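(* Let $\theta_1,\theta_2\in\,]0,\frac\pi2[$ and $x>0$. Let $(X,Y)$ be an obliquely reflected Brownian motion in the quadrant $\mathcal Q=[0,\infty[^2$ started at $(x,0)$, with angles of reflection $\theta_1$ on $\partial_1\mathcal Q=[0,\infty[\times\{0\}$ and $\theta_2$ on $\partial_2\mathcal Q=\{0\}\times[0,\infty[$, killed at the first time $\sigma_0$ at which $(X,Y)$ hits $(0,0)$. Let $L_t=L_t(X)+L_t(Y)$ be the local time accumulated at $\partial\mathcal Q$. Then: - if $\tan(\theta_1)\tan(\theta_2)>1$, then $\displaystyle\mathbb E[L_{\sigma_0}]=\frac{x(\tan(\theta_2)+1)}{\tan(\theta_1)\tan(\theta_2)-1}<\infty$; - if $\tan(\theta_1)\tan(\theta_2)\le1$, then $\mathbb E[L_{\sigma_0}]=\infty$.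
   Context: For a continuous semimartingale $Y$, $L_t(Y)=\lim_{\epsilon\to0}\frac1{2\epsilon}\int_0^t1_{\{|Y_s|\le\epsilon\}}d\langle Y\rangle_s$ is its symmetric local time at $0$. The obliquely reflected Brownian motion with angles $\theta_1,\theta_2$ is the $\mathcal Q$-valued continuous process satisfying, for $t<\sigma_0$, $$dX_t=dB^1_t+dL_t(X)-\tan(\theta_1)dL_t(Y),\qquad dY_t=dB^2_t+dL_t(Y)-\tan(\theta_2)dL_t(X),$$ with $(B^1,B^2)$ a two-dimensional Brownian motion (so that the direction of reflection is $(-\tan\theta_1,1)$ on $\partial_1\mathcal Q$ and $(1,-\tan\theta_2)$ on $\partial_2\mathcal Q$). It is known that $\sigma_0$ and $L_{\sigma_0}:=\lim_{t\uparrow\sigma_0}L_t$ are a.s. finite. *)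

theory Defs
  imports "HOL-Probability.Probability"
begin

section \<open>Planar Brownian motion with respect to a filtration\<close>

text \<open>Time is \<^typ>\<open>real\<close>; processes and filtrations are only looked at for times \<open>t \<ge> 0\<close> (a filtration
  indexed by \<open>[0,\<infinity>[\<close> is extended by \<open>F t = F 0\<close> for \<open>t < 0\<close>). No completeness or right-continuity
  of the filtration is imposed.\<close>

locale filtered_prob_space = prob_space M + filtration "space M" F
  for M :: "'w measure" and F :: "real \<Rightarrow> 'w measure" +
  assumes sub_F: "\<And>t. subalgebra M (F t)"

definition adapted :: "(real \<Rightarrow> 'w measure) \<Rightarrow> (real \<Rightarrow> 'w \<Rightarrow> 'b::topological_space) \<Rightarrow> bool" where
  "adapted F Z \<longleftrightarrow> (\<forall>t\<ge>0. Z t \<in> borel_measurable (F t))"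

locale planar_brownian_motion = filtered_prob_space M F
  for M :: "'w measure" and F :: "real \<Rightarrow> 'w measure" +
  fixes B :: "real \<Rightarrow> 'w \<Rightarrow> real \<times> real"
  assumes B_adapted: "adapted F B"
    and B_zero: "AE \<omega> in M. B 0 \<omega> = (0, 0)"
    and B_continuous: "AE \<omega> in M. continuous_on {0..} (\<lambda>t. B t \<omega>)"
    and B_increment_distributed: "\<And>s t. 0 \<le> s \<Longrightarrow> s < t \<Longrightarrow>
      distributed M lborel (\<lambda>\<omega>. B t \<omega> - B s \<omega>)
        (\<lambda>(u, v). ennreal (normal_density 0 (sqrt (t - s)) u * normal_density 0 (sqrt (t - s)) v))"
    and B_increment_indep: "\<And>s t. 0 \<le> s \<Longrightarrow> s < t \<Longrightarrow>
      indep_set (sets (F s)) (sets (vimage_algebra (space M) (\<lambda>\<omega>. B t \<omega> - B s \<omega>) borel))"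


section \<open>Quadratic variation and symmetric local time at 0, up to a random time\<close>

definition is_partition :: "real \<Rightarrow> nat \<Rightarrow> (nat \<Rightarrow> real) \<Rightarrow> bool" where
  "is_partition t n p \<longleftrightarrow> p 0 = 0 \<and> p n = t \<and> (\<forall>i<n. p i \<le> p (Suc i))"

text \<open>\<open>Q = \<langle>Z\<rangle>\<close> on the stochastic interval \<open>[0,\<sigma>[\<close>: the limit in probability, on each event \<open>{t < \<sigma>}\<close>, of
  the sums of squared increments along partitions of \<open>[0,t]\<close> whose mesh tends to \<open>0\<close>. For
  \<open>\<sigma> = \<infinity>\<close> this is the usual quadratic variation of a continuous semimartingale. The restriction to
  \<open>{t < \<sigma>}\<close> serves processes that are semimartingales only up to \<open>\<sigma>\<close>; nothing after \<open>\<sigma>\<close> matters.\<close>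

definition is_quadratic_variation ::
  "'w measure \<Rightarrow> ('w \<Rightarrow> ereal) \<Rightarrow> (real \<Rightarrow> 'w \<Rightarrow> real) \<Rightarrow> (real \<Rightarrow> 'w \<Rightarrow> real) \<Rightarrow> bool" where
  "is_quadratic_variation M \<sigma> Z Q \<longleftrightarrow>
     (\<forall>t\<ge>0. Q t \<in> borel_measurable M) \<and>
     (AE \<omega> in M. continuous_on {t. 0 \<le> t \<and> ereal t < \<sigma> \<omega>} (\<lambda>t. Q t \<omega>) \<and>
                 mono_on {t. 0 \<le> t \<and> ereal t < \<sigma> \<omega>} (\<lambda>t. Q t \<omega>)) \<and>
     (\<forall>t\<ge>0. \<forall>\<epsilon>>0. \<exists>\<delta>>0. \<forall>n p. is_partition t n p \<and> (\<forall>i<n. p (Suc i) - p i < \<delta>) \<longrightarrow>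
        measure M {\<omega> \<in> space M. ereal t < \<sigma> \<omega> \<and>
          \<bar>(\<Sum>i<n. (Z (p (Suc i)) \<omega> - Z (p i) \<omega>)\<^sup>2) - Q t \<omega>\<bar> > \<epsilon>} < \<epsilon>)"

text \<open>The Stieltjes measure \<open>dq\<close> on \<open>[0,t]\<close>. Freezing \<open>q\<close> outside \<open>[0,t]\<close> gives a function that is
  continuous and nondecreasing on all of \<open>\<real>\<close>, as \<^const>\<open>interval_measure\<close> requires, as soon as \<open>q\<close>
  has these properties on \<open>[0,t]\<close>.\<close>

definition stieltjes_measure :: "(real \<Rightarrow> real) \<Rightarrow> real \<Rightarrow> real measure" where
  "stieltjes_measure q t = interval_measure (\<lambda>s. q (max 0 (min s t)))"

definition is_symmetric_local_time ::
  "'w measure \<Rightarrow> ('w \<Rightarrow> ereal) \<Rightarrow> (real \<Rightarrow> 'w \<Rightarrow> real) \<Rightarrow> (real \<Rightarrow> 'w \<Rightarrow> real) \<Rightarrow> bool" where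
  "is_symmetric_local_time M \<sigma> Z L \<longleftrightarrow>
     (\<exists>Q. is_quadratic_variation M \<sigma> Z Q \<and>
       (AE \<omega> in M. \<forall>t\<ge>0. ereal t < \<sigma> \<omega> \<longrightarrow>
          ((\<lambda>\<epsilon>. 1 / (2 * \<epsilon>) *
              (LINT s:{0..t}|stieltjes_measure (\<lambda>s. Q s \<omega>) t. indicator {s. \<bar>Z s \<omega>\<bar> \<le> \<epsilon>} s))
           \<longlongrightarrow> L t \<omega>) (at_right 0)))"


section \<open>Obliquely reflected Brownian motion in the quadrant\<close>

definition corner_time :: "(real \<Rightarrow> 'w \<Rightarrow> real) \<Rightarrow> (real \<Rightarrow> 'w \<Rightarrow> real) \<Rightarrow> 'w \<Rightarrow> ereal" where
  "corner_time X Y \<omega> = (INF t \<in> {t. 0 \<le> t \<and> X t \<omega> = 0 \<and> Y t \<omega> = 0}. ereal t)"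

text \<open>The killed process is represented by a continuous adapted process on \<open>[0,\<infinity>[\<close> about which nothing is
  required after \<open>\<sigma>\<^sub>0 = corner_time X Y\<close> beyond staying in the quadrant (it may, for instance, be
  absorbed at the corner). The equations give the semimartingale decompositions of \<open>X\<close> and \<open>Y\<close>
  on \<open>[0,\<sigma>\<^sub>0[\<close>. The process starts at \<open>(x,y)\<close>; \<open>LX\<close> and \<open>LY\<close> are the local times \<open>L(X)\<close> and \<open>L(Y)\<close>.\<close>

locale oblique_reflected_brownian_motion = planar_brownian_motion M F B
  for M :: "'w measure" and F :: "real \<Rightarrow> 'w measure" and B :: "real \<Rightarrow> 'w \<Rightarrow> real \<times> real" +
  fixes \<theta>1 \<theta>2 x y :: real
    and X Y LX LY :: "real \<Rightarrow> 'w \<Rightarrow> real"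
  assumes X_adapted: "adapted F X" and Y_adapted: "adapted F Y"
    and LX_adapted: "adapted F LX" and LY_adapted: "adapted F LY"
    and X_continuous: "\<And>\<omega>. \<omega> \<in> space M \<Longrightarrow> continuous_on {0..} (\<lambda>t. X t \<omega>)"
    and Y_continuous: "\<And>\<omega>. \<omega> \<in> space M \<Longrightarrow> continuous_on {0..} (\<lambda>t. Y t \<omega>)"
    and in_quadrant: "\<And>\<omega> t. \<omega> \<in> space M \<Longrightarrow> 0 \<le> t \<Longrightarrow> 0 \<le> X t \<omega> \<and> 0 \<le> Y t \<omega>"
    and start: "AE \<omega> in M. X 0 \<omega> = x \<and> Y 0 \<omega> = y"
    and LX_local_time: "is_symmetric_local_time M (corner_time X Y) X LX"
    and LY_local_time: "is_symmetric_local_time M (corner_time X Y) Y LY"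
    and X_equation: "AE \<omega> in M. \<forall>t\<ge>0. ereal t < corner_time X Y \<omega> \<longrightarrow>
      X t \<omega> = X 0 \<omega> + fst (B t \<omega>) + LX t \<omega> - tan \<theta>1 * LY t \<omega>"
    and Y_equation: "AE \<omega> in M. \<forall>t\<ge>0. ereal t < corner_time X Y \<omega> \<longrightarrow>
      Y t \<omega> = Y 0 \<omega> + snd (B t \<omega>) + LY t \<omega> - tan \<theta>2 * LX t \<omega>"

text \<open>\<open>lim\<^bsub>t\<up>\<sigma>\<^esub> L t\<close>, taken in \<open>[0,\<infinity>]\<close> over extended real times, so that \<open>\<sigma> = \<infinity>\<close> needs no separate
  treatment. For \<open>\<sigma> > 0\<close> and \<open>L\<close> nondecreasing and nonnegative on \<open>[0,\<sigma>[\<close> this limit exists.\<close>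

definition terminal_value :: "('w \<Rightarrow> ereal) \<Rightarrow> (real \<Rightarrow> 'w \<Rightarrow> real) \<Rightarrow> 'w \<Rightarrow> ennreal" where
  "terminal_value \<sigma> L \<omega> = Lim (at_left (\<sigma> \<omega>)) (\<lambda>t. ennreal (L (real_of_ereal t) \<omega>))"

end

theory Submission
  imports Defs
begin

text \<open>Write \<open>a = tan \<theta>1\<close> and \<open>b = tan \<theta>2\<close>.

  Follow the process from a time at which it is at \<open>(X, Y)\<close> until \<open>X\<close> first vanishes. Up to then \<open>L(X)\<close>
  is constant, so \<open>U = X + a \<Delta>L(Y)\<close> and \<open>V = X + a Y\<close> move like linear functionals of the Brownian
  motion, and they stay nonnegative: \<open>(U, V)\<close> is a planar Brownian motion in a wedge of angle less than
  \<open>\<pi>\<close>. No mass of \<open>U + V\<close> escapes to infinity before the exit (test with the harmonic functions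
  \<open>Re (w - (1 - exp (- l w)) / l)\<close> and let \<open>l \<rightarrow> 0\<close>), so optional stopping is an equality: on average the
  stage produces local time \<open>X / a\<close> and ends at height \<open>Y + X / a\<close>. Alternating such stages between the
  two sides shows \<open>E L \<ge> u x\<close> for all iterates \<open>u\<close> of \<open>u \<mapsto> (1 + (1 + u) / b) / a\<close> from \<open>0\<close>. They tend to
  \<open>(b + 1) / (a b - 1)\<close> if \<open>a b > 1\<close> and to infinity otherwise. For \<open>a b > 1\<close> the reverse inequality is
  optional stopping of \<open>(1 + b) X + (1 + a) Y + (a b - 1) L\<close>, which is a linear functional of the Brownian
  motion.\<close>

subsection \<open>Gaussian integrals\<close>

text \<open>The upper bound rests on positivity and loses nothing by Fatou-type limits. The lower
  bound forbids any loss of mass, and this shapes the proof. In a half-plane a nonnegative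
  coordinate stopped at the boundary loses its whole mean; the wedge of one stage has angle \<pi> -
  \<open>\<theta>1\<close>, so \<open>U + V\<close> vanishes only at the apex and dominates the
  orthogonal coordinate. This bounds the test functions at the exit by an integrable variable and
  lets \<open>l\<close> tend to 0. The filtration may be neither complete nor right-continuous, and
  \<open>B\<close> has continuous paths only almost surely. Hence continuity and adaptedness are
  carried by two almost surely equal versions, stopping times are first zeros of continuous adapted
  processes, and restarts take place at deterministic times, where independence of increments is
  available. The equations hold only before \<open>\<sigma>\<close>, so a stage that may end in the
  corner is evaluated by left limits. The iterated bound is linear in the position,
  \<open>u X + v Y\<close>: a stage ends where \<open>X = 0\<close>, so the new \<open>u\<close>
  depends on \<open>v\<close> alone, and conversely for the other side.\<close>

lemma
  fixes z :: complex
  shows integrable_exp_std_normal: "integrable std_normal_distribution (\<lambda>x. exp (z * x))"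
    and integral_exp_std_normal: "(LINT x|std_normal_distribution. exp (z * x)) = exp (z\<^sup>2 / 2)"
proof -
  define f where "f = (\<lambda>x::real. std_normal_density x *\<^sub>R iexp (Im z * x))"
  define k where "k = exp ((Re z)\<^sup>2 / 2 + \<i> * (Im z * Re z))"
  interpret S: real_distribution std_normal_distribution
    by (rule real_dist_normal_dist)
  have i0: "integrable std_normal_distribution (\<lambda>x. iexp (Im z * x))"
    by (rule S.integrable_iexp) auto
  have f_int: "integrable lborel f"
    using i0 unfolding f_def by (subst (asm) integrable_density) (auto simp: normal_density_nonneg)
  have f_val: "integral\<^sup>L lborel f = exp (- (Im z)\<^sup>2 / 2)"
  proof -
    have "char std_normal_distribution (Im z) = complex_of_real (exp (- ((Im z)^2) / 2))"
      by (simp add: char_std_normal_distribution)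
    then show ?thesis
      unfolding char_def f_def by (subst (asm) integral_density) (auto simp: normal_density_nonneg exp_of_real[symmetric])
  qed
  \<comment> \<open>Completing the square: the real part of \<open>z\<close> only shifts the
    density, and what remains is the characteristic function at \<open>Im z\<close>.\<close>
  have eq: "std_normal_density x *\<^sub>R exp (z * x) = k * f (- Re z + 1 * x)" for x :: real
  proof -
    have 1: "exp (z * x) = complex_of_real (exp (Re z * x)) * iexp (Im z * x)"
      by (subst complex_eq[of z]) (simp add: exp_of_real[symmetric] exp_add[symmetric] algebra_simps)
    have 2: "std_normal_density x * exp (Re z * x) = exp ((Re z)\<^sup>2 / 2) * std_normal_density (x - Re z)"
      unfolding std_normal_density_def
      by (simp add: exp_add[symmetric] power2_eq_square field_simps)
    have 3: "k = complex_of_real (exp ((Re z)\<^sup>2 / 2)) * iexp (Im z * Re z)"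
      unfolding k_def by (simp add: exp_of_real[symmetric] exp_add[symmetric])
    have 4: "iexp (Im z * x) = iexp (Im z * Re z) * iexp (Im z * (x - Re z))"
      by (simp add: exp_add[symmetric] algebra_simps)
    have "std_normal_density x *\<^sub>R exp (z * x)
        = complex_of_real (std_normal_density x * exp (Re z * x)) * iexp (Im z * x)"
      unfolding 1 by (simp add: scaleR_conv_of_real)
    also have "\<dots> = k * f (- Re z + 1 * x)"
      unfolding 2 3 4 f_def by (simp add: scaleR_conv_of_real algebra_simps)
    finally show ?thesis .
  qed
  have i1: "integrable lborel (\<lambda>x. f (- Re z + 1 * x))"
    using f_int by (rule lborel_integrable_real_affine) simp
  show "integrable std_normal_distribution (\<lambda>x. exp (z * x))"
    using i1 by (subst integrable_density) (auto simp: normal_density_nonneg eq)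
  have "(LINT x|std_normal_distribution. exp (z * x)) = k * (LINT x|lborel. f (- Re z + 1 * x))"
    by (subst integral_density) (auto simp: normal_density_nonneg eq)
  also have "(LINT x|lborel. f (- Re z + 1 * x)) = integral\<^sup>L lborel f"
    using lborel_integral_real_affine[of 1 f "- Re z"] by simp
  also have "k * integral\<^sup>L lborel f = exp (z\<^sup>2 / 2)"
    unfolding f_val k_def exp_of_real[symmetric] exp_add[symmetric]
    by (rule arg_cong[where f=exp]) (auto simp: complex_eq_iff power2_eq_square field_simps)
  finally show "(LINT x|std_normal_distribution. exp (z * x)) = exp (z\<^sup>2 / 2)" .
qed

lemma (in prob_space)
  fixes z :: complex
  assumes X: "distributed M lborel X (normal_density 0 \<sigma>)" and \<sigma>: "0 < \<sigma>"
  shows integrable_exp_normal: "integrable M (\<lambda>w. exp (z * X w))"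
    and expectation_exp_normal: "(LINT w|M. exp (z * X w)) = exp (z\<^sup>2 * \<sigma>\<^sup>2 / 2)"
proof -
  have Y: "distributed M lborel (\<lambda>w. X w / \<sigma>) std_normal_density"
    using X normal_standard_normal_convert[OF \<sigma>, of X 0] by simp
  have [measurable]: "(\<lambda>w. X w / \<sigma>) \<in> borel_measurable M"
    using distributed_measurable[OF Y] by simp
  have eq: "exp (z * X w) = exp ((z * \<sigma>) * complex_of_real (X w / \<sigma>))" for w
    using \<sigma> by simp
  have D: "distr M lborel (\<lambda>w. X w / \<sigma>) = std_normal_distribution"
    using distributed_distr_eq_density[OF Y] by simp
  have m: "(\<lambda>x::real. exp ((z * \<sigma>) * complex_of_real x)) \<in> borel_measurable lborel"
    by measurable
  show "integrable M (\<lambda>w. exp (z * X w))"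
    unfolding eq using integrable_exp_std_normal[of "z * \<sigma>"]
    unfolding D[symmetric] by (subst (asm) integrable_distr_eq) (use m in auto)
  have "(LINT w|M. exp (z * X w)) = (LINT x|distr M lborel (\<lambda>w. X w / \<sigma>). exp ((z * \<sigma>) * x))"
    unfolding eq by (subst integral_distr) (use m in auto)
  then show "(LINT w|M. exp (z * X w)) = exp (z\<^sup>2 * \<sigma>\<^sup>2 / 2)"
    unfolding D integral_exp_std_normal by (simp add: power_mult_distrib)
qed

lemma (in prob_space)
  assumes X: "distributed M lborel X (normal_density 0 \<sigma>)" and \<sigma>: "0 < \<sigma>"
  shows integrable_normal: "integrable M X"
    and integrable_normal_power2: "integrable M (\<lambda>w. (X w)\<^sup>2)"
    and expectation_normal: "(LINT w|M. X w) = 0"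
proof -
  show "integrable M X"
    using distributed_integrable[OF X, of "\<lambda>x. x"] integrable_normal_moment_nz_1[OF \<sigma>, of 0] by simp
  show "integrable M (\<lambda>w. (X w)\<^sup>2)"
    using distributed_integrable[OF X, of "\<lambda>x. x\<^sup>2"] integrable_normal_moment[OF \<sigma>, of 0 2] by simp
  show "(LINT w|M. X w) = 0"
    using normal_distributed_expectation[OF \<sigma> X] .
qed

section \<open>Measurability along the filtration\<close>

context filtered_prob_space
begin

lemma measurable_F_M: "f \<in> measurable (F t) N \<Longrightarrow> f \<in> measurable M N"
  by (rule measurable_from_subalg[OF sub_F])

lemma sets_F_M: "A \<in> sets (F t) \<Longrightarrow> A \<in> sets M"
  using sub_F[of t] by (auto simp: subalgebra_def)

lemma measurable_F_mono: "f \<in> measurable (F s) N \<Longrightarrow> s \<le> t \<Longrightarrow> f \<in> measurable (F t) N"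
  by (rule measurable_from_subalg[of "F t" "F s"])
     (use sets_F_mono[of s t] in \<open>auto simp: subalgebra_def space_F\<close>)

lemma sets_F_mono': "A \<in> sets (F s) \<Longrightarrow> s \<le> t \<Longrightarrow> A \<in> sets (F t)"
  using sets_F_mono[of s t] by auto

end

section \<open>Law of the increments and their independence of the past\<close>

context planar_brownian_motion
begin

lemma B_measurable_F: "0 \<le> s \<Longrightarrow> s \<le> t \<Longrightarrow> B s \<in> borel_measurable (F t)"
  using B_adapted unfolding adapted_def by (auto intro: measurable_F_mono)

lemma B_measurable: "0 \<le> s \<Longrightarrow> B s \<in> borel_measurable M"
  using B_measurable_F[of s s] by (auto intro: measurable_F_M)

text \<open>\<open>H\<close> generates a part of \<open>F s\<close>, and a function of the increment
  generates a part of what the increment generates, so the assumed independence is inherited. The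
  map \<open>\<phi>\<close> brings the increment to the type of \<open>H\<close>, since
  \<open>indep_var\<close> compares variables of one type.\<close>

lemma indep_var_increment:
  fixes H :: "'w \<Rightarrow> 'b::topological_space" and \<phi> :: "real \<times> real \<Rightarrow> 'b"
  assumes st: "0 \<le> s" "s < t" and H: "H \<in> borel_measurable (F s)" and \<phi>: "\<phi> \<in> borel_measurable borel"
  shows "indep_var borel H borel (\<lambda>w. \<phi> (B t w - B s w))"
  unfolding indep_var_eq
proof (intro conjI)
  have D: "(\<lambda>w. B t w - B s w) \<in> borel_measurable M"
    using st by (intro borel_measurable_diff B_measurable) auto
  show "random_variable borel H" using H by (rule measurable_F_M)
  show "random_variable borel (\<lambda>w. \<phi> (B t w - B s w))"
    using measurable_compose[OF D \<phi>] .
  have 1: "sigma_sets (space M) {H -` A \<inter> space M |A. A \<in> sets borel} \<subseteq> sets (F s)"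
  proof (rule sets.sigma_sets_subset[of _ "F s", unfolded space_F])
    show "{H -` A \<inter> space M |A. A \<in> sets borel} \<subseteq> sets (F s)"
      using measurable_sets[OF H] by (auto simp: space_F)
  qed
  let ?V = "vimage_algebra (space M) (\<lambda>w. B t w - B s w) borel"
  have 2: "sigma_sets (space M) {(\<lambda>w. \<phi> (B t w - B s w)) -` A \<inter> space M |A. A \<in> sets borel} \<subseteq> sets ?V"
  proof (rule sets.sigma_sets_subset[of _ ?V, unfolded space_vimage_algebra])
    show "{(\<lambda>w. \<phi> (B t w - B s w)) -` A \<inter> space M |A. A \<in> sets borel} \<subseteq> sets ?V"
    proof safe
      fix A :: "'b set" assume "A \<in> sets borel"
      then have "\<phi> -` A \<in> sets borel" using measurable_sets[OF \<phi>] by auto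
      then have "(\<lambda>w. B t w - B s w) -` (\<phi> -` A) \<inter> space M \<in> sets ?V"
        by (rule in_vimage_algebra)
      then show "(\<lambda>w. \<phi> (B t w - B s w)) -` A \<inter> space M \<in> sets ?V"
        by (simp add: vimage_def)
    qed
  qed
  show "indep_set (sigma_sets (space M) {H -` A \<inter> space M |A. A \<in> sets borel})
     (sigma_sets (space M) {(\<lambda>w. \<phi> (B t w - B s w)) -` A \<inter> space M |A. A \<in> sets borel})"
    unfolding indep_sets2_eq
  proof (intro conjI ballI)
    note I = B_increment_indep[OF st, unfolded indep_sets2_eq]
    show "sigma_sets (space M) {H -` A \<inter> space M |A. A \<in> sets borel} \<subseteq> events"
      using 1 I by (rule order_trans[OF _ conjunct1])
    show "sigma_sets (space M) {(\<lambda>w. \<phi> (B t w - B s w)) -` A \<inter> space M |A. A \<in> sets borel} \<subseteq> events"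
      by (rule order_trans[OF 2 conjunct1[OF conjunct2[OF I]]])
    fix a b
    assume "a \<in> sigma_sets (space M) {H -` A \<inter> space M |A. A \<in> sets borel}"
      "b \<in> sigma_sets (space M) {(\<lambda>w. \<phi> (B t w - B s w)) -` A \<inter> space M |A. A \<in> sets borel}"
    then show "prob (a \<inter> b) = prob a * prob b"
      by (intro conjunct2[OF conjunct2[OF I], rule_format] subsetD[OF 1] subsetD[OF 2])
  qed
qed

text \<open>The joint density is a product, so the joint law is the product measure of a Gaussian
  \<open>N\<close> with itself. Its projections are the marginals, and a joint law equal to the
  product of the marginals is independence.\<close>

lemma
  assumes st: "0 \<le> s" "s < t"
  shows increment_fst_distributed:
      "distributed M lborel (\<lambda>w. fst (B t w - B s w)) (normal_density 0 (sqrt (t - s)))"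
    and increment_snd_distributed:
      "distributed M lborel (\<lambda>w. snd (B t w - B s w)) (normal_density 0 (sqrt (t - s)))"
    and increment_components_indep:
      "indep_var borel (\<lambda>w. fst (B t w - B s w)) borel (\<lambda>w. snd (B t w - B s w))"
proof -
  let ?d = "normal_density 0 (sqrt (t - s))"
  define N where "N = density lborel (\<lambda>x. ennreal (?d x))"
  define D where "D = (\<lambda>w. B t w - B s w)"
  have D_eq: "B t w - B s w = D w" for w by (simp add: D_def)
  interpret N: prob_space N
    unfolding N_def using st by (intro prob_space_normal_density) auto
  interpret NN: pair_prob_space N N ..
  have [measurable]: "D \<in> borel_measurable M"
    unfolding D_def using st by (intro borel_measurable_diff B_measurable) auto
  have [measurable]: "(\<lambda>w. fst (D w)) \<in> borel_measurable M" "(\<lambda>w. snd (D w)) \<in> borel_measurable M"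
    by (auto intro!: measurable_compose[OF \<open>D \<in> borel_measurable M\<close>] borel_measurable_continuous_onI continuous_intros)
  have sN: "sets N = sets borel" "space N = UNIV" by (auto simp: N_def)
  have NN: "N \<Otimes>\<^sub>M N = density lborel (\<lambda>(u, v). ennreal (?d u * ?d v))"
    unfolding N_def
    by (subst pair_measure_density)
       (auto simp: lborel_prod ennreal_mult'' N_def[symmetric] intro: lborel.sigma_finite_measure_axioms
         N.sigma_finite_measure_axioms intro!: arg_cong2[where f=density])
  have D: "distr M borel D = N \<Otimes>\<^sub>M N"
    using distributed_distr_eq_density[OF B_increment_distributed[OF st]]
    unfolding NN D_def by (subst distr_cong[OF refl sets_lborel[symmetric] refl]) auto
  have 1: "distr M borel (\<lambda>w. fst (D w)) = N"
  proof -
    have "distr M borel (\<lambda>w. fst (D w)) = distr (distr M borel D) borel fst"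
      by (subst distr_distr) (auto simp: comp_def borel_measurable_continuous_onI continuous_on_fst)
    also have "\<dots> = distr (N \<Otimes>\<^sub>M N) N fst" unfolding D by (rule distr_cong) (auto simp: sN)
    also have "\<dots> = N" by (rule N.distr_pair_fst)
    finally show ?thesis .
  qed
  have 2: "distr M borel (\<lambda>w. snd (D w)) = N"
  proof -
    have "distr M borel (\<lambda>w. snd (D w)) = distr (distr M borel D) borel snd"
      by (subst distr_distr) (auto simp: comp_def borel_measurable_continuous_onI continuous_on_snd)
    also have "\<dots> = distr (N \<Otimes>\<^sub>M N) N snd" unfolding D by (rule distr_cong) (auto simp: sN)
    also have "\<dots> = N"
      by (subst NN.distr_pair_swap, subst distr_distr) (auto simp: comp_def N.distr_pair_fst split_beta)
    finally show ?thesis .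
  qed
  show "distributed M lborel (\<lambda>w. fst (B t w - B s w)) ?d"
    using 1 unfolding distributed_def N_def D_eq
    by (auto cong: distr_cong)
  show "distributed M lborel (\<lambda>w. snd (B t w - B s w)) ?d"
    using 2 unfolding distributed_def N_def D_eq
    by (auto cong: distr_cong)
  show "indep_var borel (\<lambda>w. fst (B t w - B s w)) borel (\<lambda>w. snd (B t w - B s w))"
    unfolding indep_var_distribution_eq D_eq
    by (intro conjI) (measurable, simp only: 1 2 D borel_prod prod.collapse)
qed

lemma increment_measurable: "0 \<le> s \<Longrightarrow> s \<le> t \<Longrightarrow> (\<lambda>w. B t w - B s w) \<in> borel_measurable (F t)"
  by (intro borel_measurable_diff B_measurable_F) auto

lemma
  fixes H :: "'w \<Rightarrow> complex" and p q :: complex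
  assumes st: "0 \<le> s" "s \<le> t" and H: "H \<in> borel_measurable (F s)" "integrable M H"
  shows integrable_mult_exp_increment:
      "integrable M (\<lambda>w. H w * exp (p * complex_of_real (fst (B t w - B s w)) + q * complex_of_real (snd (B t w - B s w))))"
    and expectation_mult_exp_increment:
      "(LINT w|M. H w * exp (p * complex_of_real (fst (B t w - B s w)) + q * complex_of_real (snd (B t w - B s w))))
        = (LINT w|M. H w) * exp ((p\<^sup>2 + q\<^sup>2) * (t - s) / 2)"
proof -
  define E where "E = (\<lambda>w. exp (p * complex_of_real (fst (B t w - B s w)) + q * complex_of_real (snd (B t w - B s w))))"
  have "integrable M (\<lambda>w. H w * E w) \<and>
        (LINT w|M. H w * E w) = (LINT w|M. H w) * exp ((p\<^sup>2 + q\<^sup>2) * (t - s) / 2)"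
  proof (cases "s = t")
    case True
    then have "E = (\<lambda>_. 1)" by (simp add: E_def)
    with True H show ?thesis by simp
  next
    case False
    then have st': "0 \<le> s" "s < t" using st by auto
    have sig: "0 < sqrt (t - s)" using st' by simp
    have pm: "(\<lambda>x::real \<times> real. exp (p * complex_of_real (fst x) + q * complex_of_real (snd x))) \<in> borel_measurable borel"
      by (intro borel_measurable_continuous_onI continuous_intros)
    have ind: "indep_var borel H borel E"
      unfolding E_def by (rule indep_var_increment[OF st' H(1) pm])
    have ind2: "indep_var borel (\<lambda>w. exp (p * complex_of_real (fst (B t w - B s w)))) borel (\<lambda>w. exp (q * complex_of_real (snd (B t w - B s w))))"
      by (rule indep_var_compose[OF increment_components_indep[OF st'], unfolded comp_def,
            where ?Y1.0="\<lambda>x. exp (p * complex_of_real x)" and ?Y2.0="\<lambda>x. exp (q * complex_of_real x)"]) auto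
    note f = integrable_exp_normal[OF increment_fst_distributed[OF st'] sig, of p]
      expectation_exp_normal[OF increment_fst_distributed[OF st'] sig, of p]
    note g = integrable_exp_normal[OF increment_snd_distributed[OF st'] sig, of q]
      expectation_exp_normal[OF increment_snd_distributed[OF st'] sig, of q]
    have s2: "(sqrt (t - s))\<^sup>2 = t - s"
      using st' by simp
    have Ei: "integrable M E"
      unfolding E_def exp_add by (rule indep_var_integrable[OF ind2 f(1) g(1)])
    have Ev: "(LINT w|M. E w) = exp ((p\<^sup>2 + q\<^sup>2) * (t - s) / 2)"
    proof -
      have "(LINT w|M. E w) = exp (p\<^sup>2 * of_real (t - s) / 2) * exp (q\<^sup>2 * of_real (t - s) / 2)"
        unfolding E_def exp_add indep_var_lebesgue_integral[OF ind2 f(1) g(1)] f(2) g(2) s2 ..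
      then show ?thesis
        by (simp add: exp_add[symmetric] algebra_simps add_divide_distrib diff_divide_distrib)
    qed
    show ?thesis
      using indep_var_integrable[OF ind H(2) Ei] indep_var_lebesgue_integral[OF ind H(2) Ei] Ev by simp
  qed
  then show "integrable M (\<lambda>w. H w * exp (p * complex_of_real (fst (B t w - B s w)) + q * complex_of_real (snd (B t w - B s w))))"
    "(LINT w|M. H w * exp (p * complex_of_real (fst (B t w - B s w)) + q * complex_of_real (snd (B t w - B s w))))
        = (LINT w|M. H w) * exp ((p\<^sup>2 + q\<^sup>2) * (t - s) / 2)"
    by (simp_all add: E_def)
qed

text \<open>A centred increment independent of the past is orthogonal to it. With \<open>H\<close>
  an indicator this is the martingale property of linear functionals; with \<open>H\<close> an
  earlier value it removes the cross term when a square is expanded.\<close>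

lemma
  fixes p q :: real
  assumes st: "0 \<le> s" "s \<le> t"
  defines "G \<equiv> (\<lambda>w. p * fst (B t w - B s w) + q * snd (B t w - B s w))"
  shows integrable_linear_increment_power2: "integrable M (\<lambda>w. (G w)\<^sup>2)"
    and integrable_mult_linear_increment:
      "\<And>H. H \<in> borel_measurable (F s) \<Longrightarrow> integrable M H \<Longrightarrow> integrable M (\<lambda>w. H w * G w)"
    and expectation_mult_linear_increment:
      "\<And>H. H \<in> borel_measurable (F s) \<Longrightarrow> integrable M H \<Longrightarrow> (LINT w|M. H w * G w) = 0"
proof -
  have "integrable M (\<lambda>w. (G w)\<^sup>2) \<and>
    (\<forall>H. H \<in> borel_measurable (F s) \<longrightarrow> integrable M H \<longrightarrow>
      integrable M (\<lambda>w. H w * G w) \<and> (LINT w|M. H w * G w) = 0)"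
  proof (cases "s = t")
    case True
    then have "G = (\<lambda>_. 0)" by (simp add: G_def)
    then show ?thesis by simp
  next
    case False
    then have st': "0 \<le> s" "s < t" using st by auto
    have sig: "0 < sqrt (t - s)" using st' by simp
    have gm: "(\<lambda>x::real \<times> real. p * fst x + q * snd x) \<in> borel_measurable borel"
      by (intro borel_measurable_continuous_onI continuous_intros)
    note f = integrable_normal[OF increment_fst_distributed[OF st'] sig]
       integrable_normal_power2[OF increment_fst_distributed[OF st'] sig]
       expectation_normal[OF increment_fst_distributed[OF st'] sig]
    note g = integrable_normal[OF increment_snd_distributed[OF st'] sig]
       integrable_normal_power2[OF increment_snd_distributed[OF st'] sig]
       expectation_normal[OF increment_snd_distributed[OF st'] sig]
    have fg: "integrable M (\<lambda>w. fst (B t w - B s w) * snd (B t w - B s w))"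
      by (rule indep_var_integrable[OF increment_components_indep[OF st'] f(1) g(1)])
    have Gi: "integrable M G" unfolding G_def using f(1) g(1) by auto
    have G0: "(LINT w|M. G w) = 0" unfolding G_def using f g by simp
    have eq: "(G w)\<^sup>2 = p\<^sup>2 * (fst (B t w - B s w))\<^sup>2 + q\<^sup>2 * (snd (B t w - B s w))\<^sup>2
       + (2 * p * q) * (fst (B t w - B s w) * snd (B t w - B s w))" for w
      unfolding G_def by (simp add: power2_eq_square algebra_simps)
    have G2: "integrable M (\<lambda>w. (G w)\<^sup>2)"
      unfolding eq
      by (intro Bochner_Integration.integrable_add integrable_mult_right f g fg)
    show ?thesis
    proof (intro conjI allI impI G2)
      fix H :: "'w \<Rightarrow> real" assume H: "H \<in> borel_measurable (F s)" "integrable M H"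
      have ind: "indep_var borel H borel G"
        unfolding G_def by (rule indep_var_increment[OF st' H(1) gm])
      show "integrable M (\<lambda>w. H w * G w)"
        by (rule indep_var_integrable[OF ind H(2) Gi])
      show "(LINT w|M. H w * G w) = 0"
        using indep_var_lebesgue_integral[OF ind H(2) Gi] G0 by simp
    qed
  qed
  then show "integrable M (\<lambda>w. (G w)\<^sup>2)"
    "\<And>H. H \<in> borel_measurable (F s) \<Longrightarrow> integrable M H \<Longrightarrow> integrable M (\<lambda>w. H w * G w)"
    "\<And>H. H \<in> borel_measurable (F s) \<Longrightarrow> integrable M H \<Longrightarrow> (LINT w|M. H w * G w) = 0"
    by blast+
qed

end

subsection \<open>Optional stopping\<close>

text \<open>A common bound on second moments is uniform integrability in quantitative form: cutting
  off at \<open>k\<close> moves each mean by at most \<open>K / k\<close>, and the cut-off variables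
  converge boundedly. Fatou gives the limit the same second-moment bound, so \<open>k\<close> may
  tend to infinity.\<close>

lemma truncated_convergence:
  fixes f :: "nat \<Rightarrow> 'a \<Rightarrow> real"
  assumes "prob_space M"
    and meas: "\<And>n. f n \<in> borel_measurable M"
    and g: "g \<in> borel_measurable M"
    and lim: "AE x in M. (\<lambda>n. f n x) \<longlonglongrightarrow> g x"
    and sq: "\<And>n. integrable M (\<lambda>x. (f n x)\<^sup>2)" "\<And>n. (LINT x|M. (f n x)\<^sup>2) \<le> K"
    and e: "\<And>n. (LINT x|M. f n x) = e"
  shows "integrable M g" "(LINT x|M. g x) = e"
proof -
  interpret prob_space M by fact
  note [measurable] = meas g
  have K0: "0 \<le> K"
    by (rule order_trans[OF _ sq(2)[of 0]]) (auto intro: integral_nonneg_AE)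
  have fint: "integrable M (f n)" for n
    by (rule square_integrable_imp_integrable) (use sq in auto)
  have "(\<integral>\<^sup>+x. ennreal ((g x)\<^sup>2) \<partial>M) = (\<integral>\<^sup>+x. liminf (\<lambda>n. ennreal ((f n x)\<^sup>2)) \<partial>M)"
    using lim by (intro nn_integral_cong_AE, eventually_elim)
      (auto intro!: lim_imp_Liminf[symmetric] tendsto_intros tendsto_ennrealI)
  also have "\<dots> \<le> liminf (\<lambda>n. \<integral>\<^sup>+x. ennreal ((f n x)\<^sup>2) \<partial>M)"
    by (rule nn_integral_liminf) measurable
  also have "\<dots> \<le> liminf (\<lambda>n::nat. ennreal K)"
    using sq by (intro Liminf_mono always_eventually allI) (simp add: nn_integral_eq_integral ennreal_leI)
  also have "\<dots> = ennreal K" by (simp add: Liminf_const)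
  finally have gsq': "(\<integral>\<^sup>+x. ennreal ((g x)\<^sup>2) \<partial>M) \<le> ennreal K" .
  have gsq: "integrable M (\<lambda>x. (g x)\<^sup>2)"
    using gsq' by (intro integrableI_bounded) (auto intro: le_less_trans)
  show gint: "integrable M g"
    by (rule square_integrable_imp_integrable) (use gsq in auto)
  have gK: "(LINT x|M. (g x)\<^sup>2) \<le> K"
    using gsq' K0 by (subst (asm) nn_integral_eq_integral) (auto simp: gsq)
  define c where "c = (\<lambda>k y::real. max (- k) (min k y))"
  have cbd: "\<bar>c k y - y\<bar> \<le> y\<^sup>2 / k" if "k > 0" for k y
  proof (cases "\<bar>y\<bar> \<le> k")
    case True then show ?thesis using that unfolding c_def by auto
  next
    case False
    then have "k * \<bar>y\<bar> \<le> \<bar>y\<bar> * \<bar>y\<bar>" by (intro mult_right_mono) auto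
    then have "\<bar>y\<bar> \<le> y\<^sup>2 / k" using that by (simp add: field_simps power2_eq_square)
    moreover have "\<bar>c k y - y\<bar> \<le> \<bar>y\<bar>" using that unfolding c_def by auto
    ultimately show ?thesis by linarith
  qed
  have [measurable]: "c k \<in> borel_measurable borel" for k unfolding c_def by measurable
  have cint: "integrable M (\<lambda>x. c k (h x))" if "k > 0" "h \<in> borel_measurable M" for k h
    by (rule integrable_const_bound[where B=k]) (use that in \<open>auto simp: c_def\<close>)
  have est: "\<bar>(LINT x|M. c k (h x)) - (LINT x|M. h x)\<bar> \<le> K / k"
    if "k > 0" "integrable M h" "integrable M (\<lambda>x. (h x)\<^sup>2)" "(LINT x|M. (h x)\<^sup>2) \<le> K" for k h
  proof -
    have "\<bar>(LINT x|M. c k (h x)) - (LINT x|M. h x)\<bar> = \<bar>LINT x|M. c k (h x) - h x\<bar>"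
      using that cint by (subst Bochner_Integration.integral_diff) auto
    also have "\<dots> \<le> (LINT x|M. \<bar>c k (h x) - h x\<bar>)" by (rule integral_abs_bound)
    also have "\<dots> \<le> (LINT x|M. (h x)\<^sup>2 / k)"
      using that cint cbd by (intro integral_mono) auto
    also have "\<dots> \<le> K / k" using that by (simp add: divide_right_mono)
    finally show ?thesis .
  qed
  have main: "\<bar>(LINT x|M. g x) - e\<bar> \<le> 2 * K / k" if "k > 0" for k
  proof -
    have "(\<lambda>n. LINT x|M. c k (f n x)) \<longlonglongrightarrow> (LINT x|M. c k (g x))"
    proof (rule integral_dominated_convergence[where w="\<lambda>_. k"])
      show "AE x in M. (\<lambda>n. c k (f n x)) \<longlonglongrightarrow> c k (g x)"
        using lim unfolding c_def by eventually_elim (auto intro!: tendsto_intros)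
    qed (use that in \<open>auto simp: c_def\<close>)
    then have "(\<lambda>n. \<bar>(LINT x|M. c k (f n x)) - e\<bar>) \<longlonglongrightarrow> \<bar>(LINT x|M. c k (g x)) - e\<bar>"
      by (intro tendsto_intros)
    moreover have "\<bar>(LINT x|M. c k (f n x)) - e\<bar> \<le> K / k" for n
      using est[OF that fint sq(1) sq(2), of n] by (simp add: e)
    ultimately have "\<bar>(LINT x|M. c k (g x)) - e\<bar> \<le> K / k"
      by (intro LIMSEQ_le_const2) auto
    then show ?thesis using est[OF that gint gsq gK] by simp
  qed
  have "\<bar>(LINT x|M. g x) - e\<bar> \<le> 0"
  proof (rule LIMSEQ_le_const)
    show "(\<lambda>n. 2 * K / real (Suc n)) \<longlonglongrightarrow> 0"
      by (rule LIMSEQ_Suc[OF lim_const_over_n])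
  qed (use main in \<open>auto simp del: of_nat_Suc\<close>)
  then show "(LINT x|M. g x) = e" by simp
qed

lemma integrable_indicator_mult:
  fixes f :: "'a \<Rightarrow> real"
  shows "A \<in> sets M \<Longrightarrow> integrable M f \<Longrightarrow> integrable M (\<lambda>x. indicator A x * f x)"
  using integrable_mult_indicator[of A M f] by simp

context filtered_prob_space
begin

text \<open>\<open>D\<close> bounds the stopped variables in \<open>L\<^sup>2\<close>, hence makes them uniformly integrable. \<open>N\<close> itself need not be
  adapted: it will only be equal almost surely to an adapted process.\<close>

lemma optional_stopping:
  fixes N D :: "real \<Rightarrow> 'w \<Rightarrow> real" and T :: "'w \<Rightarrow> ereal"
  assumes st: "s \<le> t"
    and T: "\<And>r. s \<le> r \<Longrightarrow> r \<le> t \<Longrightarrow> {w \<in> space M. T w \<le> ereal r} \<in> sets (F r)"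
    and cont: "\<And>w. w \<in> space M \<Longrightarrow> continuous_on {s..t} (\<lambda>r. N r w)"
    and Nm: "\<And>r. s \<le> r \<Longrightarrow> r \<le> t \<Longrightarrow> N r \<in> borel_measurable M"
    and mart: "\<And>r C. s \<le> r \<Longrightarrow> r \<le> t \<Longrightarrow> C \<in> sets (F r) \<Longrightarrow>
      (LINT w|M. indicator C w * N r w) = (LINT w|M. indicator C w * N t w)"
    and D: "\<And>r w. s \<le> r \<Longrightarrow> r \<le> t \<Longrightarrow> w \<in> space M \<Longrightarrow> \<bar>N r w\<bar> \<le> D r w"
    and Dint: "\<And>r. s \<le> r \<Longrightarrow> r \<le> t \<Longrightarrow> integrable M (\<lambda>w. (D r w)\<^sup>2)"
    and sub: "\<And>r C. s \<le> r \<Longrightarrow> r \<le> t \<Longrightarrow> C \<in> sets (F r) \<Longrightarrow>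
      (LINT w|M. indicator C w * (D r w)\<^sup>2) \<le> (LINT w|M. indicator C w * (D t w)\<^sup>2)"
  shows "integrable M (\<lambda>w. N (real_of_ereal (max s (min (T w) t))) w)"
    and "(LINT w|M. N (real_of_ereal (max s (min (T w) t))) w) = (LINT w|M. N s w)"
proof -
  \<comment> \<open>\<open>T w\<close> may lie below \<open>s\<close> or beyond \<open>t\<close>; it
    is clipped to the interval, so the real value is never a default.\<close>
  define \<tau> where "\<tau> = (\<lambda>w. real_of_ereal (max s (min (T w) t)))"
  have \<tau>: "ereal (\<tau> w) = max s (min (T w) t)" for w
    unfolding \<tau>_def by (subst ereal_real) (auto simp: max_def min_def)
  have \<tau>_bounds: "s \<le> \<tau> w" "\<tau> w \<le> t" for w
    using st by (simp_all add: ereal_less_eq(3)[symmetric] \<tau> del: ereal_less_eq(3))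
  define h where "h = (\<lambda>n::nat. (t - s) / real (Suc n))"
  define g where "g = (\<lambda>n k. s + real k * h n)"
  have h0: "0 \<le> h n" for n using st by (simp add: h_def)
  have g_bounds: "s \<le> g n k" "k \<le> Suc n \<Longrightarrow> g n k \<le> t" for n k
  proof -
    show "s \<le> g n k" using h0 by (simp add: g_def)
    assume "k \<le> Suc n"
    then have "real k * h n \<le> real (Suc n) * h n" using h0 by (intro mult_right_mono) auto
    then show "g n k \<le> t" by (simp add: g_def h_def)
  qed
  have g_last: "g n (Suc n) = t" for n by (simp add: g_def h_def)
  \<comment> \<open>\<open>\<kappa> n w\<close> is the index of the first grid point not before
    \<open>T w\<close>. The alternative \<open>k = Suc n\<close> keeps the minimum defined for paths
    that have not stopped by \<open>t\<close>; they are stopped at the last grid point, which is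
    \<open>t\<close>.\<close>
  define \<kappa> where "\<kappa> = (\<lambda>n w. LEAST k. k = Suc n \<or> T w \<le> g n k)"
  have \<kappa>1: "\<kappa> n w = Suc n \<or> T w \<le> g n (\<kappa> n w)" for n w
    unfolding \<kappa>_def by (rule LeastI[of _ "Suc n"]) simp
  have \<kappa>2: "\<kappa> n w \<le> Suc n" for n w
    unfolding \<kappa>_def by (rule Least_le) simp
  have \<kappa>3: "\<not> T w \<le> g n j" if "j < \<kappa> n w" for n w j
    using not_less_Least[OF that[unfolded \<kappa>_def]] by auto
  have close: "\<bar>g n (\<kappa> n w) - \<tau> w\<bar> \<le> h n" for n w
  proof -
    have 1: "\<tau> w \<le> g n (\<kappa> n w)"
    proof (cases "\<kappa> n w = Suc n")
      case True
      then show ?thesis using \<tau>_bounds g_last by simp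
    next
      case False
      then have "T w \<le> g n (\<kappa> n w)" using \<kappa>1 by auto
      then have "ereal (\<tau> w) \<le> ereal (g n (\<kappa> n w))"
        unfolding \<tau> using g_bounds(1) by (auto simp: min_le_iff_disj)
      then show ?thesis by simp
    qed
    have "g n (\<kappa> n w) \<le> \<tau> w + h n"
    proof (cases "\<kappa> n w")
      case 0
      then show ?thesis using \<tau>_bounds(1)[of w] h0[of n] by (simp add: g_def)
    next
      case (Suc j)
      then have "\<not> T w \<le> g n j" by (intro \<kappa>3) simp
      moreover have "g n j \<le> t" using Suc \<kappa>2[of n w] by (intro g_bounds) simp
      ultimately have "ereal (g n j) \<le> ereal (\<tau> w)"
        unfolding \<tau> by (auto simp: le_max_iff_disj)
      then show ?thesis unfolding Suc by (simp add: g_def algebra_simps)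
    qed
    then show ?thesis using 1 by simp
  qed
  define A where "A = (\<lambda>n k. {w \<in> space M. \<kappa> n w = k})"
  \<comment> \<open>Rounding is upwards so that stopping at a grid point is decided by what is known
    at that point.\<close>
  have A: "A n k \<in> sets (F (g n k))" if k: "k \<le> Suc n" for n k
  proof -
    have "A n k = (if k = Suc n then space M else {w \<in> space M. T w \<le> g n k})
        - (\<Union>j<k. {w \<in> space M. T w \<le> g n j})"
    proof (intro set_eqI iffI)
      fix w assume "w \<in> A n k"
      then have w: "w \<in> space M" "\<kappa> n w = k" by (auto simp: A_def)
      then show "w \<in> (if k = Suc n then space M else {w \<in> space M. T w \<le> g n k})
        - (\<Union>j<k. {w \<in> space M. T w \<le> g n j})"
        using \<kappa>1[of n w] \<kappa>3[of _ n w] by auto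
    next
      fix w assume *: "w \<in> (if k = Suc n then space M else {w \<in> space M. T w \<le> g n k})
        - (\<Union>j<k. {w \<in> space M. T w \<le> g n j})"
      then have w: "w \<in> space M" by (auto split: if_splits)
      have "\<kappa> n w = k"
        unfolding \<kappa>_def
      proof (rule Least_equality)
        show "k = Suc n \<or> T w \<le> g n k" using * by (auto split: if_splits)
        fix j assume "j = Suc n \<or> T w \<le> g n j"
        then show "k \<le> j" using * w k by (auto simp: not_less[symmetric])
      qed
      then show "w \<in> A n k" using w by (simp add: A_def)
    qed
    moreover have "{w \<in> space M. T w \<le> g n j} \<in> sets (F (g n k))" if "j \<le> k" for j
    proof (rule sets_F_mono')
      show "{w \<in> space M. T w \<le> g n j} \<in> sets (F (g n j))"
        using that k by (intro T g_bounds) auto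
      show "g n j \<le> g n k"
        using that h0 unfolding g_def by (auto intro: mult_right_mono)
    qed
    moreover have "space M \<in> sets (F (g n k))"
      using sets.top[of "F (g n k)"] by (simp add: space_F)
    ultimately show ?thesis by auto
  qed
  have A_M[measurable]: "A n k \<in> sets M" if "k \<le> Suc n" for n k
    using A[OF that] by (rule sets_F_M)
  have sum_ind: "(\<Sum>k\<le>Suc n. indicator (A n k) w * c k) = (c (\<kappa> n w)::real)" if "w \<in> space M" for n w c
    using that \<kappa>2[of n w] by (simp add: A_def indicator_def if_distrib[of "\<lambda>x. x * _"] sum.delta cong: if_cong)
  define f where "f = (\<lambda>n w. \<Sum>k\<le>Suc n. indicator (A n k) w * N (g n k) w)"
  have f: "f n w = N (g n (\<kappa> n w)) w" if "w \<in> space M" for n w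
    unfolding f_def using that by (rule sum_ind)
  have lim: "(\<lambda>n. f n w) \<longlonglongrightarrow> N (\<tau> w) w" if w: "w \<in> space M" for w
  proof -
    have "(\<lambda>n. g n (\<kappa> n w) - \<tau> w) \<longlonglongrightarrow> 0"
    proof (rule Lim_null_comparison)
      show "\<forall>\<^sub>F n in sequentially. norm (g n (\<kappa> n w) - \<tau> w) \<le> h n"
        using close by simp
      show "h \<longlonglongrightarrow> 0"
        unfolding h_def by (rule LIMSEQ_Suc[OF lim_const_over_n])
    qed
    then have "(\<lambda>n. g n (\<kappa> n w)) \<longlonglongrightarrow> \<tau> w"
      by (simp add: LIM_zero_iff)
    then have "(\<lambda>n. N (g n (\<kappa> n w)) w) \<longlonglongrightarrow> N (\<tau> w) w"
      by (rule continuous_on_tendsto_compose[OF cont[OF w]])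
         (use \<tau>_bounds g_bounds \<kappa>2 in auto)
    then show ?thesis using w by (simp add: f)
  qed
  have Nt_int: "integrable M (N r)" if "s \<le> r" "r \<le> t" for r
  proof (rule square_integrable_imp_integrable)
    show "integrable M (\<lambda>x. (N r x)\<^sup>2)"
      by (rule Bochner_Integration.integrable_bound[OF Dint[OF that]])
         (use Nm[OF that] D[OF that] in \<open>auto intro!: abs_le_square_iff[THEN iffD1] order_trans[OF D[OF that] abs_ge_self]\<close>)
  qed (use Nm[OF that] in auto)
  have fm: "f n \<in> borel_measurable M" for n
    unfolding f_def using Nm g_bounds
    by (intro borel_measurable_sum borel_measurable_times borel_measurable_indicator A_M) auto
  have fint: "(LINT w|M. f n w) = (LINT w|M. N s w)" for n
  proof -
    have "(LINT w|M. f n w) = (\<Sum>k\<le>Suc n. LINT w|M. indicator (A n k) w * N (g n k) w)"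
      unfolding f_def using A_M Nt_int g_bounds
      by (intro Bochner_Integration.integral_sum) (auto intro!: integrable_indicator_mult)
    also have "\<dots> = (\<Sum>k\<le>Suc n. LINT w|M. indicator (A n k) w * N t w)"
      using A g_bounds by (intro sum.cong refl mart) auto
    also have "\<dots> = (LINT w|M. (\<Sum>k\<le>Suc n. indicator (A n k) w * N t w))"
      using A_M Nt_int st
      by (intro Bochner_Integration.integral_sum[symmetric]) (auto intro!: integrable_indicator_mult)
    also have "\<dots> = (LINT w|M. N t w)"
      by (intro Bochner_Integration.integral_cong refl sum_ind)
    also have "\<dots> = (LINT w|M. indicator (space M) w * N t w)"
      by (intro Bochner_Integration.integral_cong) auto
    also have "\<dots> = (LINT w|M. indicator (space M) w * N s w)"
      using st sets.top[of "F s"] by (intro mart[symmetric]) (auto simp: space_F)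
    also have "\<dots> = (LINT w|M. N s w)"
      by (intro Bochner_Integration.integral_cong) auto
    finally show ?thesis .
  qed
  \<comment> \<open>On each event \<open>A n k\<close> the submartingale \<open>D\<^sup>2\<close> is
    moved from the grid point to the final time. As these events partition the space, the second
    moments get a bound that does not depend on the mesh.\<close>
  define q where "q = (\<lambda>n w. \<Sum>k\<le>Suc n. indicator (A n k) w * (D (g n k) w)\<^sup>2)"
  have q: "(f n w)\<^sup>2 \<le> q n w" if "w \<in> space M" for n w
    unfolding f[OF that] q_def sum_ind[OF that]
    by (rule abs_le_square_iff[THEN iffD1, OF order_trans[OF D[OF g_bounds(1) g_bounds(2)[OF \<kappa>2] that] abs_ge_self]])
  have q_int: "integrable M (q n)" for n
    unfolding q_def using A_M Dint g_bounds
    by (intro Bochner_Integration.integrable_sum) (auto intro!: integrable_indicator_mult)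
  have q_val: "(LINT w|M. q n w) \<le> (LINT w|M. (D t w)\<^sup>2)" for n
  proof -
    have "(LINT w|M. q n w) = (\<Sum>k\<le>Suc n. LINT w|M. indicator (A n k) w * (D (g n k) w)\<^sup>2)"
      unfolding q_def using A_M Dint g_bounds
      by (intro Bochner_Integration.integral_sum) (auto intro!: integrable_indicator_mult)
    also have "\<dots> \<le> (\<Sum>k\<le>Suc n. LINT w|M. indicator (A n k) w * (D t w)\<^sup>2)"
      using A g_bounds by (intro sum_mono sub) auto
    also have "\<dots> = (LINT w|M. (\<Sum>k\<le>Suc n. indicator (A n k) w * (D t w)\<^sup>2))"
      using A_M Dint st
      by (intro Bochner_Integration.integral_sum[symmetric]) (auto intro!: integrable_indicator_mult)
    also have "\<dots> = (LINT w|M. (D t w)\<^sup>2)"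
      by (intro Bochner_Integration.integral_cong refl sum_ind)
    finally show ?thesis .
  qed
  have fsq: "integrable M (\<lambda>w. (f n w)\<^sup>2)" for n
    by (rule Bochner_Integration.integrable_bound[OF q_int[of n]])
       (use fm q in \<open>auto intro!: order_trans[OF q abs_ge_self]\<close>)
  have fsq_le: "(LINT w|M. (f n w)\<^sup>2) \<le> (LINT w|M. (D t w)\<^sup>2)" for n
    by (rule order_trans[OF integral_mono[OF fsq q_int q] q_val])
  have gm: "(\<lambda>w. N (\<tau> w) w) \<in> borel_measurable M"
    by (rule borel_measurable_LIMSEQ_real[OF lim fm])
  have "AE w in M. (\<lambda>n. f n w) \<longlonglongrightarrow> N (\<tau> w) w"
    using lim by simp
  note tc = truncated_convergence[OF prob_space_axioms fm gm this fsq fsq_le fint]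
  show "integrable M (\<lambda>w. N (real_of_ereal (max s (min (T w) t))) w)"
    using tc(1) by (simp add: \<tau>_def)
  show "(LINT w|M. N (real_of_ereal (max s (min (T w) t))) w) = (LINT w|M. N s w)"
    using tc(2) by (simp add: \<tau>_def)
qed

end

section \<open>Stopped linear and exponential martingales\<close>

context planar_brownian_motion
begin

text \<open>The paths of \<open>B\<close> are continuous only almost surely. \<open>Bc\<close> is continuous everywhere, at the price of
  being adapted only up to null sets.\<close>

definition good_paths :: "'w set" where
  "good_paths = (SOME G. G \<in> sets M \<and> (AE w in M. w \<in> G) \<and>
     (\<forall>w\<in>G. B 0 w = (0, 0) \<and> continuous_on {0..} (\<lambda>t. B t w)))"

definition Bc :: "real \<Rightarrow> 'w \<Rightarrow> real \<times> real" where
  "Bc t w = (if w \<in> good_paths then B t w else 0)"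

abbreviation "dB1 s t w \<equiv> fst (Bc t w - Bc s w)"
abbreviation "dB2 s t w \<equiv> snd (Bc t w - Bc s w)"

lemma good_paths:
  "good_paths \<in> sets M" "AE w in M. w \<in> good_paths"
  "w \<in> good_paths \<Longrightarrow> B 0 w = (0, 0)" "w \<in> good_paths \<Longrightarrow> continuous_on {0..} (\<lambda>t. B t w)"
proof -
  have "AE w in M. B 0 w = (0, 0) \<and> continuous_on {0..} (\<lambda>t. B t w)"
    using B_zero B_continuous by eventually_elim simp
  then obtain N where N: "{w \<in> space M. \<not> (B 0 w = (0, 0) \<and> continuous_on {0..} (\<lambda>t. B t w))} \<subseteq> N"
      "emeasure M N = 0" "N \<in> sets M"
    by (rule AE_E)
  have "\<exists>G. G \<in> sets M \<and> (AE w in M. w \<in> G) \<and>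
     (\<forall>w\<in>G. B 0 w = (0, 0) \<and> continuous_on {0..} (\<lambda>t. B t w))"
  proof (intro exI[of _ "space M - N"] conjI)
    show "AE w in M. w \<in> space M - N"
      using AE_not_in[of N M] N AE_space[of M] by (auto simp: null_sets_def)
  qed (use N in auto)
  from someI_ex[OF this]
  show "good_paths \<in> sets M" "AE w in M. w \<in> good_paths"
    "w \<in> good_paths \<Longrightarrow> B 0 w = (0, 0)" "w \<in> good_paths \<Longrightarrow> continuous_on {0..} (\<lambda>t. B t w)"
    unfolding good_paths_def by blast+
qed

lemma Bc_measurable: "0 \<le> t \<Longrightarrow> Bc t \<in> borel_measurable M"
  unfolding Bc_def[abs_def] using good_paths(1)
  by (intro measurable_If_set B_measurable borel_measurable_const) auto

lemma Bc_AE: "AE w in M. \<forall>t. Bc t w = B t w"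
  using good_paths(2) by eventually_elim (simp add: Bc_def)

lemma Bc_0: "Bc 0 w = 0"
  using good_paths(3) by (simp add: Bc_def zero_prod_def)

lemma Bc_continuous: "continuous_on {0..} (\<lambda>t. Bc t w)"
  using good_paths(4) by (cases "w \<in> good_paths") (simp_all add: Bc_def)

text \<open>Here \<open>A\<close> and the bounded \<open>\<zeta>\<close> stand for a start known at
  time \<open>s\<close>. \<open>NB\<close>, built from \<open>B\<close>, is adapted;
  \<open>N\<close>, built from \<open>Bc\<close>, has continuous paths. They agree almost surely, so
  integrals computed for the one hold for the other.\<close>

lemma
  fixes p q s t :: real and \<zeta> :: "'w \<Rightarrow> real" and T :: "'w \<Rightarrow> ereal"
  assumes st: "0 \<le> s" "s \<le> t"
    and T: "\<And>r. s \<le> r \<Longrightarrow> r \<le> t \<Longrightarrow> {w \<in> space M. T w \<le> ereal r} \<in> sets (F r)"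
    and A: "A \<in> sets (F s)" and \<zeta>: "\<zeta> \<in> borel_measurable (F s)" "\<And>w. w \<in> A \<Longrightarrow> \<bar>\<zeta> w\<bar> \<le> K"
  defines "N \<equiv> \<lambda>r w. indicator A w * (\<zeta> w + (p * dB1 s r w + q * dB2 s r w))"
  shows integrable_stopped_linear: "integrable M (\<lambda>w. N (real_of_ereal (max (ereal s) (min (T w) (ereal t)))) w)"
    and expectation_stopped_linear:
      "(LINT w|M. N (real_of_ereal (max (ereal s) (min (T w) (ereal t)))) w) = (LINT w|M. indicator A w * \<zeta> w)"
proof -
  define L where "L = (\<lambda>r w. p * fst (B r w - B s w) + q * snd (B r w - B s w))"
  define G where "G = (\<lambda>r w. p * fst (B t w - B r w) + q * snd (B t w - B r w))"
  define NB where "NB = (\<lambda>r w. indicator A w * (\<zeta> w + L r w))"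
  have eqB: "AE w in M. \<forall>r. N r w = NB r w"
    using Bc_AE by eventually_elim (simp add: N_def NB_def L_def)
  have lin: "(\<lambda>x::real \<times> real. p * fst x + q * snd x) \<in> borel_measurable borel"
    by (intro borel_measurable_continuous_onI continuous_intros)
  have L_meas: "L r \<in> borel_measurable (F r)" if "s \<le> r" for r
    unfolding L_def using measurable_compose[OF increment_measurable[OF st(1) that] lin] .
  have NB_meas: "NB r \<in> borel_measurable (F r)" if "s \<le> r" for r
    unfolding NB_def
    using L_meas[OF that] measurable_F_mono[OF \<zeta>(1) that] sets_F_mono'[OF A that] by simp
  have N_meas: "N r \<in> borel_measurable M" if "s \<le> r" for r
  proof -
    have "(\<lambda>w. Bc r w - Bc s w) \<in> borel_measurable M"
      using st that by (intro borel_measurable_diff Bc_measurable) auto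
    from measurable_compose[OF this lin] show ?thesis
      unfolding N_def using measurable_F_M[OF \<zeta>(1)] sets_F_M[OF A] by simp
  qed
  have NB_sq: "integrable M (\<lambda>w. (NB r w)\<^sup>2)" if r: "s \<le> r" for r
  proof (rule Bochner_Integration.integrable_bound)
    show "integrable M (\<lambda>w. 2 * K\<^sup>2 + 2 * (L r w)\<^sup>2)"
      using integrable_linear_increment_power2[OF st(1) r, of p q] unfolding L_def by simp
    show "(\<lambda>w. (NB r w)\<^sup>2) \<in> borel_measurable M"
      using measurable_F_M[OF NB_meas[OF r]] by simp
    have "(NB r w)\<^sup>2 \<le> 2 * K\<^sup>2 + 2 * (L r w)\<^sup>2" for w
    proof (cases "w \<in> A")
      case True
      have "(\<zeta> w + L r w)\<^sup>2 \<le> 2 * (\<zeta> w)\<^sup>2 + 2 * (L r w)\<^sup>2"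
        using sum_squares_bound[of "\<zeta> w" "L r w"] by (simp add: power2_sum)
      moreover have "(\<zeta> w)\<^sup>2 \<le> K\<^sup>2"
        by (rule abs_le_square_iff[THEN iffD1, OF order_trans[OF \<zeta>(2)[OF True] abs_ge_self]])
      ultimately show ?thesis using True by (simp add: NB_def)
    qed (simp add: NB_def)
    then show "AE w in M. norm ((NB r w)\<^sup>2) \<le> norm (2 * K\<^sup>2 + 2 * (L r w)\<^sup>2)"
      by simp
  qed
  have NB_int: "integrable M (NB r)" if "s \<le> r" for r
    by (rule square_integrable_imp_integrable[OF _ NB_sq[OF that]])
       (rule measurable_F_M[OF NB_meas[OF that]])
  have NB_t: "NB t w = NB r w + indicator A w * G r w" for r w
    unfolding NB_def L_def G_def by (simp add: algebra_simps)
  have mart: "(LINT w|M. indicator C w * N r w) = (LINT w|M. indicator C w * N t w)"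
    if r: "s \<le> r" "r \<le> t" and C: "C \<in> sets (F r)" for r C
  proof -
    note CM = sets_F_M[OF C] and AM = sets_F_M[OF A]
    have r0: "0 \<le> r" using st r by simp
    have AC: "A \<inter> C \<in> sets (F r)" using C sets_F_mono'[OF A r(1)] by auto
    have ACi: "integrable M (indicator (A \<inter> C) :: 'w \<Rightarrow> real)"
      using CM AM by (intro integrable_real_indicator) (auto simp: less_top[symmetric])
    have 1: "integrable M (\<lambda>w. indicator (A \<inter> C) w * G r w)"
      "(LINT w|M. indicator (A \<inter> C) w * G r w) = 0"
      using integrable_mult_linear_increment[OF r0 r(2) _ ACi, of p q]
        expectation_mult_linear_increment[OF r0 r(2) _ ACi, of p q] AC
      unfolding G_def by auto
    have "(LINT w|M. indicator C w * N t w) = (LINT w|M. indicator C w * NB t w)"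
      using eqB N_meas[of t] measurable_F_M[OF NB_meas[of t]] CM st by (intro integral_cong_AE) auto
    also have "\<dots> = (LINT w|M. indicator C w * NB r w + indicator (A \<inter> C) w * G r w)"
      unfolding NB_t[of _ r] by (simp add: algebra_simps indicator_inter_arith)
    also have "\<dots> = (LINT w|M. indicator C w * NB r w)"
      using 1 CM NB_int[OF r(1)]
      by (subst Bochner_Integration.integral_add) (auto intro!: integrable_indicator_mult)
    also have "\<dots> = (LINT w|M. indicator C w * N r w)"
      using eqB N_meas[OF r(1)] measurable_F_M[OF NB_meas[OF r(1)]] CM by (intro integral_cong_AE) auto
    finally show ?thesis ..
  qed
  \<comment> \<open>When the square of \<open>NB t\<close> is expanded around \<open>NB r\<close>,
    the cross term integrates to 0 and the square of the increment is nonnegative. So the square is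
    a submartingale, and \<open>\<bar>N\<bar>\<close> can serve as its own dominating
    process.\<close>
  have sub: "(LINT w|M. indicator C w * (\<bar>N r w\<bar>)\<^sup>2) \<le> (LINT w|M. indicator C w * (\<bar>N t w\<bar>)\<^sup>2)"
    if r: "s \<le> r" "r \<le> t" and C: "C \<in> sets (F r)" for r C
  proof -
    note CM = sets_F_M[OF C] and AM = sets_F_M[OF A]
    have r0: "0 \<le> r" using st r by simp
    define H where "H = (\<lambda>w. indicator C w * NB r w)"
    have H: "H \<in> borel_measurable (F r)" "integrable M H"
      unfolding H_def using C NB_meas[OF r(1)] CM NB_int[OF r(1)]
      by (auto intro!: integrable_indicator_mult)
    have 1: "integrable M (\<lambda>w. H w * G r w)" "(LINT w|M. H w * G r w) = 0"
      using integrable_mult_linear_increment[OF r0 r(2) H, of p q]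
        expectation_mult_linear_increment[OF r0 r(2) H, of p q]
      unfolding G_def by auto
    have "(LINT w|M. indicator C w * (\<bar>N r w\<bar>)\<^sup>2) = (LINT w|M. indicator C w * (NB r w)\<^sup>2)"
      using eqB N_meas[OF r(1)] measurable_F_M[OF NB_meas[OF r(1)]] CM by (intro integral_cong_AE) auto
    also have "\<dots> = (LINT w|M. indicator C w * (NB r w)\<^sup>2 + 2 * (H w * G r w))"
      using 1 CM NB_sq[OF r(1)]
      by (subst Bochner_Integration.integral_add) (auto intro!: integrable_indicator_mult)
    also have "\<dots> \<le> (LINT w|M. indicator C w * (NB t w)\<^sup>2)"
    proof (rule integral_mono)
      show "integrable M (\<lambda>w. indicator C w * (NB r w)\<^sup>2 + 2 * (H w * G r w))"
        using 1 CM NB_sq[OF r(1)] by (auto intro!: integrable_indicator_mult)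
      show "integrable M (\<lambda>w. indicator C w * (NB t w)\<^sup>2)"
        using CM NB_sq[OF st(2)] by (auto intro!: integrable_indicator_mult)
      show "indicator C w * (NB r w)\<^sup>2 + 2 * (H w * G r w) \<le> indicator C w * (NB t w)\<^sup>2" for w
        unfolding H_def NB_t[of w r]
        by (cases "w \<in> A"; cases "w \<in> C") (auto simp: power2_sum NB_def distrib_right distrib_left)
    qed
    also have "\<dots> = (LINT w|M. indicator C w * (\<bar>N t w\<bar>)\<^sup>2)"
      using eqB N_meas[of t] measurable_F_M[OF NB_meas[of t]] CM st by (intro integral_cong_AE) auto
    finally show ?thesis .
  qed
  have Nsq: "integrable M (\<lambda>w. (\<bar>N r w\<bar>)\<^sup>2)" if "s \<le> r" for r
    using eqB N_meas[OF that] measurable_F_M[OF NB_meas[OF that]]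
    by (subst integrable_cong_AE[where g="\<lambda>w. (NB r w)\<^sup>2"]) (auto intro: NB_sq that)
  have cont: "continuous_on {s..t} (\<lambda>r. N r w)" for w
  proof -
    have "continuous_on {s..t} (\<lambda>r. Bc r w)"
      by (rule continuous_on_subset[OF Bc_continuous]) (use st in auto)
    then show ?thesis unfolding N_def by (intro continuous_intros)
  qed
  note os = optional_stopping[where N=N and D="\<lambda>r w. \<bar>N r w\<bar>" and T=T, OF st(2) T cont N_meas mart order_refl Nsq sub]
  show "integrable M (\<lambda>w. N (real_of_ereal (max (ereal s) (min (T w) (ereal t)))) w)"
    by (rule os(1))
  show "(LINT w|M. N (real_of_ereal (max (ereal s) (min (T w) (ereal t)))) w) = (LINT w|M. indicator A w * \<zeta> w)"
  proof (rule trans[OF os(2)])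
    show "(LINT w|M. N s w) = (LINT w|M. indicator A w * \<zeta> w)"
      by (simp add: N_def)
  qed
qed

lemma
  fixes H :: "'w \<Rightarrow> real" and p q s t :: real
  assumes st: "0 \<le> s" "s \<le> t" and H: "H \<in> borel_measurable (F s)" "integrable M H"
  shows integrable_mult_exp_increment_real:
      "integrable M (\<lambda>w. H w * exp (p * fst (B t w - B s w) + q * snd (B t w - B s w)))"
    and expectation_mult_exp_increment_real:
      "(LINT w|M. H w * exp (p * fst (B t w - B s w) + q * snd (B t w - B s w)))
        = (LINT w|M. H w) * exp ((p\<^sup>2 + q\<^sup>2) * (t - s) / 2)"
proof -
  let ?E = "\<lambda>w. H w * exp (p * fst (B t w - B s w) + q * snd (B t w - B s w))"
  have eq: "complex_of_real (?E w) = complex_of_real (H w) *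
      exp (complex_of_real p * complex_of_real (fst (B t w - B s w)) + complex_of_real q * complex_of_real (snd (B t w - B s w)))" for w
    by (simp add: exp_of_real[symmetric])
  have H': "(\<lambda>w. complex_of_real (H w)) \<in> borel_measurable (F s)" "integrable M (\<lambda>w. complex_of_real (H w))"
    using H by auto
  note 1 = integrable_mult_exp_increment[OF st H', of "complex_of_real p" "complex_of_real q"]
    expectation_mult_exp_increment[OF st H', of "complex_of_real p" "complex_of_real q"]
  show "integrable M ?E"
    using 1(1) unfolding eq[symmetric] complex_of_real_integrable_eq .
  have "complex_of_real (LINT w|M. ?E w) = (LINT w|M. complex_of_real (?E w))"
    by (rule integral_complex_of_real[symmetric])
  also have "\<dots> = (LINT w|M. complex_of_real (H w)) * exp (((complex_of_real p)\<^sup>2 + (complex_of_real q)\<^sup>2) * (t - s) / 2)"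
    unfolding eq by (rule 1(2))
  also have "\<dots> = complex_of_real ((LINT w|M. H w) * exp ((p\<^sup>2 + q\<^sup>2) * (t - s) / 2))"
    by (simp add: exp_of_real[symmetric])
  finally have "complex_of_real (LINT w|M. ?E w) = complex_of_real ((LINT w|M. H w) * exp ((p\<^sup>2 + q\<^sup>2) * (t - s) / 2))" .
  then show "(LINT w|M. ?E w) = (LINT w|M. H w) * exp ((p\<^sup>2 + q\<^sup>2) * (t - s) / 2)"
    by (simp only: of_real_eq_iff)
qed

end

context planar_brownian_motion
begin

text \<open>The exponential of a complex linear form, corrected by its drift, is a martingale, and
  its real part is stopped here. The modulus \<open>D\<close> dominates it; \<open>CB\<close> and
  \<open>DB\<close> are the adapted versions of the complex martingale and of
  \<open>D\<^sup>2\<close>. If \<open>p\<^sup>2 + q\<^sup>2 = 0\<close> there is no drift: the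
  functional is then a holomorphic function of the motion.\<close>

lemma
  fixes p q :: complex and s t :: real and Z :: "'w \<Rightarrow> complex" and T :: "'w \<Rightarrow> ereal"
  assumes st: "0 \<le> s" "s \<le> t"
    and T: "\<And>r. s \<le> r \<Longrightarrow> r \<le> t \<Longrightarrow> {w \<in> space M. T w \<le> ereal r} \<in> sets (F r)"
    and A: "A \<in> sets (F s)" and Z: "Z \<in> borel_measurable (F s)" "\<And>w. w \<in> A \<Longrightarrow> norm (Z w) \<le> K"
  defines "N \<equiv> \<lambda>r w. indicator A w * Re (Z w * exp (p * complex_of_real (dB1 s r w)
      + q * complex_of_real (dB2 s r w) - (p\<^sup>2 + q\<^sup>2) * complex_of_real ((r - s) / 2)))"
  shows integrable_stopped_exp: "integrable M (\<lambda>w. N (real_of_ereal (max (ereal s) (min (T w) (ereal t)))) w)"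
    and expectation_stopped_exp:
      "(LINT w|M. N (real_of_ereal (max (ereal s) (min (T w) (ereal t)))) w) = (LINT w|M. indicator A w * Re (Z w))"
proof -
  define \<kappa> where "\<kappa> = p\<^sup>2 + q\<^sup>2"
  define L where "L = (\<lambda>s r w. p * complex_of_real (fst (B r w - B s w))
      + q * complex_of_real (snd (B r w - B s w)))"
  define LR where "LR = (\<lambda>s r w. (2 * Re p) * fst (B r w - B s w) + (2 * Re q) * snd (B r w - B s w))"
  define CB where "CB = (\<lambda>r w. complex_of_real (indicator A w) * Z w * exp (L s r w) * exp (- \<kappa> * complex_of_real ((r - s) / 2)))"
  define DB where "DB = (\<lambda>r w. indicator A w * K\<^sup>2 * exp (LR s r w) * exp (- Re \<kappa> * (r - s)))"
  define D where "D = (\<lambda>r w. indicator A w * \<bar>K\<bar> * exp (Re p * dB1 s r w + Re q * dB2 s r w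
      - Re \<kappa> * ((r - s) / 2)))"
  have eqN: "AE w in M. \<forall>r. N r w = Re (CB r w)"
    using Bc_AE
  proof eventually_elim
    fix w assume Bc: "\<forall>t. Bc t w = B t w"
    have "exp (p * complex_of_real (fst (B r w - B s w)) + q * complex_of_real (snd (B r w - B s w))
          - \<kappa> * complex_of_real ((r - s) / 2))
        = exp (L s r w) * exp (- \<kappa> * complex_of_real ((r - s) / 2))" for r
      unfolding exp_add[symmetric] L_def by (rule arg_cong[where f=exp]) simp
    then show "\<forall>r. N r w = Re (CB r w)"
      unfolding N_def CB_def \<kappa>_def[symmetric] using Bc
      by (cases "w \<in> A") (simp_all only: indicator_simps of_real_0 of_real_1 mult_1 mult_zero_left
          simp_thms mult.assoc zero_complex.sel)
  qed
  have eqD: "AE w in M. \<forall>r. (D r w)\<^sup>2 = DB r w"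
    using Bc_AE
  proof eventually_elim
    fix w assume Bc: "\<forall>t. Bc t w = B t w"
    have "(exp (Re p * fst (B r w - B s w) + Re q * snd (B r w - B s w) - Re \<kappa> * ((r - s) / 2)))\<^sup>2
        = exp (LR s r w) * exp (- Re \<kappa> * (r - s))" for r
      unfolding exp_double[symmetric] exp_add[symmetric] LR_def
      by (rule arg_cong[where f=exp]) (simp add: field_simps)
    then show "\<forall>r. (D r w)\<^sup>2 = DB r w"
      unfolding D_def DB_def using Bc
      by (cases "w \<in> A") (simp_all only: indicator_simps power_mult_distrib power2_abs mult_1 mult_zero_left
          simp_thms mult.assoc zero_power2)
  qed
  have AM: "A \<in> sets M" using A by (rule sets_F_M)
  have cexp: "(\<lambda>x::real \<times> real. exp (p * complex_of_real (fst x) + q * complex_of_real (snd x))) \<in> borel_measurable borel"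
    by (intro borel_measurable_continuous_onI continuous_intros)
  have rexp: "(\<lambda>x::real \<times> real. exp ((2 * Re p) * fst x + (2 * Re q) * snd x)) \<in> borel_measurable borel"
    by (intro borel_measurable_continuous_onI continuous_intros)
  have CB_meas: "CB r \<in> borel_measurable (F r)" if "s \<le> r" for r
    unfolding CB_def L_def
    using measurable_compose[OF increment_measurable[OF st(1) that] cexp]
      measurable_F_mono[OF Z(1) that] sets_F_mono'[OF A that] by simp
  have DB_meas: "DB r \<in> borel_measurable (F r)" if "s \<le> r" for r
    unfolding DB_def LR_def
    using measurable_compose[OF increment_measurable[OF st(1) that] rexp] sets_F_mono'[OF A that] by simp
  have Bc_inc: "(\<lambda>w. Bc r w - Bc s w) \<in> borel_measurable M" if "s \<le> r" for r
    using st that by (intro borel_measurable_diff Bc_measurable) auto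
  have N_meas: "N r \<in> borel_measurable M" if "s \<le> r" for r
  proof -
    have "(\<lambda>x::real \<times> real. exp (p * complex_of_real (fst x) + q * complex_of_real (snd x) - (p\<^sup>2 + q\<^sup>2) * complex_of_real ((r - s) / 2))) \<in> borel_measurable borel"
      by (intro borel_measurable_continuous_onI continuous_intros)
    from measurable_compose[OF Bc_inc[OF that] this] show ?thesis
      unfolding N_def using measurable_F_M[OF Z(1)] AM by simp
  qed
  have D_meas: "D r \<in> borel_measurable M" if "s \<le> r" for r
  proof -
    have "(\<lambda>x::real \<times> real. exp (Re p * fst x + Re q * snd x - Re \<kappa> * ((r - s) / 2))) \<in> borel_measurable borel"
      by (intro borel_measurable_continuous_onI continuous_intros)
    from measurable_compose[OF Bc_inc[OF that] this] show ?thesis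
      unfolding D_def using AM by simp
  qed
  have Z_int: "integrable M (\<lambda>w. complex_of_real (indicator A w) * Z w)"
  proof (rule integrable_const_bound[where B="\<bar>K\<bar>"])
    show "AE w in M. norm (complex_of_real (indicator A w) * Z w) \<le> \<bar>K\<bar>"
      using Z(2) by (auto simp: indicator_def intro: order_trans[OF _ abs_ge_self])
  qed (use measurable_F_M[OF Z(1)] AM in auto)
  have ZF: "(\<lambda>w. complex_of_real (indicator A w) * Z w) \<in> borel_measurable (F s)"
    using Z(1) A by simp
  have CB_int: "integrable M (CB r)" if "s \<le> r" for r
    unfolding CB_def L_def
    using integrable_mult_exp_increment[OF st(1) that ZF Z_int, of p q] by (intro integrable_mult_left)
  have KF: "(\<lambda>w. indicator A w * K\<^sup>2) \<in> borel_measurable (F s)" "integrable M (\<lambda>w. indicator A w * K\<^sup>2)"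
    using A AM by (auto intro!: integrable_indicator_mult integrable_real_indicator simp: less_top[symmetric])
  have DB_int: "integrable M (DB r)" if "s \<le> r" for r
    unfolding DB_def LR_def
    using integrable_mult_exp_increment_real[OF st(1) that KF, of "2 * Re p" "2 * Re q"]
    by (intro integrable_mult_left)
  have L_add: "L s t w = L s r w + L r t w" "LR s t w = LR s r w + LR r t w" for r w
    unfolding L_def LR_def by (simp_all add: algebra_simps)
  have CB_t: "CB t w = CB r w * exp (L r t w) * exp (- \<kappa> * complex_of_real ((t - r) / 2))" for r w
  proof -
    have "exp (- \<kappa> * complex_of_real ((t - s) / 2))
        = exp (- \<kappa> * complex_of_real ((r - s) / 2)) * exp (- \<kappa> * complex_of_real ((t - r) / 2))"
      unfolding exp_add[symmetric] by (rule arg_cong[where f=exp]) (simp add: field_simps)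
    then show ?thesis
      unfolding CB_def L_add[of w r] by (simp add: exp_add mult_ac)
  qed
  have DB_t: "DB t w = DB r w * exp (LR r t w) * exp (- Re \<kappa> * (t - r))" for r w
  proof -
    have "exp (- Re \<kappa> * (t - s)) = exp (- Re \<kappa> * (r - s)) * exp (- Re \<kappa> * (t - r))"
      unfolding exp_add[symmetric] by (rule arg_cong[where f=exp]) (simp add: algebra_simps)
    then show ?thesis
      unfolding DB_def L_add[of w r] by (simp add: exp_add mult_ac)
  qed
  have mart: "(LINT w|M. indicator C w * N r w) = (LINT w|M. indicator C w * N t w)"
    if r: "s \<le> r" "r \<le> t" and C: "C \<in> sets (F r)" for r C
  proof -
    note CM = sets_F_M[OF C]
    have r0: "0 \<le> r" using st r by simp
    define H where "H = (\<lambda>w. complex_of_real (indicator C w) * CB r w)"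
    have H: "H \<in> borel_measurable (F r)" "integrable M H"
      unfolding H_def using C CB_meas[OF r(1)] CM CB_int[OF r(1)]
        integrable_mult_indicator[OF CM CB_int[OF r(1)]]
      by (auto simp: scaleR_conv_of_real)
    have Re_CB: "(LINT w|M. indicator C w * N u w) = Re (LINT w|M. complex_of_real (indicator C w) * CB u w)"
      if u: "s \<le> u" for u
    proof -
      have "(LINT w|M. indicator C w * N u w) = (LINT w|M. Re (complex_of_real (indicator C w) * CB u w))"
        using eqN N_meas[OF u] measurable_F_M[OF CB_meas[OF u]] CM by (intro integral_cong_AE) auto
      also have "\<dots> = Re (LINT w|M. complex_of_real (indicator C w) * CB u w)"
        using integrable_mult_indicator[OF CM CB_int[OF u]] by (intro integral_Re) (simp add: scaleR_conv_of_real)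
      finally show ?thesis .
    qed
    have "(LINT w|M. complex_of_real (indicator C w) * CB t w)
        = (LINT w|M. H w * exp (L r t w)) * exp (- \<kappa> * complex_of_real ((t - r) / 2))"
      unfolding CB_t[of _ r] H_def by (simp add: mult.assoc[symmetric])
    also have "(LINT w|M. H w * exp (L r t w)) = (LINT w|M. H w) * exp (\<kappa> * complex_of_real (t - r) / 2)"
      using expectation_mult_exp_increment[OF r0 r(2) H, of p q] unfolding L_def \<kappa>_def .
    finally have "(LINT w|M. complex_of_real (indicator C w) * CB t w) = (LINT w|M. H w)"
      by (simp add: exp_minus)
    then show ?thesis
      using Re_CB[OF r(1)] Re_CB[OF st(2)] by (simp add: H_def)
  qed
  have D2_int: "integrable M (\<lambda>w. (D r w)\<^sup>2)" if "s \<le> r" for r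
    using eqD D_meas[OF that] measurable_F_M[OF DB_meas[OF that]]
    by (subst integrable_cong_AE[where g="DB r"]) (auto intro: DB_int that)
  have sub: "(LINT w|M. indicator C w * (D r w)\<^sup>2) \<le> (LINT w|M. indicator C w * (D t w)\<^sup>2)"
    if r: "s \<le> r" "r \<le> t" and C: "C \<in> sets (F r)" for r C
  proof -
    note CM = sets_F_M[OF C]
    have r0: "0 \<le> r" using st r by simp
    define H where "H = (\<lambda>w. indicator C w * DB r w)"
    have H: "H \<in> borel_measurable (F r)" "integrable M H"
      unfolding H_def using C DB_meas[OF r(1)] CM DB_int[OF r(1)] by (auto intro!: integrable_indicator_mult)
    have H0: "0 \<le> H w" for w unfolding H_def DB_def by simp
    have D_eq: "(LINT w|M. indicator C w * (D u w)\<^sup>2) = (LINT w|M. indicator C w * DB u w)"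
      if u: "s \<le> u" for u
      using eqD D_meas[OF u] measurable_F_M[OF DB_meas[OF u]] CM by (intro integral_cong_AE) auto
    have "(LINT w|M. indicator C w * DB t w) = (LINT w|M. H w * exp (LR r t w)) * exp (- Re \<kappa> * (t - r))"
      unfolding DB_t[of _ r] H_def by (simp add: mult.assoc[symmetric])
    also have "(LINT w|M. H w * exp (LR r t w)) = (LINT w|M. H w) * exp (((2 * Re p)\<^sup>2 + (2 * Re q)\<^sup>2) * (t - r) / 2)"
      using expectation_mult_exp_increment_real[OF r0 r(2) H, of "2 * Re p" "2 * Re q"] unfolding LR_def .
    finally have "(LINT w|M. indicator C w * DB t w)
        = (LINT w|M. H w) * exp (((2 * Re p)\<^sup>2 + (2 * Re q)\<^sup>2) * (t - r) / 2 - Re \<kappa> * (t - r))"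
      unfolding mult.assoc exp_add[symmetric] by simp
    \<comment> \<open>The growth rate of the mean of \<open>D\<^sup>2\<close>: the drift contributes
      squared imaginary parts with the opposite sign of the real ones, and what remains is the sum
      of the squared moduli of \<open>p\<close> and \<open>q\<close>. It is nonnegative, so
      \<open>D\<^sup>2\<close> is a submartingale.\<close>
    also have "((2 * Re p)\<^sup>2 + (2 * Re q)\<^sup>2) * (t - r) / 2 - Re \<kappa> * (t - r)
        = ((Re p)\<^sup>2 + (Re q)\<^sup>2 + (Im p)\<^sup>2 + (Im q)\<^sup>2) * (t - r)"
      unfolding \<kappa>_def by (simp add: power2_eq_square field_simps)
    finally have eq: "(LINT w|M. indicator C w * DB t w)
        = (LINT w|M. H w) * exp (((Re p)\<^sup>2 + (Re q)\<^sup>2 + (Im p)\<^sup>2 + (Im q)\<^sup>2) * (t - r))" .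
    have "(LINT w|M. H w) * 1 \<le> (LINT w|M. H w) * exp (((Re p)\<^sup>2 + (Re q)\<^sup>2 + (Im p)\<^sup>2 + (Im q)\<^sup>2) * (t - r))"
      using r H0 by (intro mult_left_mono) (auto intro!: integral_nonneg_AE)
    then show ?thesis
      using D_eq[OF r(1)] D_eq[OF st(2)] eq by (simp add: H_def)
  qed
  have cont: "continuous_on {s..t} (\<lambda>r. N r w)" for w
  proof -
    have "continuous_on {s..t} (\<lambda>r. Bc r w)"
      by (rule continuous_on_subset[OF Bc_continuous]) (use st in auto)
    then show ?thesis unfolding N_def by (intro continuous_intros) auto
  qed
  have ND: "\<bar>N r w\<bar> \<le> D r w" for r w
  proof (cases "w \<in> A")
    case True
    let ?e = "p * complex_of_real (dB1 s r w)
      + q * complex_of_real (dB2 s r w) - (p\<^sup>2 + q\<^sup>2) * complex_of_real ((r - s) / 2)"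
    have "\<bar>N r w\<bar> \<le> norm (Z w * exp ?e)"
      using True unfolding N_def by (simp only: indicator_simps mult_1 abs_Re_le_cmod)
    also have "\<dots> \<le> \<bar>K\<bar> * exp (Re ?e)"
      unfolding norm_mult norm_exp_eq_Re
      using Z(2)[OF True] by (intro mult_right_mono) auto
    also have "\<dots> = D r w"
      using True by (simp add: D_def \<kappa>_def)
    finally show ?thesis .
  qed (simp add: N_def D_def)
  note os = optional_stopping[where N=N and D=D and T=T, OF st(2) T cont N_meas mart ND D2_int sub]
  show "integrable M (\<lambda>w. N (real_of_ereal (max (ereal s) (min (T w) (ereal t)))) w)"
    by (rule os(1))
  show "(LINT w|M. N (real_of_ereal (max (ereal s) (min (T w) (ereal t)))) w) = (LINT w|M. indicator A w * Re (Z w))"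
  proof (rule trans[OF os(2)])
    show "(LINT w|M. N s w) = (LINT w|M. indicator A w * Re (Z w))"
      by (simp add: N_def)
  qed
qed

end

subsection \<open>Exit of planar Brownian motion from a wedge\<close>

text \<open>\<open>u - Re ((1 - exp (- l (u + \<i>v))) / l)\<close> is harmonic, at least \<open>u - 2 / l\<close> on \<open>u \<ge> 0\<close>, and tends
  to \<open>0\<close> with \<open>l\<close>. These functions detect whether the mass of \<open>u\<close> escapes to infinity.\<close>

definition escape_fun :: "real \<Rightarrow> real \<Rightarrow> real \<Rightarrow> real" where
  "escape_fun l u v = u - (1 - exp (- (l * u)) * cos (l * v)) / l"

lemma escape_fun_lower:
  assumes "0 < l" "0 \<le> u"
  shows "u - 2 / l \<le> escape_fun l u v"
proof -
  have "\<bar>exp (- (l * u)) * cos (l * v)\<bar> \<le> 1 * 1"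
    unfolding abs_mult using assms by (intro mult_mono) auto
  then have "1 - exp (- (l * u)) * cos (l * v) \<le> 2" by linarith
  then have "(1 - exp (- (l * u)) * cos (l * v)) / l \<le> 2 / l"
    using assms by (intro divide_right_mono) auto
  then show ?thesis by (simp add: escape_fun_def)
qed

text \<open>The bound is free of \<open>l\<close>, so it can dominate as \<open>l\<close> tends to
  0. The division by \<open>l\<close> is absorbed because \<open>1 - exp (- p)\<close> is at most
  \<open>p\<close> and \<open>1 - cos q\<close> is at most \<open>\<bar>q\<bar>\<close>.\<close>

lemma escape_fun_abs:
  assumes "0 < l" "0 \<le> u"
  shows "\<bar>escape_fun l u v\<bar> \<le> 2 * u + \<bar>v\<bar>"
proof -
  define p where "p = l * u"
  define q where "q = l * v"
  have p: "0 \<le> p" using assms by (simp add: p_def)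
  have 1: "1 - exp (- p) \<le> p" using exp_ge_add_one_self[of "- p"] by simp
  have 2: "0 \<le> 1 - exp (- p)" using p by simp
  have "\<bar>cos q - cos 0\<bar> \<le> \<bar>q - 0\<bar>"
  proof -
    have "cos q - cos 0 = - 2 * (sin (q / 2))\<^sup>2"
      by (simp add: cos_double_sin[of "q / 2", simplified])
    moreover have "(sin (q / 2))\<^sup>2 \<le> \<bar>sin (q / 2)\<bar>"
    proof -
      have "\<bar>sin (q / 2)\<bar> * \<bar>sin (q / 2)\<bar> \<le> 1 * \<bar>sin (q / 2)\<bar>"
        by (intro mult_right_mono) auto
      then show ?thesis by (simp add: power2_eq_square)
    qed
    moreover have "\<bar>sin (q / 2)\<bar> \<le> \<bar>q / 2\<bar>"
      by (rule abs_sin_x_le_abs_x)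
    ultimately show ?thesis by (simp add: abs_mult)
  qed
  then have 3: "\<bar>1 - cos q\<bar> \<le> \<bar>q\<bar>" by simp
  have "\<bar>exp (- p) * (1 - cos q)\<bar> \<le> 1 * \<bar>q\<bar>"
    unfolding abs_mult using p 3 by (intro mult_mono) auto
  moreover have "1 - exp (- p) * cos q = (1 - exp (- p)) + exp (- p) * (1 - cos q)"
    by (simp add: algebra_simps)
  ultimately have "\<bar>1 - exp (- p) * cos q\<bar> \<le> p + \<bar>q\<bar>"
    using 1 2 by linarith
  then have "\<bar>(1 - exp (- p) * cos q) / l\<bar> \<le> (p + \<bar>q\<bar>) / l"
    using assms by (simp add: divide_right_mono)
  also have "\<dots> = u + \<bar>v\<bar>"
    using assms by (simp add: p_def q_def abs_mult add_divide_distrib)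
  finally show ?thesis
    using assms(2) unfolding escape_fun_def p_def q_def by linarith
qed

text \<open>The function is \<open>u\<close> plus the difference quotient at \<open>l = 0\<close> of
  \<open>exp (- (l * u)) * cos (l * v)\<close>, whose derivative there is
  \<open>- u\<close>.\<close>

lemma escape_fun_tendsto: "(\<lambda>m. escape_fun (1 / real (Suc m)) u v) \<longlonglongrightarrow> 0"
proof -
  have "((\<lambda>l. exp (- (l * u)) * cos (l * v)) has_real_derivative (- u)) (at 0)"
    by (auto intro!: derivative_eq_intros)
  then have "((\<lambda>l. (exp (- (l * u)) * cos (l * v) - 1) / l) \<longlongrightarrow> - u) (at 0)"
    by (simp add: has_field_derivative_iff)
  moreover have "filterlim (\<lambda>m. 1 / real (Suc m)) (at 0) sequentially"
    unfolding filterlim_at using LIMSEQ_Suc[OF lim_const_over_n[of "1::real"]] by (auto simp del: of_nat_Suc)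
  ultimately have "(\<lambda>m. (exp (- (1 / real (Suc m) * u)) * cos (1 / real (Suc m) * v) - 1) / (1 / real (Suc m))) \<longlonglongrightarrow> - u"
    by (rule filterlim_compose)
  then have "(\<lambda>m. u + (exp (- (1 / real (Suc m) * u)) * cos (1 / real (Suc m) * v) - 1) / (1 / real (Suc m))) \<longlonglongrightarrow> u + (- u)"
    by (intro tendsto_add tendsto_const)
  moreover have "escape_fun (1 / real (Suc m)) u v
    = u + (exp (- (1 / real (Suc m) * u)) * cos (1 / real (Suc m) * v) - 1) / (1 / real (Suc m))" for m
    unfolding escape_fun_def diff_divide_distrib by simp
  ultimately show ?thesis by simp
qed

section \<open>Planar motion up to a time before which it stays in the wedge\<close>

context planar_brownian_motion
begin

text \<open>\<open>A\<close>, \<open>\<xi>\<close> and \<open>\<eta>\<close> describe a bounded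
  start known at time \<open>s\<close>, and \<open>T\<close> is a stopping time up to and including
  which both coordinates are nonnegative. That \<open>T\<close> is finite on \<open>A\<close> is a
  consequence of this positivity and is derived below.\<close>

context
  fixes a s K :: real and A :: "'w set" and \<xi> \<eta> :: "'w \<Rightarrow> real" and T :: "'w \<Rightarrow> ereal"
  assumes a: "0 < a" and s: "0 \<le> s"
    and T: "\<And>r. s \<le> r \<Longrightarrow> {w \<in> space M. T w \<le> ereal r} \<in> sets (F r)"
    and T_ge: "\<And>w. w \<in> A \<Longrightarrow> ereal s \<le> T w"
    and A: "A \<in> sets (F s)"
    and \<xi>: "\<xi> \<in> borel_measurable (F s)" "\<And>w. w \<in> A \<Longrightarrow> 0 \<le> \<xi> w \<and> \<xi> w \<le> K"
    and \<eta>: "\<eta> \<in> borel_measurable (F s)" "\<And>w. w \<in> A \<Longrightarrow> 0 \<le> \<eta> w \<and> \<eta> w \<le> K"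
    and pos: "AE w in M. w \<in> A \<longrightarrow> (\<forall>r. s \<le> r \<longrightarrow> ereal r \<le> T w \<longrightarrow>
        0 \<le> \<xi> w + dB1 s r w \<and>
        0 \<le> \<eta> w + (dB1 s r w + a * dB2 s r w))"
begin

private definition "U r w = \<xi> w + dB1 s r w"
private definition "V r w = \<eta> w + (dB1 s r w + a * dB2 s r w)"
private definition "u r w = U r w + V r w"
text \<open>As linear forms in the increment of the motion, \<open>u\<close> has coefficients
  \<open>(2, a)\<close> and \<open>v\<close> has \<open>(a, - 2)\<close>. These are orthogonal and
  of equal length, so u + \<i>v is a rescaled complex Brownian motion.\<close>

private definition "v r w = a * U r w - 2 / a * (V r w - U r w)"
private definition "\<tau> n w = real_of_ereal (max (ereal s) (min (T w) (ereal (s + real n))))"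
private definition "Q n = A - {w \<in> space M. T w \<le> ereal (s + real n)}"
text \<open>The intersection of the \<open>Q n\<close> is the event of never stopping. There
  \<open>T\<close> is infinite, its real part would be the default 0, and the value is set to 0
  instead.\<close>

private definition "uT w = indicator (A - (\<Inter>n. Q n)) w * u (real_of_ereal (T w)) w"
private definition "vT w = indicator (A - (\<Inter>n. Q n)) w * v (real_of_ereal (T w)) w"

private lemma A_M: "A \<in> sets M" using A by (rule sets_F_M)

private lemma A_space: "w \<in> A \<Longrightarrow> w \<in> space M" using A_M sets.sets_into_space by auto

private lemma Q_M: "Q n \<in> sets M"
  unfolding Q_def using A_M T[of "s + real n"] by (auto dest: sets_F_M)

private lemma Q_subset: "Q n \<subseteq> A" by (auto simp: Q_def)

private lemma tau_Q: "w \<in> Q n \<Longrightarrow> \<tau> n w = s + real n"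
  by (auto simp: Q_def \<tau>_def A_space min_def max_def)

private lemma tau_not_Q: "w \<in> A \<Longrightarrow> w \<notin> Q n \<Longrightarrow> \<tau> n w = real_of_ereal (T w)"
  using T_ge by (auto simp: Q_def \<tau>_def A_space min_def max_def)

private lemma tau_le: "w \<in> A \<Longrightarrow> s \<le> \<tau> n w \<and> ereal (\<tau> n w) \<le> T w"
proof (cases "w \<in> Q n")
  case True
  then show ?thesis unfolding tau_Q[OF True] by (auto simp: Q_def A_space)
next
  case False
  assume wA: "w \<in> A"
  then have "T w \<le> ereal (s + real n)" using False by (auto simp: Q_def A_space)
  then have "ereal (real_of_ereal (T w)) = T w"
    using T_ge[OF wA] by (cases "T w") auto
  then show ?thesis
    unfolding tau_not_Q[OF wA False] using T_ge[OF wA] by (simp add: ereal_less_eq(3)[symmetric] del: ereal_less_eq(3))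
qed

private lemma UV_nonneg: "AE w in M. w \<in> A \<longrightarrow> (\<forall>n. 0 \<le> U (\<tau> n w) w \<and> 0 \<le> V (\<tau> n w) w)"
  using pos by eventually_elim (use tau_le in \<open>auto simp: U_def V_def\<close>)

text \<open>This is where the angle below \<pi> enters: on the closed wedge \<open>u\<close>
  vanishes only at the apex, so it controls the coordinate orthogonal to it.\<close>

private lemma v_le_u: "0 \<le> U r w \<Longrightarrow> 0 \<le> V r w \<Longrightarrow> \<bar>v r w\<bar> \<le> (a + 2 / a) * u r w"
proof -
  assume *: "0 \<le> U r w" "0 \<le> V r w"
  have "\<bar>v r w\<bar> \<le> \<bar>a * U r w\<bar> + \<bar>2 / a * (V r w - U r w)\<bar>"
    unfolding v_def by (rule abs_triangle_ineq4)
  also have "\<dots> \<le> a * (U r w + V r w) + 2 / a * (U r w + V r w)"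
    unfolding abs_mult using a * by (intro add_mono mult_mono) auto
  finally show ?thesis by (simp add: u_def algebra_simps)
qed

private lemma fin_ind: "D \<in> sets M \<Longrightarrow> integrable M (indicator D :: 'w \<Rightarrow> real)"
  by (intro integrable_real_indicator) (auto simp: less_top[symmetric])

private lemma U_stopped:
  "integrable M (\<lambda>w. indicator A w * U (\<tau> n w) w)"
  "(LINT w|M. indicator A w * U (\<tau> n w) w) = (LINT w|M. indicator A w * \<xi> w)"
  using integrable_stopped_linear[OF s _ T A \<xi>(1), where K=K and p=1 and q=0 and t="s + real n"]
    expectation_stopped_linear[OF s _ T A \<xi>(1), where K=K and p=1 and q=0 and t="s + real n"] \<xi>(2)
  unfolding U_def \<tau>_def by (simp_all add: abs_le_iff)

private lemma V_stopped:
  "integrable M (\<lambda>w. indicator A w * V (\<tau> n w) w)"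
  "(LINT w|M. indicator A w * V (\<tau> n w) w) = (LINT w|M. indicator A w * \<eta> w)"
  using integrable_stopped_linear[OF s _ T A \<eta>(1), where K=K and p=1 and q=a and t="s + real n"]
    expectation_stopped_linear[OF s _ T A \<eta>(1), where K=K and p=1 and q=a and t="s + real n"] \<eta>(2)
  unfolding V_def \<tau>_def by (simp_all add: abs_le_iff)

private lemma exp_stopped:
  assumes l: "0 < l"
  shows "integrable M (\<lambda>w. indicator A w * (exp (- (l * u (\<tau> n w) w)) * cos (l * v (\<tau> n w) w)))" (is "integrable M ?f")
    and "(LINT w|M. indicator A w * (exp (- (l * u (\<tau> n w) w)) * cos (l * v (\<tau> n w) w)))
      = (LINT w|M. indicator A w * (exp (- (l * u s w)) * cos (l * v s w)))" (is "?eq")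
proof -
  \<comment> \<open>These are the coefficients of the increment of - l (u + \<i>v): \<open>p\<close>
    is - l (2 + \<i>a) and \<open>q\<close> is - l (a - 2\<i>). Since \<open>q\<close> is - \<i>
    times \<open>p\<close>, the sum of squares is 0 and the exponential has no drift.\<close>
  define p where "p = Complex (- (2 * l)) (- (a * l))"
  define q where "q = Complex (- (a * l)) (2 * l)"
  define Z where "Z = (\<lambda>w. exp (- (complex_of_real l * Complex (\<xi> w + \<eta> w) (a * \<xi> w - 2 / a * (\<eta> w - \<xi> w)))))"
  have pq: "p\<^sup>2 + q\<^sup>2 = 0"
    unfolding p_def q_def by (simp add: complex_eq_iff power2_eq_square)
  have Z: "Z \<in> borel_measurable (F s)"
  proof -
    have "(\<lambda>x::real \<times> real. exp (- (complex_of_real l * Complex (fst x + snd x) (a * fst x - 2 / a * (snd x - fst x))))) \<in> borel_measurable borel"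
      unfolding Complex_eq by (intro borel_measurable_continuous_onI continuous_intros)
    from measurable_compose[OF borel_measurable_Pair[OF \<xi>(1) \<eta>(1)] this] show ?thesis
      by (simp add: Z_def)
  qed
  have Z_bound: "norm (Z w) \<le> 1" if "w \<in> A" for w
    using \<xi>(2)[OF that] \<eta>(2)[OF that] l by (simp add: Z_def)
  have eq: "Re (Z w * exp (p * complex_of_real (dB1 s r w) + q * complex_of_real (dB2 s r w)
      - (p\<^sup>2 + q\<^sup>2) * complex_of_real ((r - s) / 2))) = exp (- (l * u r w)) * cos (l * v r w)" for r w
  proof -
    have "Z w * exp (p * complex_of_real (dB1 s r w) + q * complex_of_real (dB2 s r w)
      - (p\<^sup>2 + q\<^sup>2) * complex_of_real ((r - s) / 2)) = exp (- (complex_of_real l * Complex (u r w) (v r w)))"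
      unfolding pq Z_def exp_add[symmetric]
      using a by (intro arg_cong[where f=exp]) (simp add: complex_eq_iff p_def q_def u_def v_def U_def V_def field_simps)
    then show ?thesis by (simp add: Re_exp)
  qed
  have st: "s \<le> s + real n" by simp
  note os = integrable_stopped_exp[OF s st T A Z, where K=1 and p=p and q=q]
    expectation_stopped_exp[OF s st T A Z, where K=1 and p=p and q=q]
  show "integrable M ?f"
    using os(1)[OF _ Z_bound] unfolding eq \<tau>_def by simp
  have "Re (Z w) = exp (- (l * u s w)) * cos (l * v s w)" for w
    using eq[of w s] by simp
  then show ?eq
    using os(2)[OF _ Z_bound] unfolding eq \<tau>_def by simp
qed

text \<open>Here the drift is kept on purpose: on paths not stopped by time
  \<open>s + real n\<close> it damps the martingale to at most
  \<open>exp (- (l\<^sup>2 / 2) * real n)\<close>.\<close>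

private lemma damped_stopped:
  assumes l: "0 < l"
  shows "integrable M (\<lambda>w. indicator A w * exp (- (l * U (\<tau> n w) w) - l\<^sup>2 * ((\<tau> n w - s) / 2)))" (is "integrable M ?f")
    and "(LINT w|M. indicator A w * exp (- (l * U (\<tau> n w) w) - l\<^sup>2 * ((\<tau> n w - s) / 2)))
      = (LINT w|M. indicator A w * exp (- (l * \<xi> w)))" (is "?eq")
proof -
  define p where "p = complex_of_real (- l)"
  define Z where "Z = (\<lambda>w. complex_of_real (exp (- (l * \<xi> w))))"
  have Z: "Z \<in> borel_measurable (F s)" using \<xi>(1) by (simp add: Z_def)
  have Z_bound: "norm (Z w) \<le> 1" if "w \<in> A" for w
    using \<xi>(2)[OF that] l by (simp add: Z_def)
  have eq: "Re (Z w * exp (p * complex_of_real (dB1 s r w) + 0 * complex_of_real (dB2 s r w)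
      - (p\<^sup>2 + 0\<^sup>2) * complex_of_real ((r - s) / 2))) = exp (- (l * U r w) - l\<^sup>2 * ((r - s) / 2))" for r w
  proof -
    have "Z w * exp (p * complex_of_real (dB1 s r w) + 0 * complex_of_real (dB2 s r w)
      - (p\<^sup>2 + 0\<^sup>2) * complex_of_real ((r - s) / 2)) = complex_of_real (exp (- (l * U r w) - l\<^sup>2 * ((r - s) / 2)))"
      unfolding Z_def exp_of_real[symmetric] exp_add[symmetric]
      by (intro arg_cong[where f=exp]) (simp add: p_def U_def algebra_simps)
    then show ?thesis by simp
  qed
  have st: "s \<le> s + real n" by simp
  note os = integrable_stopped_exp[OF s st T A Z, where K=1 and p=p and q=0]
    expectation_stopped_exp[OF s st T A Z, where K=1 and p=p and q=0]
  show "integrable M ?f"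
    using os(1)[OF _ Z_bound] unfolding eq \<tau>_def by simp
  have "Re (Z w) = exp (- (l * \<xi> w))" for w
    by (simp add: Z_def)
  then show ?eq
    using os(2)[OF _ Z_bound] unfolding eq \<tau>_def by simp
qed

text \<open>One-dimensional recurrence: \<open>U\<close> cannot stay nonnegative forever. With
  \<open>c\<close> the probability of never stopping, the damped martingale gives \<open>exp (- (l *
  K)) * prob A \<le> prob A - c + exp (- (l\<^sup>2 / 2) * real n)\<close>. Letting \<open>n\<close>
  grow and then \<open>l\<close> tend to 0 leaves \<open>c = 0\<close>.\<close>

private lemma Q_lim: "(\<lambda>n. prob (Q n)) \<longlonglongrightarrow> 0"
  and exit_finite: "AE w in M. w \<in> A \<longrightarrow> T w < \<infinity>"
proof -
  define c where "c = prob (\<Inter>n. Q n)"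
  have dec: "decseq Q"
    unfolding decseq_def Q_def by (auto intro: order_trans)
  have lim: "(\<lambda>n. prob (Q n)) \<longlonglongrightarrow> c"
    unfolding c_def using Q_M dec by (intro finite_Lim_measure_decseq) auto
  have c_le: "c \<le> prob (Q n)" for n
    unfolding c_def using Q_M by (intro finite_measure_mono) auto
  have 1: "exp (- (l * K)) * prob A \<le> prob A - c + exp (- (l\<^sup>2 / 2) * real n)" if l: "0 < l" for l n
  proof -
    have "exp (- (l * K)) * prob A = (LINT w|M. exp (- (l * K)) * indicator A w)"
      using A_M by simp
    also have "\<dots> \<le> (LINT w|M. indicator A w * exp (- (l * \<xi> w)))"
    proof (rule integral_mono)
      show "integrable M (\<lambda>w. exp (- (l * K)) * indicator A w)" using fin_ind[OF A_M] by simp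
      show "integrable M (\<lambda>w. indicator A w * exp (- (l * \<xi> w)))"
      proof (rule integrable_const_bound[where B=1])
        show "AE w in M. norm (indicator A w * exp (- (l * \<xi> w))) \<le> 1"
          using \<xi>(2) l by (auto simp: indicator_def)
      qed (use A_M measurable_F_M[OF \<xi>(1)] in auto)
      show "exp (- (l * K)) * indicator A w \<le> indicator A w * exp (- (l * \<xi> w))" for w
        using \<xi>(2)[of w] l by (cases "w \<in> A") auto
    qed
    also have "\<dots> = (LINT w|M. indicator A w * exp (- (l * U (\<tau> n w) w) - l\<^sup>2 * ((\<tau> n w - s) / 2)))"
      using damped_stopped(2)[OF l] by simp
    also have "\<dots> \<le> (LINT w|M. indicator (A - Q n) w + exp (- (l\<^sup>2 / 2) * real n) * indicator (Q n) w)"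
    proof (rule integral_mono_AE[OF damped_stopped(1)[OF l]])
      show "integrable M (\<lambda>w. indicator (A - Q n) w + exp (- (l\<^sup>2 / 2) * real n) * indicator (Q n) w)"
        using fin_ind[OF Q_M] fin_ind[of "A - Q n"] A_M Q_M by auto
      show "AE w in M. indicator A w * exp (- (l * U (\<tau> n w) w) - l\<^sup>2 * ((\<tau> n w - s) / 2))
        \<le> indicator (A - Q n) w + exp (- (l\<^sup>2 / 2) * real n) * indicator (Q n) w"
        using UV_nonneg
      proof eventually_elim
        fix w assume U: "w \<in> A \<longrightarrow> (\<forall>n. 0 \<le> U (\<tau> n w) w \<and> 0 \<le> V (\<tau> n w) w)"
        show "indicator A w * exp (- (l * U (\<tau> n w) w) - l\<^sup>2 * ((\<tau> n w - s) / 2))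
          \<le> indicator (A - Q n) w + exp (- (l\<^sup>2 / 2) * real n) * indicator (Q n) w"
        proof (cases "w \<in> A")
          case True
          have U0: "0 \<le> l * U (\<tau> n w) w" using U True l by simp
          have t0: "0 \<le> l\<^sup>2 * ((\<tau> n w - s) / 2)" using tau_le[OF True, of n] by simp
          show ?thesis
          proof (cases "w \<in> Q n")
            case Q: True
            show ?thesis using True Q U0 tau_Q[OF Q] by simp
          qed (use True U0 t0 in simp)
        next
          case False
          then show ?thesis using Q_subset[of n] by (auto simp: indicator_def)
        qed
      qed
    qed
    also have "\<dots> = prob (A - Q n) + exp (- (l\<^sup>2 / 2) * real n) * prob (Q n)"
      using A_M Q_M fin_ind[OF Q_M] fin_ind[of "A - Q n"]
      by (subst Bochner_Integration.integral_add) (auto intro: fin_ind)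
    also have "\<dots> \<le> (prob A - c) + exp (- (l\<^sup>2 / 2) * real n) * 1"
      using finite_measure_Diff[OF A_M Q_M Q_subset, of n] c_le[of n]
      by (intro add_mono mult_left_mono) auto
    finally show ?thesis by simp
  qed
  have 2: "exp (- (l * K)) * prob A \<le> prob A - c" if l: "0 < l" for l
  proof (rule LIMSEQ_le_const)
    have "(\<lambda>n. exp (- (l\<^sup>2 / 2) * real n)) \<longlonglongrightarrow> 0"
    proof -
      have "(\<lambda>n. exp (- (l\<^sup>2 / 2)) ^ n) \<longlonglongrightarrow> 0"
        using l by (intro LIMSEQ_realpow_zero) auto
      then show ?thesis by (simp only: exp_of_nat2_mult)
    qed
    then have "(\<lambda>n. prob A - c + exp (- (l\<^sup>2 / 2) * real n)) \<longlonglongrightarrow> prob A - c + 0"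
      by (intro tendsto_intros)
    then show "(\<lambda>n. prob A - c + exp (- (l\<^sup>2 / 2) * real n)) \<longlonglongrightarrow> prob A - c" by simp
  qed (use 1[OF l] in auto)
  have "prob A \<le> prob A - c"
  proof (rule LIMSEQ_le_const2)
    have "(\<lambda>m. exp (- (1 / real (Suc m) * K)) * prob A) \<longlonglongrightarrow> exp (- (0 * K)) * prob A"
      by (intro tendsto_intros LIMSEQ_Suc[OF lim_const_over_n])
    then show "(\<lambda>m. exp (- (1 / real (Suc m) * K)) * prob A) \<longlonglongrightarrow> prob A" by simp
    show "\<exists>N. \<forall>m\<ge>N. exp (- (1 / real (Suc m) * K)) * prob A \<le> prob A - c"
      by (intro exI allI impI 2) simp
  qed
  moreover have "0 \<le> c" unfolding c_def by (rule measure_nonneg)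
  ultimately have c0: "c = 0" by linarith
  show "(\<lambda>n. prob (Q n)) \<longlonglongrightarrow> 0" using lim c0 by simp
  have "(\<Inter>n. Q n) \<in> null_sets M"
    using c0 Q_M by (intro null_setsI) (auto simp: c_def emeasure_eq_measure)
  then have "AE w in M. w \<notin> (\<Inter>n. Q n)" by (rule AE_not_in)
  then show "AE w in M. w \<in> A \<longrightarrow> T w < \<infinity>"
  proof eventually_elim
    fix w assume "w \<notin> (\<Inter>n. Q n)"
    then show "w \<in> A \<longrightarrow> T w < \<infinity>"
      by (auto simp: Q_def intro: le_less_trans)
  qed
qed

private lemma u_stopped:
  "integrable M (\<lambda>w. indicator A w * u (\<tau> n w) w)"
  "(LINT w|M. indicator A w * u (\<tau> n w) w) = (LINT w|M. indicator A w * u s w)"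
proof -
  have eq: "indicator A w * u r w = indicator A w * U r w + indicator A w * V r w" for r w
    by (simp add: u_def algebra_simps)
  have s0: "indicator A w * u s w = indicator A w * \<xi> w + indicator A w * \<eta> w" for w
    by (simp add: u_def U_def V_def algebra_simps)
  have i: "integrable M (\<lambda>w. indicator A w * f w)"
    if "f \<in> borel_measurable (F s)" "\<And>w. w \<in> A \<Longrightarrow> 0 \<le> f w \<and> f w \<le> K" for f :: "'w \<Rightarrow> real"
    using that(2) A_M measurable_F_M[OF that(1)]
    by (intro integrable_const_bound[where B="\<bar>K\<bar>"]) (force simp: indicator_def)+
  show "integrable M (\<lambda>w. indicator A w * u (\<tau> n w) w)"
    unfolding eq by (intro Bochner_Integration.integrable_add U_stopped V_stopped)
  show "(LINT w|M. indicator A w * u (\<tau> n w) w) = (LINT w|M. indicator A w * u s w)"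
    unfolding s0 unfolding eq using i[OF \<xi>] i[OF \<eta>]
    by (simp add: Bochner_Integration.integral_add U_stopped V_stopped)
qed

private lemma
  shows uT_lim: "(\<lambda>n. indicator (A - Q n) w * u (\<tau> n w) w) \<longlonglongrightarrow> uT w"
    and vT_lim: "(\<lambda>n. indicator (A - Q n) w * v (\<tau> n w) w) \<longlonglongrightarrow> vT w"
proof -
  have "\<forall>\<^sub>F n in sequentially. indicator (A - Q n) w * f (\<tau> n w) w
      = indicator (A - (\<Inter>n. Q n)) w * f (real_of_ereal (T w)) w" for f :: "real \<Rightarrow> 'w \<Rightarrow> real"
  proof (cases "w \<in> A - (\<Inter>n. Q n)")
    case True
    then obtain m where m: "w \<in> A" "w \<notin> Q m" by auto
    have "w \<notin> Q n" if "m \<le> n" for n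
      using m that by (auto simp: Q_def A_space intro: order_trans)
    then show ?thesis
      using m tau_not_Q by (auto simp: eventually_sequentially indicator_simps(1)[OF True] intro!: exI[of _ m])
  qed (auto simp: indicator_def)
  from this[of u] this[of v] show "(\<lambda>n. indicator (A - Q n) w * u (\<tau> n w) w) \<longlonglongrightarrow> uT w"
    "(\<lambda>n. indicator (A - Q n) w * v (\<tau> n w) w) \<longlonglongrightarrow> vT w"
    unfolding uT_def vT_def by (auto intro: tendsto_eventually)
qed

private lemma AQ_mult: "indicator (A - Q n) w * (x :: real) = indicator (A - Q n) w * (indicator A w * x)"
  by (auto simp: indicator_def)

private lemma AQ_M: "A - Q n \<in> sets M" using A_M Q_M by auto

private lemma uT_measurable: "uT \<in> borel_measurable M" and vT_measurable: "vT \<in> borel_measurable M"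
proof -
  have U: "(\<lambda>w. indicator A w * U (\<tau> n w) w) \<in> borel_measurable M" for n
    using U_stopped(1) by (rule borel_measurable_integrable)
  have V: "(\<lambda>w. indicator A w * V (\<tau> n w) w) \<in> borel_measurable M" for n
    using V_stopped(1) by (rule borel_measurable_integrable)
  have "(\<lambda>w. indicator (A - Q n) w * u (\<tau> n w) w) \<in> borel_measurable M" for n
    unfolding AQ_mult[of n _ "u _ _"]
    by (rule borel_measurable_times[OF borel_measurable_indicator[OF AQ_M] borel_measurable_integrable[OF u_stopped(1)]])
  then show "uT \<in> borel_measurable M"
    by (rule borel_measurable_LIMSEQ_real[OF uT_lim])
  have eq: "indicator (A - Q n) w * v (\<tau> n w) w = indicator (A - Q n) w *
      (a * (indicator A w * U (\<tau> n w) w) - 2 / a * (indicator A w * V (\<tau> n w) w - indicator A w * U (\<tau> n w) w))" for n w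
    by (auto simp: indicator_def v_def)
  have "(\<lambda>w. indicator (A - Q n) w * v (\<tau> n w) w) \<in> borel_measurable M" for n
    unfolding eq
    by (intro borel_measurable_times[OF borel_measurable_indicator[OF AQ_M]] borel_measurable_diff
        borel_measurable_times[OF borel_measurable_const] U V)
  then show "vT \<in> borel_measurable M"
    by (rule borel_measurable_LIMSEQ_real[OF vT_lim])
qed

private lemma uT_vT_bounds: "AE w in M. 0 \<le> uT w \<and> \<bar>vT w\<bar> \<le> (a + 2 / a) * uT w"
  using UV_nonneg
proof eventually_elim
  fix w assume UV: "w \<in> A \<longrightarrow> (\<forall>n. 0 \<le> U (\<tau> n w) w \<and> 0 \<le> V (\<tau> n w) w)"
  show "0 \<le> uT w \<and> \<bar>vT w\<bar> \<le> (a + 2 / a) * uT w"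
  proof (cases "w \<in> A - (\<Inter>n. Q n)")
    case True
    then obtain m where m: "w \<in> A" "w \<notin> Q m" by auto
    have "0 \<le> U (real_of_ereal (T w)) w \<and> 0 \<le> V (real_of_ereal (T w)) w"
      using UV m tau_not_Q[OF m] by metis
    then show ?thesis
      using True v_le_u by (simp add: uT_def vT_def u_def)
  qed (simp add: uT_def vT_def)
qed

private lemma u_s_integrable: "integrable M (\<lambda>w. indicator A w * u s w)"
  and u_s_bounds: "w \<in> A \<Longrightarrow> 0 \<le> u s w \<and> u s w \<le> 2 * \<bar>K\<bar> \<and> \<bar>v s w\<bar> \<le> (a + 2 / a) * (2 * \<bar>K\<bar>)"
proof -
  have b: "0 \<le> u s w \<and> u s w \<le> 2 * \<bar>K\<bar>" if "w \<in> A" for w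
    using \<xi>(2)[OF that] \<eta>(2)[OF that] by (simp add: u_def U_def V_def)
  have "\<bar>v s w\<bar> \<le> (a + 2 / a) * (2 * \<bar>K\<bar>)" if "w \<in> A" for w
  proof -
    have "\<bar>v s w\<bar> \<le> (a + 2 / a) * u s w"
      by (rule v_le_u) (use \<xi>(2)[OF that] \<eta>(2)[OF that] in \<open>simp_all add: U_def V_def\<close>)
    also have "\<dots> \<le> (a + 2 / a) * (2 * \<bar>K\<bar>)"
      using b[OF that] a by (intro mult_left_mono) auto
    finally show ?thesis .
  qed
  with b show "w \<in> A \<Longrightarrow> 0 \<le> u s w \<and> u s w \<le> 2 * \<bar>K\<bar> \<and> \<bar>v s w\<bar> \<le> (a + 2 / a) * (2 * \<bar>K\<bar>)" by blast
  have "(\<lambda>w. indicator A w * u s w) \<in> borel_measurable M"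
    using A_M measurable_F_M[OF \<xi>(1)] measurable_F_M[OF \<eta>(1)] by (simp add: u_def U_def V_def)
  then show "integrable M (\<lambda>w. indicator A w * u s w)"
    using b by (intro integrable_const_bound[where B="2 * \<bar>K\<bar>"]) (force simp: indicator_def)+
qed

text \<open>By Fatou, since all stopped means of \<open>u\<close> equal its initial mean. This makes
  \<open>uT\<close> a dominating variable for the test functions at the exit.\<close>

private lemma uT_integrable: "integrable M uT"
proof (rule integrableI_bounded[OF uT_measurable])
  have "(\<integral>\<^sup>+w. ennreal (norm (uT w)) \<partial>M) = (\<integral>\<^sup>+w. liminf (\<lambda>n. ennreal (indicator (A - Q n) w * u (\<tau> n w) w)) \<partial>M)"
    using uT_vT_bounds
  proof (intro nn_integral_cong_AE, eventually_elim)
    fix w assume "0 \<le> uT w \<and> \<bar>vT w\<bar> \<le> (a + 2 / a) * uT w"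
    then show "ennreal (norm (uT w)) = liminf (\<lambda>n. ennreal (indicator (A - Q n) w * u (\<tau> n w) w))"
      using lim_imp_Liminf[OF _ tendsto_ennrealI[OF uT_lim[of w]]] by simp
  qed
  also have "\<dots> \<le> liminf (\<lambda>n. \<integral>\<^sup>+w. ennreal (indicator (A - Q n) w * u (\<tau> n w) w) \<partial>M)"
  proof (rule nn_integral_liminf)
    have "(\<lambda>w. indicator (A - Q n) w * u (\<tau> n w) w) \<in> borel_measurable M" for n
      unfolding AQ_mult[of n _ "u _ _"]
      by (rule borel_measurable_times[OF borel_measurable_indicator[OF AQ_M] borel_measurable_integrable[OF u_stopped(1)]])
    then show "(\<lambda>w. ennreal (indicator (A - Q n) w * u (\<tau> n w) w)) \<in> borel_measurable M" for n
      by measurable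
  qed
  also have "\<dots> \<le> liminf (\<lambda>n::nat. ennreal (LINT w|M. indicator A w * u s w))"
  proof (intro Liminf_mono always_eventually allI)
    fix n
    have ae: "AE w in M. 0 \<le> indicator A w * u (\<tau> n w) w"
      using UV_nonneg by eventually_elim (auto simp: indicator_def u_def)
    have "(\<integral>\<^sup>+w. ennreal (indicator (A - Q n) w * u (\<tau> n w) w) \<partial>M) \<le> (\<integral>\<^sup>+w. ennreal (indicator A w * u (\<tau> n w) w) \<partial>M)"
      using ae by (intro nn_integral_mono_AE, eventually_elim) (auto simp: indicator_def)
    also have "\<dots> = ennreal (LINT w|M. indicator A w * u (\<tau> n w) w)"
      by (rule nn_integral_eq_integral[OF u_stopped(1) ae])
    finally show "(\<integral>\<^sup>+w. ennreal (indicator (A - Q n) w * u (\<tau> n w) w) \<partial>M) \<le> ennreal (LINT w|M. indicator A w * u s w)"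
      unfolding u_stopped(2) .
  qed
  also have "\<dots> < \<infinity>" by (simp add: Liminf_const)
  finally show "(\<integral>\<^sup>+w. ennreal (norm (uT w)) \<partial>M) < \<infinity>" .
qed

private lemma escape_measurable: "f \<in> borel_measurable M \<Longrightarrow> g \<in> borel_measurable M \<Longrightarrow>
    (\<lambda>w. escape_fun l (f w) (g w)) \<in> borel_measurable M"
proof -
  assume *: "f \<in> borel_measurable M" "g \<in> borel_measurable M"
  have "(\<lambda>x::real \<times> real. escape_fun l (fst x) (snd x)) \<in> borel_measurable borel"
    unfolding escape_fun_def divide_inverse
    by (intro borel_measurable_continuous_onI continuous_intros)
  from measurable_compose[OF borel_measurable_Pair[OF *] this] show ?thesis by simp
qed

text \<open>The mean of the harmonic function over \<open>A\<close> stays equal to its initial value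
  \<open>c\<close>. On \<open>Q n\<close> the function is at least \<open>u - 2 / l\<close>; off
  \<open>Q n\<close> it already has its exit value, which is at worst minus the integrand of
  \<open>R\<close>. Solving for the mean of \<open>u\<close> over \<open>Q n\<close> gives the
  bound.\<close>

private lemma escape_bound:
  assumes l: "0 < l"
  defines "c \<equiv> (LINT w|M. indicator A w * escape_fun l (u s w) (v s w))"
    and "R \<equiv> (LINT w|M. \<bar>escape_fun l (uT w) (vT w)\<bar>)"
  shows "(LINT w|M. indicator (Q n) w * u (\<tau> n w) w) \<le> 2 / l * prob (Q n) + c + R"
proof -
  define H where "H = (\<lambda>w. indicator A w * escape_fun l (u (\<tau> n w) w) (v (\<tau> n w) w))"
  have H_eq: "indicator A w * escape_fun l (u r w) (v r w) = indicator A w * u r w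
      - (1 / l) * (indicator A w - indicator A w * (exp (- (l * u r w)) * cos (l * v r w)))" for r w
    by (simp add: escape_fun_def algebra_simps diff_divide_distrib)
  have H_int: "integrable M H"
    unfolding H_def H_eq
    by (intro Bochner_Integration.integrable_diff integrable_mult_right u_stopped exp_stopped l fin_ind A_M)
  have es_int: "integrable M (\<lambda>w. indicator A w * (exp (- (l * u s w)) * cos (l * v s w)))"
  proof (rule integrable_const_bound[where B=1])
    show "AE w in M. norm (indicator A w * (exp (- (l * u s w)) * cos (l * v s w))) \<le> 1"
    proof (intro always_eventually allI)
      fix w
      show "norm (indicator A w * (exp (- (l * u s w)) * cos (l * v s w))) \<le> 1"
      proof (cases "w \<in> A")
        case True
        then have "\<bar>exp (- (l * u s w))\<bar> * \<bar>cos (l * v s w)\<bar> \<le> 1 * 1"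
          using u_s_bounds[OF True] l by (intro mult_mono) auto
        then show ?thesis using True by (simp add: abs_mult)
      qed simp
    qed
    show "(\<lambda>w. indicator A w * (exp (- (l * u s w)) * cos (l * v s w))) \<in> borel_measurable M"
      using A_M measurable_F_M[OF \<xi>(1)] measurable_F_M[OF \<eta>(1)] unfolding u_def v_def U_def V_def by simp
  qed
  have H_val: "(LINT w|M. H w) = c"
    unfolding H_def c_def H_eq
    using u_stopped(1)[of n] exp_stopped(1)[OF l, of n] fin_ind[OF A_M] u_s_integrable es_int
    by (simp add: u_stopped(2) exp_stopped(2)[OF l])
  have R_int: "integrable M (\<lambda>w. \<bar>escape_fun l (uT w) (vT w)\<bar>)"
  proof (rule Bochner_Integration.integrable_bound)
    show "integrable M (\<lambda>w. (2 + (a + 2 / a)) * uT w)" using uT_integrable by simp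
    show "AE w in M. norm \<bar>escape_fun l (uT w) (vT w)\<bar> \<le> norm ((2 + (a + 2 / a)) * uT w)"
      using uT_vT_bounds
    proof eventually_elim
      fix w assume b: "0 \<le> uT w \<and> \<bar>vT w\<bar> \<le> (a + 2 / a) * uT w"
      have "\<bar>escape_fun l (uT w) (vT w)\<bar> \<le> 2 * uT w + \<bar>vT w\<bar>"
        using b by (intro escape_fun_abs l) auto
      also have "\<dots> \<le> (2 + (a + 2 / a)) * uT w" using b by (simp add: distrib_right)
      finally show "norm \<bar>escape_fun l (uT w) (vT w)\<bar> \<le> norm ((2 + (a + 2 / a)) * uT w)" by simp
    qed
  qed (intro borel_measurable_abs escape_measurable uT_measurable vT_measurable)
  have Q_mult: "indicator (Q n) w * (x :: real) = indicator (Q n) w * (indicator A w * x)" for w x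
    using Q_subset[of n] by (auto simp: indicator_def)
  have Qu: "integrable M (\<lambda>w. indicator (Q n) w * u (\<tau> n w) w)"
    unfolding Q_mult[of _ "u _ _"] by (rule integrable_indicator_mult[OF Q_M u_stopped(1)])
  have "(LINT w|M. indicator (Q n) w * u (\<tau> n w) w)
      \<le> (LINT w|M. 2 / l * indicator (Q n) w + H w + \<bar>escape_fun l (uT w) (vT w)\<bar>)"
  proof (rule integral_mono_AE[OF Qu])
    show "integrable M (\<lambda>w. 2 / l * indicator (Q n) w + H w + \<bar>escape_fun l (uT w) (vT w)\<bar>)"
      using fin_ind[OF Q_M] by (intro Bochner_Integration.integrable_add H_int R_int integrable_mult_right)
    show "AE w in M. indicator (Q n) w * u (\<tau> n w) w \<le> 2 / l * indicator (Q n) w + H w + \<bar>escape_fun l (uT w) (vT w)\<bar>"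
      using UV_nonneg
    proof eventually_elim
      fix w assume UV: "w \<in> A \<longrightarrow> (\<forall>n. 0 \<le> U (\<tau> n w) w \<and> 0 \<le> V (\<tau> n w) w)"
      show "indicator (Q n) w * u (\<tau> n w) w \<le> 2 / l * indicator (Q n) w + H w + \<bar>escape_fun l (uT w) (vT w)\<bar>"
      proof (cases "w \<in> A")
        case A: True
        have u0: "0 \<le> u (\<tau> n w) w" using UV A by (simp add: u_def)
        show ?thesis
        proof (cases "w \<in> Q n")
          case True
          then show ?thesis
            using escape_fun_lower[OF l u0, of "v (\<tau> n w) w"] A by (simp add: H_def)
        next
          case False
          then have "w \<in> A - (\<Inter>n. Q n)" using A by auto
          then have "uT w = u (\<tau> n w) w" "vT w = v (\<tau> n w) w"
            using tau_not_Q[OF A False] by (simp_all only: uT_def vT_def indicator_simps mult_1)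
          then show ?thesis using A False by (simp add: H_def)
        qed
      next
        case False
        then show ?thesis using Q_subset[of n] by (auto simp: H_def indicator_def)
      qed
    qed
  qed
  also have "\<dots> = 2 / l * prob (Q n) + c + R"
    unfolding R_def using H_int R_int fin_ind[OF Q_M[of n]] Q_M[of n] by (simp add: H_val)
  finally show ?thesis .
qed

text \<open>The order of the limits matters. A small \<open>l\<close> is fixed first, making
  \<open>c + R\<close> small by dominated convergence; only then does \<open>n\<close> grow, so that
  \<open>prob (Q n)\<close> defeats the large factor \<open>2 / l\<close>.\<close>

private lemma no_escape: "(\<lambda>n. LINT w|M. indicator (Q n) w * u (\<tau> n w) w) \<longlonglongrightarrow> 0"
proof -
  define l where "l = (\<lambda>m. 1 / real (Suc m))"
  have l: "0 < l m" for m by (simp add: l_def)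
  define c where "c = (\<lambda>m. LINT w|M. indicator A w * escape_fun (l m) (u s w) (v s w))"
  define R where "R = (\<lambda>m. LINT w|M. \<bar>escape_fun (l m) (uT w) (vT w)\<bar>)"
  have c: "c \<longlonglongrightarrow> (LINT w|M. 0)"
    unfolding c_def
  proof (rule integral_dominated_convergence[where w="\<lambda>_. 2 * (2 * \<bar>K\<bar>) + (a + 2 / a) * (2 * \<bar>K\<bar>)"])
    show "AE w in M. (\<lambda>m. indicator A w * escape_fun (l m) (u s w) (v s w)) \<longlonglongrightarrow> 0"
      unfolding l_def by (intro always_eventually allI tendsto_mult_right_zero escape_fun_tendsto)
    show "AE w in M. norm (indicator A w * escape_fun (l m) (u s w) (v s w)) \<le> 2 * (2 * \<bar>K\<bar>) + (a + 2 / a) * (2 * \<bar>K\<bar>)" for m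
    proof (intro always_eventually allI)
      fix w
      show "norm (indicator A w * escape_fun (l m) (u s w) (v s w)) \<le> 2 * (2 * \<bar>K\<bar>) + (a + 2 / a) * (2 * \<bar>K\<bar>)"
      proof (cases "w \<in> A")
        case True
        have "\<bar>escape_fun (l m) (u s w) (v s w)\<bar> \<le> 2 * u s w + \<bar>v s w\<bar>"
          using u_s_bounds[OF True] by (intro escape_fun_abs l) auto
        also have "\<dots> \<le> 2 * (2 * \<bar>K\<bar>) + (a + 2 / a) * (2 * \<bar>K\<bar>)"
          using u_s_bounds[OF True] by (intro add_mono) auto
        finally show ?thesis using True by simp
      qed (use a in auto)
    qed
    show "(\<lambda>w. indicator A w * escape_fun (l m) (u s w) (v s w)) \<in> borel_measurable M" for m
      using A_M measurable_F_M[OF \<xi>(1)] measurable_F_M[OF \<eta>(1)] unfolding u_def v_def U_def V_def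
      by (intro borel_measurable_times borel_measurable_indicator escape_measurable) auto
  qed auto
  have R: "R \<longlonglongrightarrow> (LINT w|M. 0)"
    unfolding R_def
  proof (rule integral_dominated_convergence[where w="\<lambda>w. (2 + (a + 2 / a)) * uT w"])
    show "AE w in M. (\<lambda>m. \<bar>escape_fun (l m) (uT w) (vT w)\<bar>) \<longlonglongrightarrow> 0"
      unfolding l_def by (intro always_eventually allI tendsto_rabs_zero escape_fun_tendsto)
    show "AE w in M. norm \<bar>escape_fun (l m) (uT w) (vT w)\<bar> \<le> (2 + (a + 2 / a)) * uT w" for m
      using uT_vT_bounds
    proof eventually_elim
      fix w assume b: "0 \<le> uT w \<and> \<bar>vT w\<bar> \<le> (a + 2 / a) * uT w"
      have "\<bar>escape_fun (l m) (uT w) (vT w)\<bar> \<le> 2 * uT w + \<bar>vT w\<bar>"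
        using b by (intro escape_fun_abs l) auto
      also have "\<dots> \<le> (2 + (a + 2 / a)) * uT w" using b by (simp add: distrib_right)
      finally show "norm \<bar>escape_fun (l m) (uT w) (vT w)\<bar> \<le> (2 + (a + 2 / a)) * uT w" by simp
    qed
  qed (use uT_integrable in \<open>auto intro!: borel_measurable_abs escape_measurable uT_measurable vT_measurable\<close>)
  have cR: "(\<lambda>m. c m + R m) \<longlonglongrightarrow> 0" using tendsto_add[OF c R] by simp
  show ?thesis
  proof (rule LIMSEQ_I)
    fix r :: real assume r: "0 < r"
    have "\<forall>\<^sub>F m in sequentially. c m + R m < r / 2"
      using cR r by (intro order_tendstoD) auto
    then obtain m where m: "c m + R m < r / 2"
      by (auto simp: eventually_sequentially)
    have "(\<lambda>n. 2 / l m * prob (Q n)) \<longlonglongrightarrow> 2 / l m * 0"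
      by (intro tendsto_intros Q_lim)
    then have "\<forall>\<^sub>F n in sequentially. 2 / l m * prob (Q n) < r / 2"
      using r by (intro order_tendstoD) auto
    then obtain N where N: "\<And>n. N \<le> n \<Longrightarrow> 2 / l m * prob (Q n) < r / 2"
      by (auto simp: eventually_sequentially)
    show "\<exists>N. \<forall>n\<ge>N. norm ((LINT w|M. indicator (Q n) w * u (\<tau> n w) w) - 0) < r"
    proof (intro exI allI impI)
      fix n assume n: "N \<le> n"
      have "(LINT w|M. indicator (Q n) w * u (\<tau> n w) w) < r"
        using escape_bound[OF l[of m], of n, folded c_def R_def] N[OF n] m unfolding c_def R_def by linarith
      moreover have "0 \<le> (LINT w|M. indicator (Q n) w * u (\<tau> n w) w)"
      proof (rule integral_nonneg_AE)
        show "AE w in M. 0 \<le> indicator (Q n) w * u (\<tau> n w) w"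
          using UV_nonneg
          by eventually_elim (use Q_subset[of n] in \<open>auto simp: indicator_def u_def\<close>)
      qed
      ultimately show "norm ((LINT w|M. indicator (Q n) w * u (\<tau> n w) w) - 0) < r" by simp
    qed
  qed
qed

text \<open>The stopped mean of \<open>W\<close> equals the initial one, and its part over
  \<open>Q n\<close> is at most the mean of \<open>u\<close> there, which tends to 0. This is the
  delicate direction; the opposite inequality is Fatou alone.\<close>

private lemma exit_bound_aux:
  assumes W: "AE w in M. w \<in> A \<longrightarrow> (\<forall>n. 0 \<le> W (\<tau> n w) w \<and> W (\<tau> n w) w \<le> u (\<tau> n w) w)"
    and Wi: "\<And>n. integrable M (\<lambda>w. indicator A w * W (\<tau> n w) w)"
    and Wv: "\<And>n. (LINT w|M. indicator A w * W (\<tau> n w) w) = (LINT w|M. indicator A w * \<zeta> w)"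
    and \<zeta>: "\<zeta> \<in> borel_measurable (F s)" "\<And>w. w \<in> A \<Longrightarrow> 0 \<le> \<zeta> w \<and> \<zeta> w \<le> K"
  shows "(\<integral>\<^sup>+w. indicator A w * ennreal (\<zeta> w) \<partial>M)
      \<le> (\<integral>\<^sup>+w. indicator A w * ennreal (W (real_of_ereal (T w)) w) \<partial>M)"
proof -
  have \<zeta>i: "integrable M (\<lambda>w. indicator A w * \<zeta> w)"
    using \<zeta>(2) A_M measurable_F_M[OF \<zeta>(1)]
    by (intro integrable_const_bound[where B="\<bar>K\<bar>"]) (force simp: indicator_def)+
  define e where "e = (LINT w|M. indicator A w * \<zeta> w)"
  have "(\<integral>\<^sup>+w. indicator A w * ennreal (\<zeta> w) \<partial>M) = (\<integral>\<^sup>+w. ennreal (indicator A w * \<zeta> w) \<partial>M)"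
    by (intro nn_integral_cong) (auto simp: indicator_def)
  also have "\<dots> = ennreal e"
    unfolding e_def using \<zeta>(2) by (intro nn_integral_eq_integral \<zeta>i) (auto simp: indicator_def)
  also have "\<dots> \<le> (\<integral>\<^sup>+w. indicator A w * ennreal (W (real_of_ereal (T w)) w) \<partial>M)"
  proof (rule LIMSEQ_le_const2)
    have "(\<lambda>n. e - (LINT w|M. indicator (Q n) w * u (\<tau> n w) w)) \<longlonglongrightarrow> e - 0"
      by (intro tendsto_intros no_escape)
    then show "(\<lambda>n. ennreal (e - (LINT w|M. indicator (Q n) w * u (\<tau> n w) w))) \<longlonglongrightarrow> ennreal e"
      by (intro tendsto_ennrealI) simp
    have Q_mult: "indicator (Q n) w * (x :: real) = indicator (Q n) w * (indicator A w * x)" for n w x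
      using Q_subset[of n] by (auto simp: indicator_def)
    have "ennreal (e - (LINT w|M. indicator (Q n) w * u (\<tau> n w) w))
        \<le> (\<integral>\<^sup>+w. indicator A w * ennreal (W (real_of_ereal (T w)) w) \<partial>M)" for n
    proof -
      have Qu: "integrable M (\<lambda>w. indicator (Q n) w * u (\<tau> n w) w)"
        unfolding Q_mult[of n _ "u _ _"] by (rule integrable_indicator_mult[OF Q_M u_stopped(1)])
      have AW: "integrable M (\<lambda>w. indicator (A - Q n) w * W (\<tau> n w) w)"
        unfolding AQ_mult[of n _ "W _ _"] by (rule integrable_indicator_mult[OF AQ_M Wi])
      have "e = (LINT w|M. indicator A w * W (\<tau> n w) w)"
        by (simp add: e_def Wv)
      also have "\<dots> \<le> (LINT w|M. indicator (A - Q n) w * W (\<tau> n w) w + indicator (Q n) w * u (\<tau> n w) w)"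
      proof (rule integral_mono_AE[OF Wi Bochner_Integration.integrable_add[OF AW Qu]])
        show "AE w in M. indicator A w * W (\<tau> n w) w \<le> indicator (A - Q n) w * W (\<tau> n w) w + indicator (Q n) w * u (\<tau> n w) w"
          using W by eventually_elim (use Q_subset[of n] in \<open>auto simp: indicator_def\<close>)
      qed
      also have "\<dots> = (LINT w|M. indicator (A - Q n) w * W (\<tau> n w) w) + (LINT w|M. indicator (Q n) w * u (\<tau> n w) w)"
        by (rule Bochner_Integration.integral_add[OF AW Qu])
      finally have "ennreal (e - (LINT w|M. indicator (Q n) w * u (\<tau> n w) w)) \<le> ennreal (LINT w|M. indicator (A - Q n) w * W (\<tau> n w) w)"
        by (intro ennreal_leI) simp
      also have "\<dots> = (\<integral>\<^sup>+w. ennreal (indicator (A - Q n) w * W (\<tau> n w) w) \<partial>M)"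
      proof (rule nn_integral_eq_integral[OF AW, symmetric])
        show "AE w in M. 0 \<le> indicator (A - Q n) w * W (\<tau> n w) w"
          using W by eventually_elim (auto simp: indicator_def)
      qed
      also have "\<dots> \<le> (\<integral>\<^sup>+w. indicator A w * ennreal (W (real_of_ereal (T w)) w) \<partial>M)"
        by (intro nn_integral_mono) (auto simp: indicator_def tau_not_Q)
      finally show ?thesis .
    qed
    then show "\<exists>N. \<forall>n\<ge>N. ennreal (e - (LINT w|M. indicator (Q n) w * u (\<tau> n w) w))
        \<le> (\<integral>\<^sup>+w. indicator A w * ennreal (W (real_of_ereal (T w)) w) \<partial>M)" by blast
  qed
  finally show ?thesis .
qed

lemma wedge_exit_fst:
  "(\<integral>\<^sup>+w. indicator A w * ennreal (\<xi> w) \<partial>M)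
    \<le> (\<integral>\<^sup>+w. indicator A w * ennreal (\<xi> w + dB1 s (real_of_ereal (T w)) w) \<partial>M)"
proof (rule exit_bound_aux[where W=U and \<zeta>=\<xi>, unfolded U_def, OF _ U_stopped[unfolded U_def] \<xi>])
  show "AE w in M. w \<in> A \<longrightarrow> (\<forall>n. 0 \<le> \<xi> w + dB1 s (\<tau> n w) w \<and> \<xi> w + dB1 s (\<tau> n w) w \<le> u (\<tau> n w) w)"
    using UV_nonneg by eventually_elim (auto simp: u_def U_def)
qed

lemma wedge_exit_snd:
  "(\<integral>\<^sup>+w. indicator A w * ennreal (\<eta> w) \<partial>M)
    \<le> (\<integral>\<^sup>+w. indicator A w * ennreal (\<eta> w + (dB1 s (real_of_ereal (T w)) w
          + a * dB2 s (real_of_ereal (T w)) w)) \<partial>M)"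
proof (rule exit_bound_aux[where W=V and \<zeta>=\<eta>, unfolded V_def, OF _ V_stopped[unfolded V_def] \<eta>])
  show "AE w in M. w \<in> A \<longrightarrow> (\<forall>n. 0 \<le> \<eta> w + (dB1 s (\<tau> n w) w + a * dB2 s (\<tau> n w) w) \<and>
      \<eta> w + (dB1 s (\<tau> n w) w + a * dB2 s (\<tau> n w) w) \<le> u (\<tau> n w) w)"
    using UV_nonneg by eventually_elim (auto simp: u_def V_def)
qed

lemmas wedge_exit = exit_finite wedge_exit_fst wedge_exit_snd

end

end

subsection \<open>Hitting times of zero\<close>

definition first_zero :: "(real \<Rightarrow> 'w \<Rightarrow> real) \<Rightarrow> real \<Rightarrow> 'w \<Rightarrow> ereal" where
  "first_zero Z s w = (INF t \<in> {t. s \<le> t \<and> Z t w = 0}. ereal t)"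

lemma first_zero_ge: "ereal s \<le> first_zero Z s w"
  unfolding first_zero_def by (rule INF_greatest) auto

lemma first_zero_lower: "s \<le> t \<Longrightarrow> Z t w = 0 \<Longrightarrow> first_zero Z s w \<le> ereal t"
  unfolding first_zero_def by (rule INF_lower) auto

lemma first_zero_attained:
  assumes cont: "continuous_on {s..} (\<lambda>t. Z t w)" and fin: "first_zero Z s w < \<infinity>"
  shows "\<exists>t. first_zero Z s w = ereal t \<and> s \<le> t \<and> Z t w = 0"
proof -
  define C where "C = {t. s \<le> t \<and> Z t w = 0}"
  have ne: "C \<noteq> {}"
    using fin by (auto simp: first_zero_def C_def[symmetric] top_ereal_def)
  have bdd: "bdd_below C" by (auto simp: C_def intro!: bdd_belowI[of _ s])
  have "closed ({s..} \<inter> (\<lambda>t. Z t w) -` {0})"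
    by (rule continuous_closed_preimage[OF cont]) auto
  also have "{s..} \<inter> (\<lambda>t. Z t w) -` {0} = C" by (auto simp: C_def)
  finally have "Inf C \<in> C" by (rule closed_contains_Inf[OF ne bdd])
  moreover have "first_zero Z s w = ereal (Inf C)"
  proof (rule antisym)
    show "first_zero Z s w \<le> ereal (Inf C)"
      using \<open>Inf C \<in> C\<close> by (intro first_zero_lower) (auto simp: C_def)
    show "ereal (Inf C) \<le> first_zero Z s w"
      unfolding first_zero_def C_def[symmetric]
      by (rule INF_greatest) (simp add: cInf_lower[OF _ bdd])
  qed
  ultimately show ?thesis by (auto simp: C_def)
qed

text \<open>A continuous path has a zero in the compact interval from \<open>s\<close> to
  \<open>r\<close> exactly if its values on a countable dense set come arbitrarily close to 0,
  because the minimum of \<open>\<bar>Z\<bar>\<close> is attained. Only times up to \<open>r\<close>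
  are consulted, so \<open>F r\<close> suffices.\<close>

lemma (in filtered_prob_space) first_zero_stopping:
  assumes s: "0 \<le> s" "s \<le> r"
    and Z: "adapted F Z" "\<And>w. w \<in> space M \<Longrightarrow> continuous_on {0..} (\<lambda>t. Z t w)"
  shows "{w \<in> space M. first_zero Z s w \<le> ereal r} \<in> sets (F r)"
proof -
  \<comment> \<open>The endpoints take care of a zero at \<open>s\<close> or \<open>r\<close>, in
    particular if \<open>s = r\<close>, when the interval may contain no rational at all.\<close>
  define D where "D = {s, r} \<union> (\<rat> \<inter> {s..r})"
  have D: "countable D" "D \<subseteq> {s..r}"
    using s by (auto simp: D_def countable_rat intro: countable_subset[OF _ countable_rat])
  have cont: "continuous_on {s..r} (\<lambda>t. Z t w)" if "w \<in> space M" for w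
    using Z(2)[OF that] by (rule continuous_on_subset) (use s in auto)
  have iff: "first_zero Z s w \<le> ereal r \<longleftrightarrow> (\<forall>n. \<exists>q\<in>D. \<bar>Z q w\<bar> < 1 / real (Suc n))" if w: "w \<in> space M" for w
  proof
    assume le: "first_zero Z s w \<le> ereal r"
    have cs: "continuous_on {s..} (\<lambda>t. Z t w)"
      using Z(2)[OF w] by (rule continuous_on_subset) (use s in auto)
    obtain t where t: "s \<le> t" "t \<le> r" "Z t w = 0"
      using first_zero_attained[where Z=Z and w=w, OF cs le_less_trans[OF le]] le by auto
    show "\<forall>n. \<exists>q\<in>D. \<bar>Z q w\<bar> < 1 / real (Suc n)"
    proof
      fix n
      show "\<exists>q\<in>D. \<bar>Z q w\<bar> < 1 / real (Suc n)"
      proof (cases "t = s \<or> t = r")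
        case True
        then show ?thesis using t by (intro bexI[of _ t]) (auto simp: D_def)
      next
        case False
        then have t': "s < t" "t < r" using t by auto
        have "\<exists>d>0. \<forall>q\<in>{s..r}. dist q t < d \<longrightarrow> dist (Z q w) (Z t w) < 1 / real (Suc n)"
          using cont[OF w, unfolded continuous_on_iff, rule_format, of t "1 / real (Suc n)"] t by simp
        then obtain d where d: "d > 0" "\<And>q. q \<in> {s..r} \<Longrightarrow> dist q t < d \<Longrightarrow> dist (Z q w) (Z t w) < 1 / real (Suc n)"
          by blast
        obtain q where q: "q \<in> \<rat>" "t < q" "q < min r (t + d)"
          using Rats_dense_in_real[of t "min r (t + d)"] t' d by auto
        then have "q \<in> D" using t' by (auto simp: D_def)
        moreover have "\<bar>Z q w\<bar> < 1 / real (Suc n)"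
          using d(2)[of q] q t' t by (auto simp: dist_real_def)
        ultimately show ?thesis by blast
      qed
    qed
  next
    assume *: "\<forall>n. \<exists>q\<in>D. \<bar>Z q w\<bar> < 1 / real (Suc n)"
    have "\<exists>t\<in>{s..r}. \<forall>y\<in>{s..r}. \<bar>Z t w\<bar> \<le> \<bar>Z y w\<bar>"
      using s cont[OF w] by (intro continuous_attains_inf continuous_intros) auto
    then obtain t where t: "t \<in> {s..r}" "\<And>y. y \<in> {s..r} \<Longrightarrow> \<bar>Z t w\<bar> \<le> \<bar>Z y w\<bar>" by blast
    have "\<bar>Z t w\<bar> \<le> 1 / real (Suc n)" for n
    proof -
      obtain q where "q \<in> D" "\<bar>Z q w\<bar> < 1 / real (Suc n)" using * by blast
      then show ?thesis using t(2)[of q] D(2) by auto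
    qed
    then have "\<bar>Z t w\<bar> \<le> 0"
      by (intro LIMSEQ_le_const[OF LIMSEQ_Suc[OF lim_const_over_n[of 1]]]) auto
    then have "first_zero Z s w \<le> ereal t" using t(1) by (intro first_zero_lower) auto
    then show "first_zero Z s w \<le> ereal r" using t(1) by (auto intro: order_trans)
  qed
  have Zq: "Z q \<in> borel_measurable (F r)" if "q \<in> D" for q
  proof (rule measurable_F_mono)
    show "Z q \<in> borel_measurable (F q)" using Z(1) that D(2) s by (auto simp: adapted_def)
    show "q \<le> r" using that D(2) by auto
  qed
  have "{w \<in> space M. first_zero Z s w \<le> ereal r} = {w \<in> space (F r). \<forall>n. \<exists>q\<in>D. \<bar>Z q w\<bar> < 1 / real (Suc n)}"
    using iff by (auto simp: space_F)
  also have "\<dots> \<in> sets (F r)"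
  proof (intro sets.sets_Collect_countable_All sets.sets_Collect_countable_Ex')
    fix n q assume "q \<in> D"
    then show "{w \<in> space (F r). \<bar>Z q w\<bar> < 1 / real (Suc n)} \<in> sets (F r)"
      using Zq[of q] by measurable
  qed (rule D)
  finally show ?thesis .
qed

text \<open>Nonnegativity turns the joint condition into a zero of one continuous process, to which
  the results on first zeros apply.\<close>

lemma corner_time_eq_first_zero:
  assumes "\<And>t. 0 \<le> t \<Longrightarrow> 0 \<le> X t w \<and> 0 \<le> Y t w"
  shows "corner_time X Y w = first_zero (\<lambda>t w. X t w + Y t w) 0 w"
proof -
  have "X t w + Y t w = 0 \<longleftrightarrow> X t w = 0 \<and> Y t w = 0" if "0 \<le> t" for t
    using assms[OF that] by (simp add: add_nonneg_eq_0_iff)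
  then have "{t. 0 \<le> t \<and> X t w = 0 \<and> Y t w = 0} = {t. 0 \<le> t \<and> X t w + Y t w = 0}"
    by (intro Collect_cong) (simp cong: conj_cong)
  then show ?thesis by (simp add: corner_time_def first_zero_def)
qed

subsection \<open>Paths of the local time\<close>

text \<open>The approximations of the local time at \<open>s\<close> and at \<open>t\<close> use two
  different Stieltjes measures, and comparing them requires that these agree on sets that end by
  \<open>s\<close>. Half-open intervals form a generating \<pi>-system on which the agreement is
  read off from the distribution functions.\<close>

lemma interval_measure_freeze:
  fixes q :: "real \<Rightarrow> real"
  assumes st: "0 \<le> s" "s \<le> t" and mono: "mono_on {0..t} q" and cont: "continuous_on {0..t} q"
    and E: "E \<in> sets borel" "E \<subseteq> {..s}"
  shows "emeasure (interval_measure (\<lambda>r. q (max 0 (min r s)))) E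
       = emeasure (interval_measure (\<lambda>r. q (max 0 (min r t)))) E"
proof -
  define G where "G = (\<lambda>t r. q (max 0 (min r t)))"
  have Gm: "G u a \<le> G u b" if "a \<le> b" "u = s \<or> u = t" for u a b
    using that st unfolding G_def by (intro mono_onD[OF mono]) auto
  have Gc: "continuous (at_right a) (G u)" if "u = s \<or> u = t" for u a
  proof -
    have "continuous_on UNIV (G u)"
      unfolding G_def
      by (rule continuous_on_compose2[OF cont]) (use that st in \<open>auto intro!: continuous_intros\<close>)
    then show ?thesis
      by (simp add: continuous_on_eq_continuous_at continuous_at_imp_continuous_within)
  qed
  have Ioc: "emeasure (interval_measure (G u)) {a<..b} = (if a \<le> b then G u b - G u a else 0)"
    if "u = s \<or> u = t" for u a b
    by (rule emeasure_interval_measure_Ioc_eq) (use Gm Gc that in auto)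
  define N where "N = density (interval_measure (G t)) (indicator {..s})"
  have N: "emeasure N A = emeasure (interval_measure (G t)) (A \<inter> {..s})" if "A \<in> sets borel" for A
    using that unfolding N_def
    by (subst emeasure_density) (auto simp: nn_integral_indicator indicator_inter_arith[symmetric] mult.commute)
  have "interval_measure (G s) = N"
  proof (rule measure_eqI_generator_eq[where \<Omega>=UNIV and E="range (\<lambda>(a,b). {a<..b::real})"
        and A="\<lambda>i. {- real i <.. real i}"])
    show "Int_stable (range (\<lambda>(a,b). {a<..b::real}))"
      by (auto simp: Int_stable_def)
    show "sets (interval_measure (G s)) = sigma_sets UNIV (range (\<lambda>(a,b). {a<..b::real}))"
      "sets N = sigma_sets UNIV (range (\<lambda>(a,b). {a<..b::real}))"
      unfolding N_def by (simp_all add: borel_sigma_sets_Ioc)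
    show "emeasure (interval_measure (G s)) {- real i <.. real i} \<noteq> \<infinity>" for i
      by (subst Ioc) auto
    show "(\<Union>i. {- real i <.. real i}) = UNIV"
      by (rule UN_Ioc_eq_UNIV)
    fix X assume "X \<in> range (\<lambda>(a,b). {a<..b::real})"
    then obtain a b where X: "X = {a<..b}" by auto
    have 1: "{a<..b} \<inter> {..s} = {a<..min b s}" by auto
    have 2: "G t (min b s) = G s b" using st unfolding G_def by (simp add: min.absorb1)
    have 3: "G t a = G s a" if "a \<le> s" using st that unfolding G_def by (simp add: min.absorb1)
    have 4: "G s b = G s a" if "s < a" "a \<le> b" using st that unfolding G_def by (simp add: min.absorb2)
    show "emeasure (interval_measure (G s)) X = emeasure N X"
    proof (cases "a \<le> s")
      case True
      then show ?thesis unfolding X by (subst N) (simp_all add: 1 Ioc 2 3)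
    next
      case False
      then show ?thesis unfolding X using 4 by (subst N) (simp_all add: 1 Ioc)
    qed
  qed auto
  then have "emeasure (interval_measure (G s)) E = emeasure N E" by simp
  also have "\<dots> = emeasure (interval_measure (G t)) E"
    using E by (subst N) (auto simp: Int_absorb2)
  finally show ?thesis unfolding G_def .
qed

text \<open>This is the whole interface between the definition of symmetric local time and the rest
  of the argument: a nonnegative, nondecreasing function that is constant while \<open>z\<close>
  avoids 0.\<close>

definition local_time_path :: "ereal \<Rightarrow> (real \<Rightarrow> real) \<Rightarrow> (real \<Rightarrow> real) \<Rightarrow> bool" where
  "local_time_path \<sigma> z l \<longleftrightarrow>
    (\<forall>t. 0 \<le> t \<longrightarrow> ereal t < \<sigma> \<longrightarrow> 0 \<le> l t) \<and>
    (\<forall>s t. 0 \<le> s \<longrightarrow> s \<le> t \<longrightarrow> ereal t < \<sigma> \<longrightarrow> l s \<le> l t) \<and>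
    (\<forall>s t. 0 \<le> s \<longrightarrow> s \<le> t \<longrightarrow> ereal t < \<sigma> \<longrightarrow> (\<forall>r\<in>{s..t}. z r \<noteq> 0) \<longrightarrow> l t = l s)"

lemma local_time_pathD:
  assumes "local_time_path \<sigma> z l"
  shows "0 \<le> t \<Longrightarrow> ereal t < \<sigma> \<Longrightarrow> 0 \<le> l t"
    and "0 \<le> s \<Longrightarrow> s \<le> t \<Longrightarrow> ereal t < \<sigma> \<Longrightarrow> l s \<le> l t"
    and "0 \<le> s \<Longrightarrow> s \<le> t \<Longrightarrow> ereal t < \<sigma> \<Longrightarrow> \<forall>r\<in>{s..t}. z r \<noteq> 0 \<Longrightarrow> l t = l s"
  using assms unfolding local_time_path_def by blast+

text \<open>Each property holds for the \<epsilon>-averages and survives the limit. Monotonicity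
  compares nested sets under one measure, after freezing; constancy holds because the averages at
  \<open>s\<close> and \<open>t\<close> coincide for small \<epsilon>.\<close>

lemma is_symmetric_local_time_path:
  assumes L: "is_symmetric_local_time M \<sigma> Z L"
    and cont: "\<And>w. w \<in> space M \<Longrightarrow> continuous_on {0..} (\<lambda>t. Z t w)"
  shows "AE w in M. local_time_path (\<sigma> w) (\<lambda>t. Z t w) (\<lambda>t. L t w)"
proof -
  obtain Q where Q: "is_quadratic_variation M \<sigma> Z Q"
    and lim: "AE w in M. \<forall>t\<ge>0. ereal t < \<sigma> w \<longrightarrow>
          ((\<lambda>\<epsilon>. 1 / (2 * \<epsilon>) *
              (LINT s:{0..t}|stieltjes_measure (\<lambda>s. Q s w) t. indicator {s. \<bar>Z s w\<bar> \<le> \<epsilon>} s))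
           \<longlongrightarrow> L t w) (at_right 0)"
    using L unfolding is_symmetric_local_time_def by auto
  have Qpath: "AE w in M. continuous_on {t. 0 \<le> t \<and> ereal t < \<sigma> w} (\<lambda>t. Q t w) \<and>
                 mono_on {t. 0 \<le> t \<and> ereal t < \<sigma> w} (\<lambda>t. Q t w)"
    using Q by (simp add: is_quadratic_variation_def)
  show ?thesis
    using lim Qpath AE_space
  proof eventually_elim
    fix w
    assume lim: "\<forall>t\<ge>0. ereal t < \<sigma> w \<longrightarrow>
          ((\<lambda>\<epsilon>. 1 / (2 * \<epsilon>) *
              (LINT s:{0..t}|stieltjes_measure (\<lambda>s. Q s w) t. indicator {s. \<bar>Z s w\<bar> \<le> \<epsilon>} s))
           \<longlongrightarrow> L t w) (at_right 0)"
      and Qp: "continuous_on {t. 0 \<le> t \<and> ereal t < \<sigma> w} (\<lambda>t. Q t w) \<and>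
                 mono_on {t. 0 \<le> t \<and> ereal t < \<sigma> w} (\<lambda>t. Q t w)"
      and w: "w \<in> space M"
    define \<mu> where "\<mu> = (\<lambda>t. stieltjes_measure (\<lambda>s. Q s w) t)"
    define E where "E = (\<lambda>\<epsilon> t. {0..t} \<inter> {s. \<bar>Z s w\<bar> \<le> \<epsilon>})"
    have E_borel: "E \<epsilon> t \<in> sets borel" for \<epsilon> t
    proof -
      have "continuous_on {0..t} (\<lambda>s. \<bar>Z s w\<bar>)"
        by (intro continuous_intros continuous_on_subset[OF cont[OF w]]) auto
      then have "closed ({0..t} \<inter> (\<lambda>s. \<bar>Z s w\<bar>) -` {..\<epsilon>})"
        by (rule continuous_closed_preimage) auto
      also have "{0..t} \<inter> (\<lambda>s. \<bar>Z s w\<bar>) -` {..\<epsilon>} = E \<epsilon> t" by (auto simp: E_def)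
      finally show ?thesis by (rule borel_closed)
    qed
    have sets_\<mu>: "sets (\<mu> t) = sets borel" for t by (simp add: \<mu>_def stieltjes_measure_def)
    have int_eq: "(LINT s:{0..t}|\<mu> t. indicator {s. \<bar>Z s w\<bar> \<le> \<epsilon>} s) = measure (\<mu> t) (E \<epsilon> t)" for \<epsilon> t
    proof -
      have "(LINT s:{0..t}|\<mu> t. indicator {s. \<bar>Z s w\<bar> \<le> \<epsilon>} s) = (LINT s|\<mu> t. indicator (E \<epsilon> t) s)"
        unfolding set_lebesgue_integral_def E_def
        by (intro Bochner_Integration.integral_cong refl) (auto simp: indicator_def)
      also have "\<dots> = measure (\<mu> t) (E \<epsilon> t)"
        using E_borel[of \<epsilon> t] by (simp add: sets_\<mu> sets_eq_imp_space_eq[OF sets_\<mu>])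
      finally show ?thesis .
    qed
    define \<phi> where "\<phi> = (\<lambda>t \<epsilon>. 1 / (2 * \<epsilon>) * measure (\<mu> t) (E \<epsilon> t))"
    have \<phi>: "(\<phi> t \<longlongrightarrow> L t w) (at_right 0)" if "0 \<le> t" "ereal t < \<sigma> w" for t
      using lim that unfolding \<phi>_def \<mu>_def[symmetric] int_eq by auto
    have nn: "0 \<le> L t w" if "0 \<le> t" "ereal t < \<sigma> w" for t
    proof (rule tendsto_lowerbound[OF \<phi>[OF that]])
      show "\<forall>\<^sub>F \<epsilon> in at_right 0. 0 \<le> \<phi> t \<epsilon>"
        using eventually_at_right_less[of 0] by eventually_elim (simp add: \<phi>_def)
    qed auto
    have Qt: "mono_on {0..t} (\<lambda>t. Q t w)" "continuous_on {0..t} (\<lambda>t. Q t w)" if "ereal t < \<sigma> w" for t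
    proof -
      have "{0..t} \<subseteq> {t. 0 \<le> t \<and> ereal t < \<sigma> w}" using that by (auto intro: le_less_trans[of _ "ereal t"])
      then show "mono_on {0..t} (\<lambda>t. Q t w)" "continuous_on {0..t} (\<lambda>t. Q t w)"
        using Qp by (auto intro: mono_on_subset continuous_on_subset)
    qed
    have freeze: "measure (\<mu> s) (E \<epsilon> s) = measure (\<mu> t) (E \<epsilon> s)"
      if "0 \<le> s" "s \<le> t" "ereal t < \<sigma> w" for s t \<epsilon>
    proof -
      have "emeasure (\<mu> s) (E \<epsilon> s) = emeasure (\<mu> t) (E \<epsilon> s)"
        unfolding \<mu>_def stieltjes_measure_def using that E_borel
        by (intro interval_measure_freeze[where q="\<lambda>s. Q s w"] Qt) (auto simp: E_def)
      then show ?thesis by (simp add: measure_def)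
    qed
    \<comment> \<open>\<open>measure\<close> turns an infinite value into 0, so comparing nested
      sets by \<open>measure\<close> requires finiteness first.\<close>
    have fin: "emeasure (\<mu> t) (E \<epsilon> t) \<noteq> \<infinity>" if "0 \<le> t" "ereal t < \<sigma> w" for t \<epsilon>
    proof -
      let ?q = "\<lambda>s. Q (max 0 (min s t)) w"
      \<comment> \<open>The half-open interval starts at -1 because one starting at 0 would miss the
        time 0.\<close>
      have "emeasure (\<mu> t) (E \<epsilon> t) \<le> emeasure (\<mu> t) {-1<..t}"
        by (rule emeasure_mono) (auto simp: E_def sets_\<mu>)
      also have "\<dots> = ennreal (?q t - ?q (- 1))"
        unfolding \<mu>_def stieltjes_measure_def
      proof (rule emeasure_interval_measure_Ioc)
        show "- 1 \<le> t" using that by simp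
        show "?q y \<le> ?q z" if "y \<le> z" for y z
          using \<open>0 \<le> t\<close> that by (intro mono_onD[OF Qt(1)[OF \<open>ereal t < \<sigma> w\<close>]]) auto
        have "continuous_on UNIV ?q"
          by (rule continuous_on_compose2[OF Qt(2)[OF \<open>ereal t < \<sigma> w\<close>]])
             (use that in \<open>auto intro!: continuous_intros\<close>)
        then show "continuous (at_right y) ?q" for y
          by (simp add: continuous_on_eq_continuous_at continuous_at_imp_continuous_within)
      qed
      finally show ?thesis by (auto simp: top_unique)
    qed
    have mono: "L s w \<le> L t w" if st: "0 \<le> s" "s \<le> t" "ereal t < \<sigma> w" for s t
    proof (rule tendsto_le[OF _ \<phi> \<phi>])
      show "0 \<le> t" "ereal t < \<sigma> w" "0 \<le> s" "ereal s < \<sigma> w"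
        using st by (auto intro: le_less_trans[of _ "ereal t"])
      show "\<forall>\<^sub>F \<epsilon> in at_right 0. \<phi> s \<epsilon> \<le> \<phi> t \<epsilon>"
        using eventually_at_right_less[of 0]
      proof eventually_elim
        fix \<epsilon> :: real assume "0 < \<epsilon>"
        have "enn2real (emeasure (\<mu> t) (E \<epsilon> s)) \<le> enn2real (emeasure (\<mu> t) (E \<epsilon> t))"
          using st fin[of t \<epsilon>] E_borel
          by (intro enn2real_mono emeasure_mono) (auto simp: E_def sets_\<mu> less_top[symmetric])
        then show "\<phi> s \<epsilon> \<le> \<phi> t \<epsilon>"
          using \<open>0 < \<epsilon>\<close> unfolding \<phi>_def freeze[OF st] by (intro mult_left_mono) (auto simp: measure_def)
      qed
    qed simp
    have flat: "L t w = L s w" if st: "0 \<le> s" "s \<le> t" "ereal t < \<sigma> w" and nz: "\<forall>r\<in>{s..t}. Z r w \<noteq> 0" for s t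
    proof -
      have "continuous_on {s..t} (\<lambda>s. \<bar>Z s w\<bar>)"
        by (intro continuous_intros continuous_on_subset[OF cont[OF w]]) (use st in auto)
      then obtain r0 where r0: "r0 \<in> {s..t}" "\<And>r. r \<in> {s..t} \<Longrightarrow> \<bar>Z r0 w\<bar> \<le> \<bar>Z r w\<bar>"
        using continuous_attains_inf[of "{s..t}" "\<lambda>s. \<bar>Z s w\<bar>"] st by auto
      have pos: "0 < \<bar>Z r0 w\<bar>" using nz r0(1) by auto
      \<comment> \<open>Below the minimum of \<open>\<bar>Z\<bar>\<close> over the interval from
        \<open>s\<close> to \<open>t\<close>, no time in that interval is counted, so both averages
        see the same set of earlier times.\<close>
      have "\<forall>\<^sub>F \<epsilon> in at_right 0. \<phi> s \<epsilon> = \<phi> t \<epsilon>"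
      proof (rule eventually_at_rightI[OF _ pos])
        fix \<epsilon> assume e: "\<epsilon> \<in> {0<..<\<bar>Z r0 w\<bar>}"
        have "E \<epsilon> s = E \<epsilon> t"
        proof -
          have "r \<le> s" if "r \<in> E \<epsilon> t" for r
          proof (rule ccontr)
            assume "\<not> r \<le> s"
            then have "r \<in> {s..t}" using that by (auto simp: E_def)
            then show False using r0(2) e that by (fastforce simp: E_def)
          qed
          then show ?thesis using st by (auto simp: E_def)
        qed
        then show "\<phi> s \<epsilon> = \<phi> t \<epsilon>" unfolding \<phi>_def freeze[OF st] by simp
      qed
      moreover have "ereal s < \<sigma> w" using st by (auto intro: le_less_trans[of _ "ereal t"])
      ultimately have "(\<phi> t \<longlongrightarrow> L s w) (at_right 0)"
        using \<phi>[of s] st by (simp cong: tendsto_cong)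
      then show ?thesis
        using \<phi>[of t] st by (intro tendsto_unique[of "at_right 0"]) auto
    qed
    show "local_time_path (\<sigma> w) (\<lambda>t. Z t w) (\<lambda>t. L t w)"
      unfolding local_time_path_def
      using nn mono flat by blast
  qed
qed

subsection \<open>Exchanging the two sides\<close>

text \<open>The product of two equal densities is symmetric, and the swapped increment generates no
  more than the increment itself. This lets the analysis of a stage, carried out until
  \<open>X\<close> vanishes, be transferred to \<open>Y\<close>.\<close>

lemma (in planar_brownian_motion) planar_brownian_motion_swap:
  "planar_brownian_motion M F (\<lambda>t w. prod.swap (B t w))"
proof
  have swap_meas: "prod.swap \<in> borel_measurable (borel :: (real \<times> real) measure)"
    unfolding prod.swap_def by (intro borel_measurable_continuous_onI continuous_intros)
  show "adapted F (\<lambda>t w. prod.swap (B t w))"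
    using B_adapted measurable_compose[OF _ swap_meas] unfolding adapted_def by blast
  show "AE w in M. prod.swap (B 0 w) = (0, 0)"
    using B_zero by eventually_elim simp
  show "AE w in M. continuous_on {0..} (\<lambda>t. prod.swap (B t w))"
    using B_continuous by eventually_elim (auto simp: prod.swap_def intro!: continuous_intros)
  fix s t :: real assume st: "0 \<le> s" "s < t"
  have diff: "prod.swap (B t w) - prod.swap (B s w) = prod.swap (B t w - B s w)" for w
    by (simp add: prod_eq_iff)
  have ind: "indep_var lborel (\<lambda>w. snd (B t w - B s w)) lborel (\<lambda>w. fst (B t w - B s w))"
  proof -
    have "indep_var borel (\<lambda>w. snd (B t w - B s w)) borel (\<lambda>w. fst (B t w - B s w))"
      unfolding indep_var_eq indep_sets2_eq
    proof (intro conjI ballI)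
      note I = increment_components_indep[OF st, unfolded indep_var_eq indep_sets2_eq]
      note I1 = conjunct1[OF I] and I2 = conjunct2[OF I]
      show "random_variable borel (\<lambda>w. snd (B t w - B s w))" "random_variable borel (\<lambda>w. fst (B t w - B s w))"
        by (rule conjunct2[OF I1], rule conjunct1[OF I1])
      show "sigma_sets (space M) {(\<lambda>w. snd (B t w - B s w)) -` A \<inter> space M |A. A \<in> sets borel} \<subseteq> events"
        by (rule conjunct1[OF conjunct2[OF I2]])
      show "sigma_sets (space M) {(\<lambda>w. fst (B t w - B s w)) -` A \<inter> space M |A. A \<in> sets borel} \<subseteq> events"
        by (rule conjunct1[OF I2])
      fix a b
      assume "a \<in> sigma_sets (space M) {(\<lambda>w. snd (B t w - B s w)) -` A \<inter> space M |A. A \<in> sets borel}"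
        "b \<in> sigma_sets (space M) {(\<lambda>w. fst (B t w - B s w)) -` A \<inter> space M |A. A \<in> sets borel}"
      then have "prob (b \<inter> a) = prob b * prob a"
        by (intro conjunct2[OF conjunct2[OF I2], rule_format])
      then show "prob (a \<inter> b) = prob a * prob b" by (simp only: Int_commute mult.commute)
    qed
    then show ?thesis unfolding indep_var_eq by simp
  qed
  have "distributed M (lborel \<Otimes>\<^sub>M lborel) (\<lambda>w. (snd (B t w - B s w), fst (B t w - B s w)))
      (\<lambda>(u, v). ennreal (normal_density 0 (sqrt (t - s)) u) * ennreal (normal_density 0 (sqrt (t - s)) v))"
    by (rule distributed_joint_indep[OF lborel.sigma_finite_measure_axioms lborel.sigma_finite_measure_axioms
          increment_snd_distributed[OF st] increment_fst_distributed[OF st] ind])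
  then show "distributed M lborel (\<lambda>w. prod.swap (B t w) - prod.swap (B s w))
        (\<lambda>(u, v). ennreal (normal_density 0 (sqrt (t - s)) u * normal_density 0 (sqrt (t - s)) v))"
    unfolding diff by (simp add: prod.swap_def lborel_prod ennreal_mult'')
  let ?V = "vimage_algebra (space M) (\<lambda>w. B t w - B s w) borel"
  have *: "sets (vimage_algebra (space M) (\<lambda>w. prod.swap (B t w - B s w)) borel) \<subseteq> sets ?V"
  proof -
    have "(\<lambda>w. prod.swap (B t w - B s w)) \<in> measurable ?V borel"
      by (rule measurable_compose[OF measurable_vimage_algebra1 swap_meas]) auto
    then show ?thesis
      by (auto simp: sets_vimage_algebra2 measurable_def)
  qed
  show "indep_set (sets (F s)) (sets (vimage_algebra (space M) (\<lambda>w. prod.swap (B t w) - prod.swap (B s w)) borel))"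
    unfolding diff indep_sets2_eq
  proof (intro conjI ballI)
    note I = B_increment_indep[OF st, unfolded indep_sets2_eq]
    show "sets (F s) \<subseteq> events" by (rule conjunct1[OF I])
    show "sets (vimage_algebra (space M) (\<lambda>w. prod.swap (B t w - B s w)) borel) \<subseteq> events"
      by (rule order_trans[OF * conjunct1[OF conjunct2[OF I]]])
    fix a b
    assume "a \<in> sets (F s)" "b \<in> sets (vimage_algebra (space M) (\<lambda>w. prod.swap (B t w - B s w)) borel)"
    then show "prob (a \<inter> b) = prob a * prob b"
      by (intro conjunct2[OF conjunct2[OF I], rule_format] subsetD[OF *])
  qed
qed

lemma corner_time_commute: "corner_time X Y = corner_time Y X"
  by (auto simp: corner_time_def fun_eq_iff conj_commute)

lemma (in oblique_reflected_brownian_motion) oblique_reflected_brownian_motion_swap: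
  "oblique_reflected_brownian_motion M F (\<lambda>t w. prod.swap (B t w)) \<theta>2 \<theta>1 y x Y X LY LX"
proof -
  interpret swap: planar_brownian_motion M F "\<lambda>t w. prod.swap (B t w)"
    by (rule planar_brownian_motion_swap)
  show ?thesis
  proof
    show "AE w in M. Y 0 w = y \<and> X 0 w = x" using start by eventually_elim simp
    show "AE w in M. \<forall>t\<ge>0. ereal t < corner_time Y X w \<longrightarrow>
      Y t w = Y 0 w + fst (prod.swap (B t w)) + LY t w - tan \<theta>2 * LX t w"
      using Y_equation by (simp add: corner_time_commute[of Y X])
    show "AE w in M. \<forall>t\<ge>0. ereal t < corner_time Y X w \<longrightarrow>
      X t w = X 0 w + snd (prod.swap (B t w)) + LX t w - tan \<theta>1 * LY t w"
      using X_equation by (simp add: corner_time_commute[of Y X])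
    show "is_symmetric_local_time M (corner_time Y X) Y LY" "is_symmetric_local_time M (corner_time Y X) X LX"
      using LX_local_time LY_local_time by (simp_all only: corner_time_commute[of Y X])
    show "0 \<le> Y t w \<and> 0 \<le> X t w" if "w \<in> space M" "0 \<le> t" for w t
      using in_quadrant[OF that] by simp
    show "continuous_on {0..} (\<lambda>t. Y t w)" "continuous_on {0..} (\<lambda>t. X t w)" if "w \<in> space M" for w
      using Y_continuous[OF that] X_continuous[OF that] .
  qed (rule X_adapted Y_adapted LX_adapted LY_adapted)+
qed

subsection \<open>Local time accumulated until one side is hit\<close>

text \<open>Monotonicity makes rational times sufficient, and countability makes the supremum measurable.\<close>

definition sup_before :: "('w \<Rightarrow> ereal) \<Rightarrow> (real \<Rightarrow> 'w \<Rightarrow> real) \<Rightarrow> real \<Rightarrow> 'w \<Rightarrow> ennreal" where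
  "sup_before \<tau> L s w = (SUP r \<in> {r \<in> \<rat>. s \<le> r}. if ereal r < \<tau> w then ennreal (L r w) else 0)"

lemma sup_before_upper:
  assumes mono: "\<And>r r'. s \<le> r \<Longrightarrow> r \<le> r' \<Longrightarrow> ereal r' < \<tau> w \<Longrightarrow> L r w \<le> L r' w"
    and r: "s \<le> r" "ereal r < \<tau> w"
  shows "ennreal (L r w) \<le> sup_before \<tau> L s w"
proof -
  \<comment> \<open>\<open>r\<close> may be irrational: a rational time between \<open>r\<close> and
    \<open>\<tau> w\<close> belongs to the index set, and monotonicity compares the two
    values.\<close>
  obtain z where z: "ereal r < z" "z < \<tau> w"
    using dense[OF r(2)] by blast
  then obtain z' where z': "ereal z' = z" by (cases z) auto
  then have "r < z'" using z by auto
  then obtain q where q: "q \<in> \<rat>" "r < q" "q < z'" using Rats_dense_in_real by blast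
  then have q': "ereal q < \<tau> w" using z z' by (auto intro: less_trans[of "ereal q" "ereal z'"])
  have "ennreal (L r w) \<le> ennreal (L q w)"
    using r q q' by (intro ennreal_leI mono) auto
  also have "\<dots> \<le> sup_before \<tau> L s w"
    unfolding sup_before_def using q q' r by (intro SUP_upper2[of q]) auto
  finally show ?thesis .
qed

lemma sup_before_least:
  assumes "\<And>r. r \<in> \<rat> \<Longrightarrow> s \<le> r \<Longrightarrow> ereal r < \<tau> w \<Longrightarrow> ennreal (L r w) \<le> c"
  shows "sup_before \<tau> L s w \<le> c"
  unfolding sup_before_def using assms by (intro SUP_least) auto

lemma sup_before_measurable:
  assumes \<tau>: "\<tau> \<in> borel_measurable M" and L: "\<And>r. s \<le> r \<Longrightarrow> L r \<in> borel_measurable M"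
  shows "sup_before \<tau> L s \<in> borel_measurable M"
proof -
  have "(\<lambda>w. SUP r \<in> {r \<in> \<rat>. s \<le> r}. if ereal r < \<tau> w then ennreal (L r w) else 0) \<in> borel_measurable M"
  proof (rule borel_measurable_SUP)
    show "countable {r \<in> \<rat>. s \<le> r}"
      by (rule countable_subset[OF _ countable_rat]) auto
    show "(\<lambda>w. if ereal r < \<tau> w then ennreal (L r w) else 0) \<in> borel_measurable M" if "r \<in> {r \<in> \<rat>. s \<le> r}" for r
    proof -
      have [measurable]: "L r \<in> borel_measurable M" using L that by auto
      note [measurable] = \<tau>
      show ?thesis by measurable
    qed
  qed
  then show ?thesis by (simp add: sup_before_def[abs_def])
qed

text \<open>Rounded up to a grid, the random time takes countably many values, so the composition is
  measurable. Refining the grid recovers the original time by continuity of the paths.\<close>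

lemma measurable_at_random_time:
  fixes Y :: "real \<Rightarrow> 'a \<Rightarrow> real"
  assumes Y: "\<And>t. 0 \<le> t \<Longrightarrow> Y t \<in> borel_measurable M"
    and cont: "\<And>w. w \<in> space M \<Longrightarrow> continuous_on {0..} (\<lambda>t. Y t w)"
    and t: "t \<in> borel_measurable M" "\<And>w. w \<in> space M \<Longrightarrow> 0 \<le> t w"
  shows "(\<lambda>w. Y (t w) w) \<in> borel_measurable M"
proof (rule borel_measurable_LIMSEQ_real)
  define k where "k = (\<lambda>n w. nat \<lceil>t w * real (Suc n)\<rceil>)"
  show "(\<lambda>w. Y (real (k n w) / real (Suc n)) w) \<in> borel_measurable M" for n
  proof (rule measurable_compose_countable[where f="\<lambda>k w. Y (real k / real (Suc n)) w"])
    show "k n \<in> measurable M (count_space UNIV)"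
      unfolding k_def using t(1) by measurable
  qed (auto intro: Y)
  fix w assume w: "w \<in> space M"
  have b: "t w \<le> real (k n w) / real (Suc n) \<and> real (k n w) / real (Suc n) \<le> t w + 1 / real (Suc n)" for n
  proof -
    have 0: "0 \<le> \<lceil>t w * real (Suc n)\<rceil>" using t(2)[OF w] by (simp add: ceiling_le_zero less_le_trans[of "- 1" 0])
    have "t w * real (Suc n) \<le> real (k n w)" "real (k n w) \<le> t w * real (Suc n) + 1"
      unfolding k_def of_nat_nat[OF 0] by linarith+
    then show ?thesis by (simp add: field_simps del: of_nat_Suc)
  qed
  have "(\<lambda>n. real (k n w) / real (Suc n)) \<longlonglongrightarrow> t w"
  proof (rule tendsto_sandwich[OF _ _ tendsto_const])
    have "(\<lambda>n. t w + 1 / real (Suc n)) \<longlonglongrightarrow> t w + 0"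
      by (intro tendsto_intros LIMSEQ_Suc[OF lim_const_over_n])
    then show "(\<lambda>n. t w + 1 / real (Suc n)) \<longlonglongrightarrow> t w" by simp
  qed (use b in auto)
  then show "(\<lambda>n. Y (real (k n w) / real (Suc n)) w) \<longlonglongrightarrow> Y (t w) w"
    by (rule continuous_on_tendsto_compose[OF cont[OF w]]) (use t(2)[OF w] in auto)
qed

section \<open>Regular paths and future local time of the reflected process\<close>

context oblique_reflected_brownian_motion
begin

abbreviation "\<sigma> \<equiv> corner_time X Y"

definition "local_time t w = LX t w + LY t w"

text \<open>The local time still to be collected from \<open>s\<close> until the corner, with values
  in [0,\<infinity>] so that expectations can be compared before any of them is known to be
  finite.\<close>

definition "future s = sup_before \<sigma> (\<lambda>r w. local_time r w - local_time s w) s"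

text \<open>All almost sure properties are gathered in one predicate, so that later arguments run
  along a single path. The equations are stated with \<open>Bc\<close>, which is continuous on every
  path.\<close>

definition "regular_path w \<longleftrightarrow> X 0 w = x \<and> Y 0 w = y \<and>
   (\<forall>t\<ge>0. ereal t < \<sigma> w \<longrightarrow> X t w = x + fst (Bc t w) + LX t w - tan \<theta>1 * LY t w \<and>
      Y t w = y + snd (Bc t w) + LY t w - tan \<theta>2 * LX t w) \<and>
   local_time_path (\<sigma> w) (\<lambda>t. X t w) (\<lambda>t. LX t w) \<and> local_time_path (\<sigma> w) (\<lambda>t. Y t w) (\<lambda>t. LY t w)"

lemma AE_regular_path: "AE w in M. regular_path w"
proof -
  have "AE w in M. local_time_path (\<sigma> w) (\<lambda>t. X t w) (\<lambda>t. LX t w)"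
    by (rule is_symmetric_local_time_path[OF LX_local_time]) (rule X_continuous)
  moreover have "AE w in M. local_time_path (\<sigma> w) (\<lambda>t. Y t w) (\<lambda>t. LY t w)"
    by (rule is_symmetric_local_time_path[OF LY_local_time]) (rule Y_continuous)
  ultimately show ?thesis
    using start X_equation Y_equation Bc_AE by eventually_elim (simp add: regular_path_def)
qed

lemma regular_pathD:
  assumes "regular_path w"
  shows "X 0 w = x" "Y 0 w = y"
    and "0 \<le> t \<Longrightarrow> ereal t < \<sigma> w \<Longrightarrow> 0 \<le> LX t w"
    and "0 \<le> t \<Longrightarrow> ereal t < \<sigma> w \<Longrightarrow> 0 \<le> LY t w"
    and "0 \<le> t \<Longrightarrow> ereal t < \<sigma> w \<Longrightarrow> X t w = x + fst (Bc t w) + LX t w - tan \<theta>1 * LY t w"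
    and "0 \<le> t \<Longrightarrow> ereal t < \<sigma> w \<Longrightarrow> Y t w = y + snd (Bc t w) + LY t w - tan \<theta>2 * LX t w"
    and "0 \<le> s \<Longrightarrow> s \<le> t \<Longrightarrow> ereal t < \<sigma> w \<Longrightarrow> LX s w \<le> LX t w"
    and "0 \<le> s \<Longrightarrow> s \<le> t \<Longrightarrow> ereal t < \<sigma> w \<Longrightarrow> LY s w \<le> LY t w"
    and "0 \<le> s \<Longrightarrow> s \<le> t \<Longrightarrow> ereal t < \<sigma> w \<Longrightarrow> \<forall>r\<in>{s..t}. X r w \<noteq> 0 \<Longrightarrow> LX t w = LX s w"
proof -
  have p: "local_time_path (\<sigma> w) (\<lambda>t. X t w) (\<lambda>t. LX t w)" "local_time_path (\<sigma> w) (\<lambda>t. Y t w) (\<lambda>t. LY t w)"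
    using assms by (simp_all add: regular_path_def)
  note X = local_time_pathD[OF p(1)] and Y = local_time_pathD[OF p(2)]
  show "0 \<le> t \<Longrightarrow> ereal t < \<sigma> w \<Longrightarrow> 0 \<le> LX t w" by (rule X(1))
  show "0 \<le> t \<Longrightarrow> ereal t < \<sigma> w \<Longrightarrow> 0 \<le> LY t w" by (rule Y(1))
  show "0 \<le> s \<Longrightarrow> s \<le> t \<Longrightarrow> ereal t < \<sigma> w \<Longrightarrow> LX s w \<le> LX t w" by (rule X(2))
  show "0 \<le> s \<Longrightarrow> s \<le> t \<Longrightarrow> ereal t < \<sigma> w \<Longrightarrow> LY s w \<le> LY t w" by (rule Y(2))
  show "0 \<le> s \<Longrightarrow> s \<le> t \<Longrightarrow> ereal t < \<sigma> w \<Longrightarrow> \<forall>r\<in>{s..t}. X r w \<noteq> 0 \<Longrightarrow> LX t w = LX s w" by (rule X(3))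
qed (use assms in \<open>auto simp: regular_path_def\<close>)

lemma corner_time_eq: "w \<in> space M \<Longrightarrow> \<sigma> w = first_zero (\<lambda>t w. X t w + Y t w) 0 w"
  by (rule corner_time_eq_first_zero) (rule in_quadrant)

lemma corner_time_stopping:
  assumes "0 \<le> r"
  shows "{w \<in> space M. \<sigma> w \<le> ereal r} \<in> sets (F r)"
proof -
  have "adapted F (\<lambda>t w. X t w + Y t w)"
    using X_adapted Y_adapted unfolding adapted_def by (auto intro: borel_measurable_add)
  then have "{w \<in> space M. first_zero (\<lambda>t w. X t w + Y t w) 0 w \<le> ereal r} \<in> sets (F r)"
    using assms by (intro first_zero_stopping) (auto intro!: continuous_intros X_continuous Y_continuous)
  also have "{w \<in> space M. first_zero (\<lambda>t w. X t w + Y t w) 0 w \<le> ereal r} = {w \<in> space M. \<sigma> w \<le> ereal r}"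
    using corner_time_eq by auto
  finally show ?thesis .
qed

lemma at_corner_time:
  assumes w: "w \<in> space M" and t: "\<sigma> w = ereal t"
  shows "0 \<le> t \<and> X t w = 0 \<and> Y t w = 0"
proof -
  have "continuous_on {0..} (\<lambda>t. X t w + Y t w)"
    using w by (intro continuous_intros X_continuous Y_continuous)
  from first_zero_attained[where Z="\<lambda>t w. X t w + Y t w" and w=w, OF this]
  have "0 \<le> t \<and> X t w + Y t w = 0"
    using t corner_time_eq[OF w] by auto
  then show ?thesis using in_quadrant[OF w, of t] by auto
qed

lemma corner_time_nonneg: "w \<in> space M \<Longrightarrow> 0 \<le> \<sigma> w"
  using first_zero_ge[of 0 "\<lambda>t w. X t w + Y t w"] corner_time_eq by (simp add: zero_ereal_def)

lemma stopping_measurable: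
  assumes T: "\<And>r. 0 \<le> r \<Longrightarrow> {w \<in> space M. T w \<le> ereal r} \<in> sets (F r)"
    and nn: "\<And>w. w \<in> space M \<Longrightarrow> 0 \<le> T w"
  shows "T \<in> borel_measurable M"
  unfolding borel_measurable_iff_Iic_ereal
proof
  fix c :: ereal
  have eq: "T -` {..c} \<inter> space M = {w \<in> space M. T w \<le> c}" by auto
  show "T -` {..c} \<inter> space M \<in> sets M"
  proof (cases "0 \<le> c")
    case True
    then show ?thesis
      unfolding eq by (cases c) (auto intro: sets_F_M[OF T])
  next
    case False
    then have empty: "{w \<in> space M. T w \<le> c} = {}"
      using order_trans[OF nn, of _ c] by auto
    show ?thesis unfolding eq empty by (rule sets.empty_sets)
  qed
qed

lemma corner_time_measurable: "\<sigma> \<in> borel_measurable M"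
  by (rule stopping_measurable[OF corner_time_stopping corner_time_nonneg])

lemma path_measurable:
  "0 \<le> t \<Longrightarrow> X t \<in> borel_measurable M" "0 \<le> t \<Longrightarrow> Y t \<in> borel_measurable M"
  "0 \<le> t \<Longrightarrow> LX t \<in> borel_measurable M" "0 \<le> t \<Longrightarrow> LY t \<in> borel_measurable M"
  "0 \<le> t \<Longrightarrow> local_time t \<in> borel_measurable M"
proof -
  show 1: "0 \<le> t \<Longrightarrow> X t \<in> borel_measurable M" "0 \<le> t \<Longrightarrow> Y t \<in> borel_measurable M"
    "0 \<le> t \<Longrightarrow> LX t \<in> borel_measurable M" "0 \<le> t \<Longrightarrow> LY t \<in> borel_measurable M"
    using X_adapted Y_adapted LX_adapted LY_adapted unfolding adapted_def
    by (auto intro: measurable_F_M)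
  then show "0 \<le> t \<Longrightarrow> local_time t \<in> borel_measurable M"
    unfolding local_time_def[abs_def] by (intro borel_measurable_add)
qed

lemma future_measurable: "0 \<le> s \<Longrightarrow> future s \<in> borel_measurable M"
  unfolding future_def
  by (intro sup_before_measurable corner_time_measurable borel_measurable_diff path_measurable) auto

text \<open>Integration over arbitrary \<open>A \<in> F s\<close> stands for conditioning on \<open>F s\<close>.\<close>

definition "lower_bound u v \<longleftrightarrow> (\<forall>s A. 0 \<le> s \<longrightarrow> A \<in> sets (F s) \<longrightarrow> (\<forall>w\<in>A. ereal s < \<sigma> w) \<longrightarrow>
  (\<integral>\<^sup>+w. indicator A w * ennreal (u * X s w + v * Y s w) \<partial>M) \<le> (\<integral>\<^sup>+w. indicator A w * future s w \<partial>M))"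

lemma local_time_mono:
  "regular_path w \<Longrightarrow> 0 \<le> s \<Longrightarrow> s \<le> t \<Longrightarrow> ereal t < \<sigma> w \<Longrightarrow> local_time s w \<le> local_time t w"
  unfolding local_time_def by (intro add_mono regular_pathD(7,8))

lemma future_upper:
  assumes "regular_path w" "0 \<le> s" "s \<le> r" "ereal r < \<sigma> w"
  shows "ennreal (local_time r w - local_time s w) \<le> future s w"
  unfolding future_def
  by (rule sup_before_upper[where L="\<lambda>r w. local_time r w - local_time s w"])
     (use assms local_time_mono in auto)

section \<open>One stage: the process until \<open>X\<close> first vanishes\<close>

context
  fixes s :: real and T :: "'w \<Rightarrow> ereal"
  assumes s: "0 \<le> s" and a: "0 < tan \<theta>1"
  defines "T \<equiv> first_zero X s"
begin

text \<open>The local time collected on the side \<open>Y = 0\<close> during the stage. A supremum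
  over times before \<open>T\<close> is taken because \<open>LY\<close> is uncontrolled at
  \<open>T\<close> itself if the stage ends in the corner.\<close>

private definition "gain = sup_before T (\<lambda>r w. LY r w - LY s w) s"

private lemma T_ge: "ereal s \<le> T w" unfolding T_def by (rule first_zero_ge)

private lemma T_nonneg: "0 \<le> T w" using T_ge[of w] s by (auto simp: zero_ereal_def intro: order_trans[of _ "ereal s"])

private lemma T_stopping: "0 \<le> r \<Longrightarrow> {w \<in> space M. T w \<le> ereal r} \<in> sets (F r)"
proof (cases "s \<le> r")
  case True
  then show ?thesis unfolding T_def using s by (intro first_zero_stopping X_adapted X_continuous)
next
  case False
  then have empty: "{w \<in> space M. T w \<le> ereal r} = {}"
    by (auto simp: not_le intro: less_le_trans[OF _ T_ge])
  show ?thesis unfolding empty by (rule sets.empty_sets)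
qed

private lemma T_measurable: "T \<in> borel_measurable M"
  by (rule stopping_measurable[OF T_stopping T_nonneg])

private lemma YT_measurable: "(\<lambda>w. Y (real_of_ereal (T w)) w) \<in> borel_measurable M"
proof (rule measurable_at_random_time[OF path_measurable(2) Y_continuous])
  show "(\<lambda>w. real_of_ereal (T w)) \<in> borel_measurable M"
    using T_measurable by measurable
  show "0 \<le> real_of_ereal (T w)" for w using T_nonneg[of w] by (rule real_of_ereal_pos)
qed

private lemma gain_measurable: "gain \<in> borel_measurable M"
  unfolding gain_def using s
  by (intro sup_before_measurable T_measurable borel_measurable_diff path_measurable) auto

context
  fixes w
  assumes w: "w \<in> space M" and reg: "regular_path w" and s\<sigma>: "ereal s < \<sigma> w" and Xs: "0 < X s w"
begin

lemma stage_end_le_corner: "T w \<le> \<sigma> w"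
proof (cases "\<sigma> w")
  case (real t)
  then show ?thesis
    unfolding T_def using at_corner_time[OF w real] s\<sigma> by (auto intro: first_zero_lower)
qed (use s\<sigma> in auto)

text \<open>\<open>X\<close> has no zero between \<open>s\<close> and \<open>r\<close>, so
  \<open>LX\<close> is frozen. The reflection term in \<open>LY\<close> is then moved to the other
  side in the first combination and cancelled by \<open>tan \<theta>1 * Y\<close> in the
  second.\<close>

lemma before_stage_end:
  assumes r: "s \<le> r" "ereal r < T w"
  shows "X s w + dB1 s r w = X r w + tan \<theta>1 * (LY r w - LY s w)"
    and "X s w + tan \<theta>1 * Y s w + (dB1 s r w + tan \<theta>1 * dB2 s r w)
       = X r w + tan \<theta>1 * Y r w"
proof -
  have r\<sigma>: "ereal r < \<sigma> w" using r stage_end_le_corner by (auto intro: less_le_trans)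
  have nz: "\<forall>q\<in>{s..r}. X q w \<noteq> 0"
  proof safe
    fix q assume "q \<in> {s..r}" "X q w = 0"
    then have "T w \<le> ereal q" unfolding T_def by (intro first_zero_lower) auto
    also have "\<dots> \<le> ereal r" using \<open>q \<in> {s..r}\<close> by simp
    finally show False using r by simp
  qed
  have LX: "LX r w = LX s w"
    by (rule regular_pathD(9)[OF reg s r(1) r\<sigma> nz])
  have "X r w = x + fst (Bc r w) + LX r w - tan \<theta>1 * LY r w"
    "Y r w = y + snd (Bc r w) + LY r w - tan \<theta>2 * LX r w"
    "X s w = x + fst (Bc s w) + LX s w - tan \<theta>1 * LY s w"
    "Y s w = y + snd (Bc s w) + LY s w - tan \<theta>2 * LX s w"
    using regular_pathD(5,6)[OF reg _ r\<sigma>] regular_pathD(5,6)[OF reg s s\<sigma>] s r(1) by simp_all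
  note eqs = this[unfolded LX]
  show "X s w + dB1 s r w = X r w + tan \<theta>1 * (LY r w - LY s w)"
    unfolding eqs by (simp add: algebra_simps)
  show "X s w + tan \<theta>1 * Y s w + (dB1 s r w + tan \<theta>1 * dB2 s r w)
       = X r w + tan \<theta>1 * Y r w"
    unfolding eqs by (simp add: algebra_simps)
qed

private lemma LY_mono: "s \<le> r \<Longrightarrow> r \<le> r' \<Longrightarrow> ereal r' < T w \<Longrightarrow> LY r w \<le> LY r' w"
  by (rule regular_pathD(8)[OF reg _ _ less_le_trans[OF _ stage_end_le_corner]]) (use s in auto)

lemma before_stage_end_nonneg:
  assumes r: "s \<le> r" "ereal r < T w"
  shows "0 \<le> X s w + dB1 s r w"
    and "0 \<le> X s w + tan \<theta>1 * Y s w + (dB1 s r w + tan \<theta>1 * dB2 s r w)"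
proof -
  have 1: "0 \<le> X r w \<and> 0 \<le> Y r w" using in_quadrant[OF w, of r] s r by simp
  have "0 \<le> tan \<theta>1 * (LY r w - LY s w)"
    using a LY_mono[OF order_refl r] by simp
  then show "0 \<le> X s w + dB1 s r w" unfolding before_stage_end(1)[OF r] using 1 by linarith
  have "0 \<le> tan \<theta>1 * Y r w" using a 1 by simp
  then show "0 \<le> X s w + tan \<theta>1 * Y s w + (dB1 s r w + tan \<theta>1 * dB2 s r w)"
    unfolding before_stage_end(2)[OF r] using 1 by linarith
qed

private lemma U_cont: "continuous_on {s..t} (\<lambda>r. X s w + dB1 s r w)"
  and V_cont: "continuous_on {s..t} (\<lambda>r. X s w + tan \<theta>1 * Y s w + (dB1 s r w + tan \<theta>1 * dB2 s r w))"
proof -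
  have "continuous_on {s..t} (\<lambda>r. Bc r w)"
    by (rule continuous_on_subset[OF Bc_continuous]) (use s in auto)
  then show "continuous_on {s..t} (\<lambda>r. X s w + dB1 s r w)"
    "continuous_on {s..t} (\<lambda>r. X s w + tan \<theta>1 * Y s w + (dB1 s r w + tan \<theta>1 * dB2 s r w))"
    by (intro continuous_intros; assumption)+
qed

text \<open>The stage may end in the corner, where the equations are no longer available. All
  relations are therefore left limits of those before \<open>T\<close>, using continuity of
  \<open>X\<close>, \<open>Y\<close> and \<open>Bc\<close> only; for the local time this leaves the
  inequality with \<open>gain\<close>.\<close>

lemma at_stage_end:
  assumes t: "T w = ereal t"
  shows "s < t" "X t w = 0" "0 \<le> X s w + dB1 s t w"
    "ennreal (X s w + dB1 s t w) \<le> ennreal (tan \<theta>1) * gain w"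
    "X s w + tan \<theta>1 * Y s w + (dB1 s t w + tan \<theta>1 * dB2 s t w) = tan \<theta>1 * Y t w"
proof -
  have "continuous_on {s..} (\<lambda>t. X t w)"
    by (rule continuous_on_subset[OF X_continuous[OF w]]) (use s in auto)
  from first_zero_attained[where Z=X and w=w, OF this] have st: "s \<le> t" and Xt: "X t w = 0"
    using t unfolding T_def by auto
  show st': "s < t" and "X t w = 0"
    using st Xt Xs by (auto simp: less_le)
  have ev: "\<forall>\<^sub>F r in at_left t. s \<le> r \<and> ereal r < T w"
    using eventually_at_left_real[OF st'] by eventually_elim (simp add: t)
  have cX: "((\<lambda>r. X r w) \<longlongrightarrow> X t w) (at_left t)" and cY: "((\<lambda>r. Y r w) \<longlongrightarrow> Y t w) (at_left t)"
    using s st' by (auto intro!: continuous_on_Icc_at_leftD[of s t] continuous_on_subset[OF X_continuous[OF w]]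
        continuous_on_subset[OF Y_continuous[OF w]])
  note cU = continuous_on_Icc_at_leftD[OF U_cont[of t] st']
    and cV = continuous_on_Icc_at_leftD[OF V_cont[of t] st']
  show "0 \<le> X s w + dB1 s t w"
  proof (rule tendsto_lowerbound[OF cU])
    show "\<forall>\<^sub>F r in at_left t. 0 \<le> X s w + dB1 s r w"
      using ev by eventually_elim (rule before_stage_end_nonneg(1), simp_all)
  qed simp
  show "ennreal (X s w + dB1 s t w) \<le> ennreal (tan \<theta>1) * gain w"
  proof (rule tendsto_upperbound)
    show "((\<lambda>r. ennreal (X s w + dB1 s r w - X r w)) \<longlongrightarrow> ennreal (X s w + dB1 s t w)) (at_left t)"
      using tendsto_diff[OF cU cX] Xt by (intro tendsto_ennrealI) simp
    show "\<forall>\<^sub>F r in at_left t. ennreal (X s w + dB1 s r w - X r w) \<le> ennreal (tan \<theta>1) * gain w"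
      using ev
    proof eventually_elim
      case (elim r)
      have "ennreal (LY r w - LY s w) \<le> gain w"
        unfolding gain_def
        by (rule sup_before_upper[where L="\<lambda>r w. LY r w - LY s w"]) (use elim LY_mono in auto)
      then have "ennreal (tan \<theta>1) * ennreal (LY r w - LY s w) \<le> ennreal (tan \<theta>1) * gain w"
        by (rule mult_left_mono) simp
      then show ?case
        using before_stage_end(1)[of r] elim a LY_mono[of s r] by (simp add: ennreal_mult[symmetric])
    qed
  qed simp
  show "X s w + tan \<theta>1 * Y s w + (dB1 s t w + tan \<theta>1 * dB2 s t w) = tan \<theta>1 * Y t w"
  proof (rule tendsto_unique[OF _ cV])
    have "((\<lambda>r. X r w + tan \<theta>1 * Y r w) \<longlongrightarrow> X t w + tan \<theta>1 * Y t w) (at_left t)"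
      by (intro tendsto_intros cX cY)
    then have "((\<lambda>r. X r w + tan \<theta>1 * Y r w) \<longlongrightarrow> tan \<theta>1 * Y t w) (at_left t)"
      using Xt by simp
    then show "((\<lambda>r. X s w + tan \<theta>1 * Y s w + (dB1 s r w + tan \<theta>1 * dB2 s r w)) \<longlongrightarrow> tan \<theta>1 * Y t w) (at_left t)"
    proof (rule Lim_transform_eventually)
      show "\<forall>\<^sub>F r in at_left t. X r w + tan \<theta>1 * Y r w = X s w + tan \<theta>1 * Y s w + (dB1 s r w + tan \<theta>1 * dB2 s r w)"
        using ev by eventually_elim (use before_stage_end(2) in auto)
    qed
  qed simp
qed

end

context
  fixes A :: "'w set" and K :: real
  assumes A: "A \<in> sets (F s)"
    and AK: "\<And>w. w \<in> A \<Longrightarrow> ereal s < \<sigma> w \<and> 0 < X s w \<and> X s w + tan \<theta>1 * Y s w \<le> K"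
begin

private lemma A_space: "w \<in> A \<Longrightarrow> w \<in> space M"
  using A sets.sets_into_space[of A "F s"] by (auto simp: space_F)

text \<open>This is \<open>wedge_exit\<close> started from \<open>X s\<close> and
  \<open>X s + tan \<theta>1 * Y s\<close>. At the end of the stage \<open>X\<close> is 0, so the
  first coordinate is at most \<open>tan \<theta>1\<close> times the gain and the second equals
  \<open>tan \<theta>1\<close> times the height.\<close>

private lemma
  shows stage_finite: "AE w in M. w \<in> A \<longrightarrow> T w < \<infinity>"
    and stage_gain: "(\<integral>\<^sup>+w. indicator A w * ennreal (X s w) \<partial>M)
      \<le> ennreal (tan \<theta>1) * (\<integral>\<^sup>+w. indicator A w * gain w \<partial>M)"
    and stage_height: "(\<integral>\<^sup>+w. indicator A w * ennreal (X s w + tan \<theta>1 * Y s w) \<partial>M)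
      \<le> ennreal (tan \<theta>1) * (\<integral>\<^sup>+w. indicator A w * ennreal (Y (real_of_ereal (T w)) w) \<partial>M)"
proof -
  have pos: "AE w in M. w \<in> A \<longrightarrow> (\<forall>r. s \<le> r \<longrightarrow> ereal r \<le> T w \<longrightarrow>
        0 \<le> X s w + dB1 s r w \<and>
        0 \<le> (X s w + tan \<theta>1 * Y s w) + (dB1 s r w + tan \<theta>1 * dB2 s r w))"
    using AE_regular_path
  proof eventually_elim
    fix w assume reg: "regular_path w"
    show "w \<in> A \<longrightarrow> (\<forall>r. s \<le> r \<longrightarrow> ereal r \<le> T w \<longrightarrow>
        0 \<le> X s w + dB1 s r w \<and>
        0 \<le> (X s w + tan \<theta>1 * Y s w) + (dB1 s r w + tan \<theta>1 * dB2 s r w))"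
    proof (intro impI allI)
      fix r assume wA: "w \<in> A" and r: "s \<le> r" "ereal r \<le> T w"
      note w = A_space[OF wA] and AK' = AK[OF wA]
      show "0 \<le> X s w + dB1 s r w \<and>
        0 \<le> (X s w + tan \<theta>1 * Y s w) + (dB1 s r w + tan \<theta>1 * dB2 s r w)"
      proof (cases "ereal r = T w")
        case True
        then have t: "T w = ereal r" by simp
        show ?thesis
          using at_stage_end[OF w reg _ _ t] AK' in_quadrant[OF w, of r] s r a by auto
      next
        case False
        then have "ereal r < T w" using r by simp
        then show ?thesis using before_stage_end_nonneg[OF w reg _ _ r(1)] AK' by auto
      qed
    qed
  qed
  have meas: "X s \<in> borel_measurable (F s)" "(\<lambda>w. X s w + tan \<theta>1 * Y s w) \<in> borel_measurable (F s)"
    using X_adapted Y_adapted s unfolding adapted_def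
    by (auto intro!: borel_measurable_add borel_measurable_times borel_measurable_const)
  have bX: "0 \<le> X s w \<and> X s w \<le> K" and bY: "0 \<le> X s w + tan \<theta>1 * Y s w \<and> X s w + tan \<theta>1 * Y s w \<le> K"
    if "w \<in> A" for w
    using AK[OF that] in_quadrant[OF A_space[OF that] s] a
    by (auto intro: order_trans[of _ "X s w + tan \<theta>1 * Y s w"])
  have Ts: "{w \<in> space M. T w \<le> ereal r} \<in> sets (F r)" if "s \<le> r" for r
    using that s by (intro T_stopping) auto
  note W = wedge_exit[OF a s Ts T_ge A meas(1) bX meas(2) bY pos]
  show fin: "AE w in M. w \<in> A \<longrightarrow> T w < \<infinity>" by (rule W(1))
  have AM: "A \<in> sets M" using A by (rule sets_F_M)
  have T_real: "\<exists>t. T w = ereal t" if "T w < \<infinity>" for w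
    using that T_ge[of w] by (cases "T w") auto
  have "(\<integral>\<^sup>+w. indicator A w * ennreal (X s w) \<partial>M)
      \<le> (\<integral>\<^sup>+w. indicator A w * ennreal (X s w + dB1 s (real_of_ereal (T w)) w) \<partial>M)"
    by (rule W(2))
  also have "\<dots> \<le> (\<integral>\<^sup>+w. ennreal (tan \<theta>1) * (indicator A w * gain w) \<partial>M)"
  proof (rule nn_integral_mono_AE)
    show "AE w in M. indicator A w * ennreal (X s w + dB1 s (real_of_ereal (T w)) w)
        \<le> ennreal (tan \<theta>1) * (indicator A w * gain w)"
      using AE_regular_path fin
    proof eventually_elim
      case (elim w)
      show ?case
      proof (cases "w \<in> A")
      case True
      then obtain t where t: "T w = ereal t" using elim T_real by auto
      show ?thesis using at_stage_end(4)[OF A_space[OF True] elim(1) _ _ t] AK[OF True] True t by simp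
      qed simp
    qed
  qed
  also have "\<dots> = ennreal (tan \<theta>1) * (\<integral>\<^sup>+w. indicator A w * gain w \<partial>M)"
    using AM gain_measurable by (intro nn_integral_cmult) auto
  finally show "(\<integral>\<^sup>+w. indicator A w * ennreal (X s w) \<partial>M)
      \<le> ennreal (tan \<theta>1) * (\<integral>\<^sup>+w. indicator A w * gain w \<partial>M)" .
  have "(\<integral>\<^sup>+w. indicator A w * ennreal (X s w + tan \<theta>1 * Y s w) \<partial>M)
      \<le> (\<integral>\<^sup>+w. indicator A w * ennreal (X s w + tan \<theta>1 * Y s w + (dB1 s (real_of_ereal (T w)) w
          + tan \<theta>1 * dB2 s (real_of_ereal (T w)) w)) \<partial>M)"
    by (rule W(3))
  also have "\<dots> \<le> (\<integral>\<^sup>+w. ennreal (tan \<theta>1) * (indicator A w * ennreal (Y (real_of_ereal (T w)) w)) \<partial>M)"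
  proof (rule nn_integral_mono_AE)
    show "AE w in M. indicator A w * ennreal (X s w + tan \<theta>1 * Y s w + (dB1 s (real_of_ereal (T w)) w
          + tan \<theta>1 * dB2 s (real_of_ereal (T w)) w))
        \<le> ennreal (tan \<theta>1) * (indicator A w * ennreal (Y (real_of_ereal (T w)) w))"
      using AE_regular_path fin
    proof eventually_elim
      case (elim w)
      show ?case
      proof (cases "w \<in> A")
      case True
      then obtain t where t: "T w = ereal t" using elim T_real by auto
      note at = at_stage_end[OF A_space[OF True] elim(1) _ _ t]
      have "0 \<le> Y t w" using at(1) AK[OF True] s in_quadrant[OF A_space[OF True], of t] by simp
      then show ?thesis using at(5) AK[OF True] True t a by (simp add: ennreal_mult)
      qed simp
    qed
  qed
  also have "\<dots> = ennreal (tan \<theta>1) * (\<integral>\<^sup>+w. indicator A w * ennreal (Y (real_of_ereal (T w)) w) \<partial>M)"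
    using AM YT_measurable by (intro nn_integral_cmult) auto
  finally show "(\<integral>\<^sup>+w. indicator A w * ennreal (X s w + tan \<theta>1 * Y s w) \<partial>M)
      \<le> ennreal (tan \<theta>1) * (\<integral>\<^sup>+w. indicator A w * ennreal (Y (real_of_ereal (T w)) w) \<partial>M)" .
qed

text \<open>Local time before \<open>T\<close> and local time after \<open>c\<close> are collected
  during disjoint periods; whatever is collected between \<open>T\<close> and \<open>c\<close> is
  given away.\<close>

private lemma gain_le_future:
  assumes wA: "w \<in> A" and reg: "regular_path w"
  shows "gain w \<le> future s w"
    and "0 \<le> c \<Longrightarrow> T w \<le> ereal c \<Longrightarrow> ereal c < \<sigma> w \<Longrightarrow> gain w + future c w \<le> future s w"
proof -
  note w = A_space[OF wA] and AK' = AK[OF wA]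
  have TS: "T w \<le> \<sigma> w" using AK' by (intro stage_end_le_corner[OF w reg]) auto
  have LY_le: "ennreal (LY r w - LY s w) \<le> ennreal (local_time q w - local_time s w)"
    if "s \<le> r" "r \<le> q" "ereal q < \<sigma> w" for r q
    using regular_pathD(7)[OF reg, of s q] regular_pathD(8)[OF reg, of r q] s that
    by (intro ennreal_leI) (simp add: local_time_def)
  show "gain w \<le> future s w"
    unfolding gain_def
  proof (rule sup_before_least)
    fix r assume r: "s \<le> r" "ereal r < T w"
    have "ereal r < \<sigma> w" by (rule less_le_trans[OF r(2) TS])
    then show "ennreal (LY r w - LY s w) \<le> future s w"
      using LY_le[of r r] future_upper[OF reg s r(1)] r by (auto intro: order_trans)
  qed
  assume c: "0 \<le> c" "T w \<le> ereal c" "ereal c < \<sigma> w"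
  have sc: "s \<le> c" using T_ge[of w] c(2) by (metis ereal_less_eq(3) order_trans)
  have "gain w + ennreal (local_time r' w - local_time c w) \<le> future s w"
    if r': "c \<le> r'" "ereal r' < \<sigma> w" for r'
  proof -
    have "gain w \<le> ennreal (local_time c w - local_time s w)"
      unfolding gain_def
    proof (rule sup_before_least)
      fix r assume r: "s \<le> r" "ereal r < T w"
      then have "r \<le> c" using c(2) by (metis ereal_less_eq(3) less_imp_le order_trans)
      then show "ennreal (LY r w - LY s w) \<le> ennreal (local_time c w - local_time s w)"
        using r c by (intro LY_le) auto
    qed
    then have "gain w + ennreal (local_time r' w - local_time c w)
        \<le> ennreal (local_time c w - local_time s w) + ennreal (local_time r' w - local_time c w)"
      by (rule add_right_mono)
    also have "\<dots> = ennreal (local_time r' w - local_time s w)"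
      using local_time_mono[OF reg s sc c(3)] local_time_mono[OF reg c(1) r'] by (simp add: ennreal_plus[symmetric] del: ennreal_plus)
    also have "\<dots> \<le> future s w"
      using r' sc by (intro future_upper[OF reg s]) auto
    finally show ?thesis .
  qed
  moreover have "gain w \<le> future s w" by fact
  ultimately have le: "gain w + (if ereal r' < \<sigma> w then ennreal (local_time r' w - local_time c w) else 0) \<le> future s w"
    if "c \<le> r'" for r'
    using that by simp
  \<comment> \<open>A rational beyond \<open>c\<close> shows that the index set of the supremum is
    nonempty, as required for moving \<open>gain w\<close> inside it.\<close>
  obtain q where q: "q \<in> \<rat>" "c < q" using Rats_dense_in_real[of c "c + 1"] by auto
  have "gain w + future c w = (SUP r' \<in> {r' \<in> \<rat>. c \<le> r'}. gain w + (if ereal r' < \<sigma> w then ennreal (local_time r' w - local_time c w) else 0))"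
    unfolding future_def sup_before_def
    by (rule ennreal_SUP_add_right) (use q in auto)
  also have "\<dots> \<le> future s w"
    by (rule SUP_least) (use le in auto)
  finally show "gain w + future c w \<le> future s w" .
qed

text \<open>The stage ends in one of the intervals \<open>]k/(h+1), (k+1)/(h+1)]\<close>. Restarting at the right endpoint, a
  deterministic time, and letting \<open>h \<rightarrow> \<infinity>\<close> replaces the strong Markov property.\<close>

private definition "node h k = real (Suc k) / real (Suc h)"

text \<open>The last condition keeps the paths that are still alive at the restart, as
  \<open>lower_bound\<close> demands. It refers to the deterministic node, so the event is known at
  that time.\<close>

private definition "C h k = {w \<in> A. \<not> T w \<le> ereal (real k / real (Suc h)) \<and> T w \<le> ereal (node h k) \<and> \<not> \<sigma> w \<le> ereal (node h k)}"

private lemma node_nonneg: "0 \<le> node h k" by (simp add: node_def)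

private lemma C_sets: "C h k \<in> sets (F (node h k))"
proof (cases "s \<le> node h k")
  case True
  have le: "real k / real (Suc h) \<le> node h k"
    unfolding node_def by (intro divide_right_mono) auto
  have "C h k = A \<inter> ({w \<in> space M. T w \<le> ereal (node h k)} - {w \<in> space M. T w \<le> ereal (real k / real (Suc h))}
      - {w \<in> space M. \<sigma> w \<le> ereal (node h k)})"
    unfolding C_def using A_space by blast
  moreover have "{w \<in> space M. T w \<le> ereal (real k / real (Suc h))} \<in> sets (F (node h k))"
    by (rule sets_F_mono'[OF T_stopping le]) simp
  ultimately show ?thesis
    using sets_F_mono'[OF A True] T_stopping[OF node_nonneg, of h k] corner_time_stopping[OF node_nonneg, of h k]
    by (simp add: sets.Int sets.Diff)
next
  case False
  have "ereal s \<le> ereal (node h k)" if "T w \<le> ereal (node h k)" for w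
    using order_trans[OF T_ge that] .
  then have "C h k = {}" using False by (auto simp: C_def)
  then show ?thesis by simp
qed

private lemma C_M: "C h k \<in> sets M" using C_sets by (rule sets_F_M)

private lemma C_unique: "w \<in> C h k \<Longrightarrow> w \<in> C h k' \<Longrightarrow> k = k'"
proof (rule ccontr)
  assume *: "w \<in> C h k" "w \<in> C h k'" "k \<noteq> k'"
  have "False" if "w \<in> C h k" "w \<in> C h k'" "k < k'" for k k'
  proof -
    have "node h k \<le> real k' / real (Suc h)"
      using that(3) unfolding node_def by (intro divide_right_mono) auto
    then have "T w \<le> ereal (real k' / real (Suc h))"
      using that(1) unfolding C_def by (auto intro: order_trans)
    then show False using that(2) by (simp add: C_def)
  qed
  then show False using * by (cases "k < k'") (auto simp: not_less_iff_gr_or_eq)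
qed

text \<open>For fixed \<open>h\<close> a path restarts at no more than one node, so the series has
  at most one nonzero term.\<close>

private lemma gain_plus_restart:
  assumes reg: "regular_path w"
  shows "indicator A w * gain w + (\<Sum>k. indicator (C h k) w * future (node h k) w) \<le> indicator A w * future s w"
proof (cases "\<exists>k. w \<in> C h k")
  case True
  then obtain k where k: "w \<in> C h k" by blast
  have "(\<Sum>k. indicator (C h k) w * future (node h k) w) = (\<Sum>k\<in>{k}. indicator (C h k) w * future (node h k) w)"
    by (rule suminf_finite) (use C_unique[OF k] in \<open>auto simp: indicator_def\<close>)
  moreover have kk: "w \<in> A" "T w \<le> ereal (node h k)" "ereal (node h k) < \<sigma> w"
    using k by (auto simp: C_def)
  ultimately show ?thesis
    using gain_le_future(2)[OF kk(1) reg node_nonneg kk(2,3)] k by simp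
next
  case False
  then have "(\<Sum>k. indicator (C h k) w * future (node h k) w) = 0" by simp
  then show ?thesis using gain_le_future(1)[OF _ reg] by (cases "w \<in> A") auto
qed

text \<open>If the stage ends in the corner, the height is 0 and dropping the series costs nothing.
  Otherwise the node following \<open>T\<close> decreases the gap to \<open>T\<close> below any
  bound, precedes \<open>\<sigma>\<close> for large \<open>h\<close>, and continuity of
  \<open>Y\<close> gives the height in the limit.\<close>

private lemma restart_liminf:
  assumes wA: "w \<in> A" and reg: "regular_path w" and t: "T w = ereal t"
  shows "gain w + ennreal v * ennreal (Y t w)
    \<le> liminf (\<lambda>h. gain w + ennreal v * (\<Sum>k. indicator (C h k) w * ennreal (Y (node h k) w)))"
proof -
  note w = A_space[OF wA] and AK' = AK[OF wA]
  have TS: "T w \<le> \<sigma> w" using AK' by (intro stage_end_le_corner[OF w reg]) auto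
  have st: "s < t" using AK' by (intro at_stage_end(1)[OF w reg _ _ t]) auto
  show ?thesis
  proof (cases "T w = \<sigma> w")
    case True
    then have "Y t w = 0" using at_corner_time[OF w, of t] t by simp
    then show ?thesis by (intro Liminf_bounded) (simp add: add_increasing2)
  next
    case False
    then have T\<sigma>: "ereal t < \<sigma> w" using TS t by simp
    have "\<exists>k. real k / real (Suc h) < t \<and> t \<le> node h k" for h
    proof -
      \<comment> \<open>The index sought is one less than this ceiling, since node \<open>k\<close>
        has numerator \<open>Suc k\<close>; it is a natural number because \<open>t\<close> is
        positive.\<close>
      define m where "m = \<lceil>t * real (Suc h)\<rceil>"
      have m: "t * real (Suc h) \<le> of_int m" "of_int m - 1 < t * real (Suc h)"
        unfolding m_def by linarith+
      have "0 < t * real (Suc h)" using st s by simp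
      then have "1 \<le> m" using m(1) by linarith
      then obtain k where k: "m = int (Suc k)" using zero_less_imp_eq_int[of m] by (metis One_nat_def Suc_pred int_one_le_iff_zero_less of_nat_0_less_iff)
      show ?thesis
        using m unfolding k node_def by (intro exI[of _ k]) (simp add: field_simps)
    qed
    then obtain k where k: "\<And>h. real (k h) / real (Suc h) < t" "\<And>h. t \<le> node h (k h)" by metis
    have c_lim: "(\<lambda>h. node h (k h)) \<longlonglongrightarrow> t"
    proof (rule tendsto_sandwich[OF _ _ tendsto_const])
      have "(\<lambda>h. t + 1 / real (Suc h)) \<longlonglongrightarrow> t + 0"
        by (intro tendsto_intros LIMSEQ_Suc[OF lim_const_over_n])
      then show "(\<lambda>h. t + 1 / real (Suc h)) \<longlonglongrightarrow> t" by simp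
      have "node h (k h) \<le> t + 1 / real (Suc h)" for h
        using k(1)[of h] by (simp add: node_def add_divide_distrib)
      then show "\<forall>\<^sub>F h in sequentially. node h (k h) \<le> t + 1 / real (Suc h)" by simp
    qed (use k in auto)
    have ev: "\<forall>\<^sub>F h in sequentially. ereal (node h (k h)) < \<sigma> w"
      using c_lim T\<sigma> by (intro order_tendstoD(2)[of _ "ereal t"]) auto
    have "(\<lambda>h. Y (node h (k h)) w) \<longlonglongrightarrow> Y t w"
      by (rule continuous_on_tendsto_compose[OF Y_continuous[OF w] c_lim]) (use st s node_nonneg in auto)
    then have "(\<lambda>h. gain w + ennreal v * ennreal (Y (node h (k h)) w)) \<longlonglongrightarrow> gain w + ennreal v * ennreal (Y t w)"
      by (intro tendsto_add tendsto_const ennreal_tendsto_cmult tendsto_ennrealI) auto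
    then have "gain w + ennreal v * ennreal (Y t w) = liminf (\<lambda>h. gain w + ennreal v * ennreal (Y (node h (k h)) w))"
      by (intro lim_imp_Liminf[symmetric]) auto
    also have "\<dots> \<le> liminf (\<lambda>h. gain w + ennreal v * (\<Sum>k. indicator (C h k) w * ennreal (Y (node h k) w)))"
    proof (rule Liminf_mono)
      show "\<forall>\<^sub>F h in sequentially. gain w + ennreal v * ennreal (Y (node h (k h)) w)
          \<le> gain w + ennreal v * (\<Sum>k. indicator (C h k) w * ennreal (Y (node h k) w))"
        using ev
      proof eventually_elim
        case (elim h)
        then have "w \<in> C h (k h)" using k[of h] wA t by (simp add: C_def)
        then have "ennreal (Y (node h (k h)) w) = (\<Sum>k\<in>{k h}. indicator (C h k) w * ennreal (Y (node h k) w))" by simp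
        also have "\<dots> \<le> (\<Sum>k. indicator (C h k) w * ennreal (Y (node h k) w))"
          by (rule sum_le_suminf) auto
        finally show ?case by (intro add_left_mono mult_left_mono) auto
      qed
    qed
    finally show ?thesis .
  qed
qed

text \<open>The coefficients come from the decomposition
  \<open>(1 + v) / a * X + v * Y = 1 / a * X + v / a * (X + a * Y)\<close> with
  \<open>a = tan \<theta>1\<close>. The first term is paid by the gain of the stage, the second by
  \<open>v\<close> times the height at its end, from which the old bound continues. As
  \<open>X\<close> is 0 there, the old \<open>u\<close> leaves no trace.\<close>

lemma lower_bound_stage:
  assumes uv: "0 \<le> u" "0 \<le> v" and LB: "lower_bound u v"
  shows "(\<integral>\<^sup>+w. indicator A w * ennreal ((1 + v) / tan \<theta>1 * X s w + v * Y s w) \<partial>M)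
    \<le> (\<integral>\<^sup>+w. indicator A w * future s w \<partial>M)"
proof -
  have AM[measurable]: "A \<in> sets M" using A by (rule sets_F_M)
  note [measurable] = C_M gain_measurable YT_measurable
  have [measurable]: "X s \<in> borel_measurable M" "Y s \<in> borel_measurable M" using s path_measurable by auto
  have Ym[measurable]: "Y (node h k) \<in> borel_measurable M" for h k using node_nonneg path_measurable by auto
  have fm[measurable]: "future (node h k) \<in> borel_measurable M" for h k using node_nonneg by (rule future_measurable)
  let ?Y = "\<lambda>h w. \<Sum>k. indicator (C h k) w * ennreal (Y (node h k) w)"
  have eq: "indicator A w * ennreal ((1 + v) / tan \<theta>1 * X s w + v * Y s w)
      = ennreal (1 / tan \<theta>1) * (indicator A w * ennreal (X s w))
        + ennreal (v / tan \<theta>1) * (indicator A w * ennreal (X s w + tan \<theta>1 * Y s w))" if "w \<in> space M" for w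
  proof -
    have nn: "0 \<le> X s w" "0 \<le> Y s w" using in_quadrant[OF that s] by auto
    have "(1 + v) / tan \<theta>1 * X s w + v * Y s w = 1 / tan \<theta>1 * X s w + v / tan \<theta>1 * (X s w + tan \<theta>1 * Y s w)"
      using a by (simp add: field_simps)
    also have "ennreal \<dots> = ennreal (1 / tan \<theta>1) * ennreal (X s w) + ennreal (v / tan \<theta>1) * ennreal (X s w + tan \<theta>1 * Y s w)"
    proof -
      have "0 \<le> X s w + tan \<theta>1 * Y s w" using nn a by simp
      moreover have "0 \<le> 1 / tan \<theta>1" "0 \<le> v / tan \<theta>1" using a uv by simp_all
      ultimately show ?thesis using nn by (simp only: ennreal_plus mult_nonneg_nonneg ennreal_mult)
    qed
    finally show ?thesis by (cases "w \<in> A") simp_all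
  qed
  have scale: "ennreal (c / tan \<theta>1) * (ennreal (tan \<theta>1) * z) = ennreal c * z" if "0 \<le> c" for c z
    using a that by (simp add: mult.assoc[symmetric] ennreal_mult[symmetric])
  have "(\<integral>\<^sup>+w. indicator A w * ennreal ((1 + v) / tan \<theta>1 * X s w + v * Y s w) \<partial>M)
      = (\<integral>\<^sup>+w. ennreal (1 / tan \<theta>1) * (indicator A w * ennreal (X s w))
        + ennreal (v / tan \<theta>1) * (indicator A w * ennreal (X s w + tan \<theta>1 * Y s w)) \<partial>M)"
    by (intro nn_integral_cong eq)
  also have "\<dots> = ennreal (1 / tan \<theta>1) * (\<integral>\<^sup>+w. indicator A w * ennreal (X s w) \<partial>M)
        + ennreal (v / tan \<theta>1) * (\<integral>\<^sup>+w. indicator A w * ennreal (X s w + tan \<theta>1 * Y s w) \<partial>M)"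
    by (subst nn_integral_add) (auto simp: nn_integral_cmult)
  also have "\<dots> \<le> ennreal (1 / tan \<theta>1) * (ennreal (tan \<theta>1) * (\<integral>\<^sup>+w. indicator A w * gain w \<partial>M))
        + ennreal (v / tan \<theta>1) * (ennreal (tan \<theta>1) * (\<integral>\<^sup>+w. indicator A w * ennreal (Y (real_of_ereal (T w)) w) \<partial>M))"
    by (intro add_mono mult_left_mono stage_gain stage_height) auto
  also have "\<dots> = (\<integral>\<^sup>+w. indicator A w * gain w \<partial>M) + ennreal v * (\<integral>\<^sup>+w. indicator A w * ennreal (Y (real_of_ereal (T w)) w) \<partial>M)"
    using uv by (simp only: scale zero_le_one ennreal_1 mult_1)
  also have "\<dots> = (\<integral>\<^sup>+w. indicator A w * gain w + ennreal v * (indicator A w * ennreal (Y (real_of_ereal (T w)) w)) \<partial>M)"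
    by (subst nn_integral_add) (auto simp: nn_integral_cmult)
  \<comment> \<open>The height at the random time is replaced by heights at nodes, where
    \<open>lower_bound\<close> applies. Fatou acts in the desired direction, so no domination is
    required.\<close>
  also have "\<dots> \<le> (\<integral>\<^sup>+w. liminf (\<lambda>h. indicator A w * gain w + ennreal v * ?Y h w) \<partial>M)"
  proof (rule nn_integral_mono_AE)
    show "AE w in M. indicator A w * gain w + ennreal v * (indicator A w * ennreal (Y (real_of_ereal (T w)) w))
        \<le> liminf (\<lambda>h. indicator A w * gain w + ennreal v * ?Y h w)"
      using AE_regular_path stage_finite
    proof eventually_elim
      case (elim w)
      show ?case
      proof (cases "w \<in> A")
        case True
        then obtain t where t: "T w = ereal t" using elim(2) T_ge[of w] by (cases "T w") auto
        show ?thesis using restart_liminf[OF True elim(1) t] True t by simp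
      qed simp
    qed
  qed
  also have "\<dots> \<le> liminf (\<lambda>h. \<integral>\<^sup>+w. indicator A w * gain w + ennreal v * ?Y h w \<partial>M)"
    by (rule nn_integral_liminf) measurable
  also have "\<dots> \<le> liminf (\<lambda>h::nat. \<integral>\<^sup>+w. indicator A w * future s w \<partial>M)"
  proof (intro Liminf_mono always_eventually allI)
    fix h
    have "(\<integral>\<^sup>+w. indicator A w * gain w + ennreal v * ?Y h w \<partial>M)
        = (\<integral>\<^sup>+w. indicator A w * gain w + (\<Sum>k. ennreal v * (indicator (C h k) w * ennreal (Y (node h k) w))) \<partial>M)"
      by (simp add: ennreal_suminf_cmult)
    also have "\<dots> = (\<integral>\<^sup>+w. indicator A w * gain w \<partial>M)
        + (\<Sum>k. \<integral>\<^sup>+w. ennreal v * (indicator (C h k) w * ennreal (Y (node h k) w)) \<partial>M)"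
    proof -
      have e: "(\<integral>\<^sup>+w. (\<Sum>k. ennreal v * (indicator (C h k) w * ennreal (Y (node h k) w))) \<partial>M)
          = (\<Sum>k. \<integral>\<^sup>+w. ennreal v * (indicator (C h k) w * ennreal (Y (node h k) w)) \<partial>M)"
        by (rule nn_integral_suminf) measurable
      show ?thesis
        unfolding e[symmetric] by (rule nn_integral_add) measurable
    qed
    also have "\<dots> \<le> (\<integral>\<^sup>+w. indicator A w * gain w \<partial>M)
        + (\<Sum>k. \<integral>\<^sup>+w. indicator (C h k) w * future (node h k) w \<partial>M)"
    proof (intro add_left_mono suminf_le)
      fix k
      \<comment> \<open>At a node \<open>X\<close> may already be positive again; the nonnegative
        term \<open>u * X\<close> is added to reach the form of \<open>lower_bound\<close>.\<close>
      have "(\<integral>\<^sup>+w. ennreal v * (indicator (C h k) w * ennreal (Y (node h k) w)) \<partial>M)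
          \<le> (\<integral>\<^sup>+w. indicator (C h k) w * ennreal (u * X (node h k) w + v * Y (node h k) w) \<partial>M)"
      proof (rule nn_integral_mono)
        fix w assume "w \<in> space M"
        then have "0 \<le> X (node h k) w" "0 \<le> Y (node h k) w" using in_quadrant node_nonneg by auto
        then show "ennreal v * (indicator (C h k) w * ennreal (Y (node h k) w))
            \<le> indicator (C h k) w * ennreal (u * X (node h k) w + v * Y (node h k) w)"
          using uv by (cases "w \<in> C h k") (auto simp: ennreal_mult[symmetric] intro!: ennreal_leI)
      qed
      also have "\<dots> \<le> (\<integral>\<^sup>+w. indicator (C h k) w * future (node h k) w \<partial>M)"
        by (rule LB[unfolded lower_bound_def, rule_format, OF node_nonneg C_sets]) (auto simp: C_def)
      finally show "(\<integral>\<^sup>+w. ennreal v * (indicator (C h k) w * ennreal (Y (node h k) w)) \<partial>M)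
          \<le> (\<integral>\<^sup>+w. indicator (C h k) w * future (node h k) w \<partial>M)" .
    qed auto
    also have "\<dots> = (\<integral>\<^sup>+w. indicator A w * gain w + (\<Sum>k. indicator (C h k) w * future (node h k) w) \<partial>M)"
      by (subst nn_integral_add) (auto simp: nn_integral_suminf)
    also have "\<dots> \<le> (\<integral>\<^sup>+w. indicator A w * future s w \<partial>M)"
    proof (rule nn_integral_mono_AE)
      show "AE w in M. indicator A w * gain w + (\<Sum>k. indicator (C h k) w * future (node h k) w) \<le> indicator A w * future s w"
        using AE_regular_path by eventually_elim (rule gain_plus_restart)
    qed
    finally show "(\<integral>\<^sup>+w. indicator A w * gain w + ennreal v * ?Y h w \<partial>M) \<le> (\<integral>\<^sup>+w. indicator A w * future s w \<partial>M)" .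
  qed
  also have "\<dots> = (\<integral>\<^sup>+w. indicator A w * future s w \<partial>M)" by (simp add: Liminf_const)
  finally show ?thesis .
qed

end

end

end

section \<open>Alternating the stages\<close>

context oblique_reflected_brownian_motion
begin

text \<open>Where \<open>X s\<close> is 0, the coefficient of \<open>X\<close> is irrelevant and the
  old bound is the new one. Where \<open>X s\<close> is positive, a stage begins and
  \<open>lower_bound_stage\<close> applies.\<close>

lemma lower_bound_step:
  assumes a: "0 < tan \<theta>1" and uv: "0 \<le> u" "0 \<le> v" and LB: "lower_bound u v"
  shows "lower_bound ((1 + v) / tan \<theta>1) v"
  unfolding lower_bound_def
proof (intro allI impI)
  fix s A assume s: "0 \<le> s" and A: "A \<in> sets (F s)" and A\<sigma>: "\<forall>w\<in>A. ereal s < \<sigma> w"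
  define f where "f = (\<lambda>w. ennreal ((1 + v) / tan \<theta>1 * X s w + v * Y s w))"
  define A0 where "A0 = A \<inter> {w \<in> space M. X s w \<le> 0}"
  define A1 where "A1 = A \<inter> {w \<in> space M. 0 < X s w}"
  \<comment> \<open>The stage estimate wants a bounded start; these sets supply the constant
    \<open>K\<close> and exhaust \<open>A1\<close>, so monotone convergence removes the
    truncation.\<close>
  define D where "D = (\<lambda>n::nat. A1 \<inter> {w \<in> space M. X s w + tan \<theta>1 * Y s w \<le> real n})"
  have XF[measurable]: "X s \<in> borel_measurable (F s)" "Y s \<in> borel_measurable (F s)"
    using X_adapted Y_adapted s unfolding adapted_def by auto
  have sets_F: "A0 \<in> sets (F s)" "A1 \<in> sets (F s)" "D n \<in> sets (F s)" for n
  proof -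
    have 1: "{w \<in> space (F s). X s w \<le> 0} \<in> sets (F s)" "{w \<in> space (F s). 0 < X s w} \<in> sets (F s)"
      "{w \<in> space (F s). X s w + tan \<theta>1 * Y s w \<le> real n} \<in> sets (F s)"
      by measurable
    show "A0 \<in> sets (F s)" "A1 \<in> sets (F s)" "D n \<in> sets (F s)"
      unfolding D_def A0_def A1_def using A 1[unfolded space_F] by (auto intro!: sets.Int)
  qed
  note sets_M[measurable] = sets_F[THEN sets_F_M]
  have [measurable]: "X s \<in> borel_measurable M" "Y s \<in> borel_measurable M" "future s \<in> borel_measurable M"
    using s path_measurable future_measurable by auto
  have [measurable]: "f \<in> borel_measurable M" unfolding f_def by measurable
  have A_space: "w \<in> space M" if "w \<in> A" for w
    using that A sets.sets_into_space[of A "F s"] by (auto simp: space_F)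
  have split: "indicator A w * z = indicator A0 w * z + indicator A1 w * z" for w and z :: ennreal
    using A_space by (auto simp: A0_def A1_def indicator_def)
  have 0: "(\<integral>\<^sup>+w. indicator A0 w * f w \<partial>M) \<le> (\<integral>\<^sup>+w. indicator A0 w * future s w \<partial>M)"
  proof -
    have "(\<integral>\<^sup>+w. indicator A0 w * f w \<partial>M) = (\<integral>\<^sup>+w. indicator A0 w * ennreal (u * X s w + v * Y s w) \<partial>M)"
    proof (intro nn_integral_cong)
      fix w assume "w \<in> space M"
      then have "X s w = 0" if "w \<in> A0" using that in_quadrant[of w s] s by (auto simp: A0_def)
      then show "indicator A0 w * f w = indicator A0 w * ennreal (u * X s w + v * Y s w)"
        by (cases "w \<in> A0") (simp_all add: f_def)
    qed
    also have "\<dots> \<le> (\<integral>\<^sup>+w. indicator A0 w * future s w \<partial>M)"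
      by (rule LB[unfolded lower_bound_def, rule_format, OF s sets_F(1)]) (use A\<sigma> in \<open>auto simp: A0_def\<close>)
    finally show ?thesis .
  qed
  have 1: "(\<integral>\<^sup>+w. indicator A1 w * f w \<partial>M) \<le> (\<integral>\<^sup>+w. indicator A1 w * future s w \<partial>M)"
  proof -
    have "(SUP n. indicator (D n) w * f w) = indicator A1 w * f w" for w
    proof (cases "w \<in> A1")
      case True
      obtain n :: nat where "X s w + tan \<theta>1 * Y s w \<le> real n" using real_arch_simple by blast
      then have "w \<in> D n" using True by (auto simp: D_def A1_def)
      then show ?thesis
        using True by (intro antisym SUP_least SUP_upper2[of n]) (auto simp: indicator_def)
    next
      case False
      then show ?thesis by (auto simp: D_def)
    qed
    then have "(\<integral>\<^sup>+w. indicator A1 w * f w \<partial>M) = (\<integral>\<^sup>+w. (SUP n. indicator (D n) w * f w) \<partial>M)" by simp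
    also have "\<dots> = (SUP n. \<integral>\<^sup>+w. indicator (D n) w * f w \<partial>M)"
      by (rule nn_integral_monotone_convergence_SUP)
         (auto simp: incseq_def le_fun_def D_def indicator_def)
    also have "\<dots> \<le> (\<integral>\<^sup>+w. indicator A1 w * future s w \<partial>M)"
    proof (rule SUP_least)
      fix n
      have "(\<integral>\<^sup>+w. indicator (D n) w * f w \<partial>M) \<le> (\<integral>\<^sup>+w. indicator (D n) w * future s w \<partial>M)"
        unfolding f_def
        by (rule lower_bound_stage[OF s a sets_F(3) _ uv LB, where K="real n"])
           (use A\<sigma> in \<open>auto simp: D_def A1_def\<close>)
      also have "\<dots> \<le> (\<integral>\<^sup>+w. indicator A1 w * future s w \<partial>M)"
        by (intro nn_integral_mono) (auto simp: D_def indicator_def)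
      finally show "(\<integral>\<^sup>+w. indicator (D n) w * f w \<partial>M) \<le> (\<integral>\<^sup>+w. indicator A1 w * future s w \<partial>M)" .
    qed
    finally show ?thesis .
  qed
  show "(\<integral>\<^sup>+w. indicator A w * ennreal ((1 + v) / tan \<theta>1 * X s w + v * Y s w) \<partial>M) \<le> (\<integral>\<^sup>+w. indicator A w * future s w \<partial>M)"
    unfolding split f_def[symmetric, THEN fun_cong]
    unfolding f_def[symmetric]
    using add_mono[OF 0 1] by (simp add: nn_integral_add f_def)
qed

text \<open>\<open>local_time\<close> is symmetric in the two sides, so \<open>future\<close> does
  not change under the exchange and the two notions of \<open>lower_bound\<close> differ only in the
  order of the coefficients.\<close>

lemma lower_bound_step_swap:
  assumes b: "0 < tan \<theta>2" and uv: "0 \<le> u" "0 \<le> v" and LB: "lower_bound u v"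
  shows "lower_bound u ((1 + u) / tan \<theta>2)"
proof -
  interpret swap: oblique_reflected_brownian_motion M F "\<lambda>t w. prod.swap (B t w)" \<theta>2 \<theta>1 y x Y X LY LX
    by (rule oblique_reflected_brownian_motion_swap)
  have "swap.local_time = local_time"
    by (auto simp: fun_eq_iff swap.local_time_def local_time_def)
  then have "swap.future = future"
    by (auto simp: fun_eq_iff swap.future_def future_def corner_time_commute[of Y X])
  then have eq: "swap.lower_bound v u \<longleftrightarrow> lower_bound u v" for u v
    unfolding swap.lower_bound_def lower_bound_def by (simp add: corner_time_commute[of Y X] add.commute)
  show ?thesis
    using swap.lower_bound_step[OF b uv(2,1)] LB unfolding eq by simp
qed

subsection \<open>The total local time\<close>

text \<open>A countable supremum takes the place of the left limit at \<open>\<sigma>\<close>;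
  \<open>terminal_value_eq\<close> identifies the two.\<close>

definition "total_local_time = sup_before \<sigma> local_time 0"

lemma local_time_le_total:
  assumes "regular_path w" "0 \<le> r" "ereal r < \<sigma> w"
  shows "ennreal (local_time r w) \<le> total_local_time w"
  unfolding total_local_time_def
  by (rule sup_before_upper[where L=local_time]) (use assms local_time_mono in auto)

lemma corner_time_pos:
  assumes x: "0 < x" and w: "w \<in> space M" and reg: "regular_path w"
  shows "0 < \<sigma> w"
proof (rule ccontr)
  assume "\<not> 0 < \<sigma> w"
  then have "\<sigma> w = ereal 0" using corner_time_nonneg[OF w] by (simp add: zero_ereal_def)
  from at_corner_time[OF w this] show False using regular_pathD(1)[OF reg] x by simp
qed

text \<open>The iteration starts from the trivial bound with both coefficients 0. Each round
  improves \<open>v\<close> through the exchanged process and then \<open>u\<close>; since the start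
  has \<open>Y = 0\<close>, only \<open>u\<close> appears in the result.\<close>

lemma total_local_time_ge:
  assumes ab: "0 < tan \<theta>1" "0 < tan \<theta>2" and x: "0 < x" and y: "y = 0"
  defines "U \<equiv> \<lambda>n. ((\<lambda>u. (1 + (1 + u) / tan \<theta>2) / tan \<theta>1) ^^ n) 0"
  shows "ennreal (U n * x) \<le> (\<integral>\<^sup>+w. total_local_time w \<partial>M)"
proof -
  have "0 \<le> U n \<and> (\<exists>v\<ge>0. lower_bound (U n) v)" for n
  proof (induction n)
    case 0
    have "lower_bound 0 0" by (simp add: lower_bound_def)
    then show ?case by (auto simp: U_def)
  next
    case (Suc n)
    then obtain v where v: "0 \<le> v" "lower_bound (U n) v" and u: "0 \<le> U n" by auto
    define v' where "v' = (1 + U n) / tan \<theta>2"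
    have v': "0 \<le> v'" using u ab by (simp add: v'_def)
    have "lower_bound (U n) v'"
      unfolding v'_def by (rule lower_bound_step_swap[OF ab(2) u v])
    from lower_bound_step[OF ab(1) u v' this]
    have "lower_bound (U (Suc n)) v'" by (simp add: U_def v'_def)
    moreover have "0 \<le> U (Suc n)" using u ab by (simp add: U_def)
    ultimately show ?case using v' by blast
  qed
  then obtain v where u: "0 \<le> U n" and v: "0 \<le> v" "lower_bound (U n) v" by blast
  \<comment> \<open>\<open>lower_bound\<close> asks for paths alive at time 0 without exception.
    Because \<open>x\<close> is positive, this set has full measure.\<close>
  define A where "A = {w \<in> space M. 0 < \<sigma> w}"
  have A: "A \<in> sets (F 0)"
  proof -
    have "A = space M - {w \<in> space M. \<sigma> w \<le> ereal 0}" by (auto simp: A_def zero_ereal_def)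
    then show ?thesis
      using corner_time_stopping[of 0] sets.compl_sets[of _ "F 0"] by (simp add: space_F)
  qed
  have "ennreal (U n * x) = (\<integral>\<^sup>+w. ennreal (U n * x) \<partial>M)" by (simp add: emeasure_space_1)
  also have "\<dots> = (\<integral>\<^sup>+w. indicator A w * ennreal (U n * X 0 w + v * Y 0 w) \<partial>M)"
  proof (rule nn_integral_cong_AE)
    show "AE w in M. ennreal (U n * x) = indicator A w * ennreal (U n * X 0 w + v * Y 0 w)"
      using AE_regular_path AE_space
    proof eventually_elim
      case (elim w)
      then have "w \<in> A" using corner_time_pos[OF x] by (simp add: A_def)
      then show ?case using regular_pathD(1,2)[OF elim(1)] y by simp
    qed
  qed
  also have "\<dots> \<le> (\<integral>\<^sup>+w. indicator A w * future 0 w \<partial>M)"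
    by (rule v(2)[unfolded lower_bound_def, rule_format, OF order_refl A]) (simp add: A_def zero_ereal_def[symmetric])
  also have "\<dots> \<le> (\<integral>\<^sup>+w. total_local_time w \<partial>M)"
  proof (rule nn_integral_mono_AE)
    show "AE w in M. indicator A w * future 0 w \<le> total_local_time w"
      using AE_regular_path
    proof eventually_elim
      case (elim w)
      have "future 0 w \<le> total_local_time w"
        unfolding future_def
      proof (rule sup_before_least)
        fix r assume r: "0 \<le> r" "ereal r < \<sigma> w"
        have "ereal 0 < \<sigma> w" using r by (auto intro: le_less_trans[of "ereal 0" "ereal r"])
        then have "0 \<le> local_time 0 w"
          unfolding local_time_def using regular_pathD(3,4)[OF elim order_refl] by simp
        then have "ennreal (local_time r w - local_time 0 w) \<le> ennreal (local_time r w)"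
          by (intro ennreal_leI) simp
        also have "\<dots> \<le> total_local_time w"
          by (rule local_time_le_total[OF elim r])
        finally show "ennreal (local_time r w - local_time 0 w) \<le> total_local_time w" .
      qed
      then show ?case by (auto simp: indicator_def)
    qed
  qed
  finally show ?thesis .
qed

text \<open>A nonnegative linear function of the position plus a positive multiple of the local time
  is a linear functional of the motion, so its mean at bounded stopping times stays at the initial
  value. Discarding the position bounds the mean local time.\<close>

lemma total_local_time_le:
  assumes ab: "0 < tan \<theta>1" "0 < tan \<theta>2" "1 < tan \<theta>1 * tan \<theta>2" and x: "0 < x" and y: "y = 0"
  shows "(\<integral>\<^sup>+w. total_local_time w \<partial>M) \<le> ennreal (x * (tan \<theta>2 + 1) / (tan \<theta>1 * tan \<theta>2 - 1))"
proof -
  define d where "d = tan \<theta>1 * tan \<theta>2 - 1"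
  define c where "c = (1 + tan \<theta>2) * x"
  have d: "0 < d" using ab by (simp add: d_def)
  \<comment> \<open>With \<open>a = tan \<theta>1\<close> and \<open>b = tan \<theta>2\<close>, the
    weights \<open>1 + b\<close> for \<open>X\<close> and \<open>1 + a\<close> for \<open>Y\<close>
    are chosen so that \<open>LX\<close> and \<open>LY\<close> both enter with the factor 1 - ab,
    which is \<open>- d\<close>: their coefficients are \<open>(1 + b) - b * (1 + a)\<close> and
    \<open>(1 + a) - a * (1 + b)\<close>.\<close>
  define W where "W = (\<lambda>r w. c + ((1 + tan \<theta>2) * dB1 0 r w + (1 + tan \<theta>1) * dB2 0 r w))"
  have W: "d * local_time r w \<le> W r w" if reg: "regular_path w" and w: "w \<in> space M" and r: "0 \<le> r" "ereal r < \<sigma> w" for r w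
  proof -
    have "W r w - d * local_time r w = (1 + tan \<theta>2) * X r w + (1 + tan \<theta>1) * Y r w"
      unfolding regular_pathD(5,6)[OF reg r] W_def c_def d_def local_time_def Bc_0 y by (simp add: algebra_simps)
    moreover have "0 \<le> (1 + tan \<theta>2) * X r w + (1 + tan \<theta>1) * Y r w"
      using in_quadrant[OF w r(1)] ab by simp
    ultimately show ?thesis by linarith
  qed
  define \<tau> where "\<tau> = (\<lambda>n w. real_of_ereal (max (ereal 0) (min (\<sigma> w) (ereal (real n)))))"
  have stopped: "integrable M (\<lambda>w. W (\<tau> n w) w)" "(LINT w|M. W (\<tau> n w) w) = c" for n
  proof -
    have sp: "space M \<in> sets (F 0)" using sets.top[of "F 0"] by (simp add: space_F)
    have "integrable M (\<lambda>w. indicator (space M) w * W (\<tau> n w) w)"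
      unfolding \<tau>_def W_def by (rule integrable_stopped_linear[OF order_refl _ corner_time_stopping sp, where K="\<bar>c\<bar>"]) auto
    then show "integrable M (\<lambda>w. W (\<tau> n w) w)" by (simp cong: Bochner_Integration.integrable_cong)
    have "(LINT w|M. indicator (space M) w * W (\<tau> n w) w) = (LINT w|M. indicator (space M) w * c)"
      unfolding \<tau>_def W_def by (rule expectation_stopped_linear[OF order_refl _ corner_time_stopping sp, where K="\<bar>c\<bar>"]) auto
    then show "(LINT w|M. W (\<tau> n w) w) = c" by (simp add: prob_space cong: Bochner_Integration.integral_cong)
  qed
  have W_tau: "0 \<le> W (\<tau> n w) w \<and> sup_before (\<lambda>w. min (\<sigma> w) (ereal (real n))) local_time 0 w \<le> ennreal (W (\<tau> n w) w / d)"
    if reg: "regular_path w" and w: "w \<in> space M" and n: "0 < n" for n w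
  proof -
    define t where "t = \<tau> n w"
    have t: "ereal t = min (\<sigma> w) (ereal (real n))"
      using corner_time_nonneg[OF w] unfolding t_def \<tau>_def
      by (subst ereal_real) (auto simp: min_def max_def zero_ereal_def[symmetric])
    have "0 < ereal t" unfolding t using corner_time_pos[OF x w reg] n by (simp add: min_def)
    then have t0: "0 < t" by simp
    \<comment> \<open>At \<open>t\<close> itself the equations may fail, since \<open>t\<close> may
      be the corner time. The comparison is made slightly earlier, where the local time is at least
      that at \<open>r\<close>, and passes to the left limit by continuity of
      \<open>W\<close>.\<close>
    have bound: "d * local_time r w \<le> W t w" if r: "0 \<le> r" "ereal r < ereal t" for r
    proof (rule tendsto_lowerbound)
      have "continuous_on {0..t} (\<lambda>r. Bc r w)"
        by (rule continuous_on_subset[OF Bc_continuous]) auto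
      then have "continuous_on {0..t} (\<lambda>r. W r w)" unfolding W_def by (intro continuous_intros)
      then show "((\<lambda>r. W r w) \<longlongrightarrow> W t w) (at_left t)" using t0 by (rule continuous_on_Icc_at_leftD)
      have "r < t" using r by simp
      then show "\<forall>\<^sub>F r' in at_left t. d * local_time r w \<le> W r' w"
      proof (rule eventually_mono[OF eventually_at_left_real])
        fix r' assume r': "r' \<in> {r<..<t}"
        then have "ereal r' < min (\<sigma> w) (ereal (real n))" unfolding t[symmetric] by simp
        then have r'\<sigma>: "ereal r' < \<sigma> w" by simp
        have "d * local_time r w \<le> d * local_time r' w"
          using r r' r'\<sigma> d by (intro mult_left_mono local_time_mono[OF reg]) auto
        also have "\<dots> \<le> W r' w" using r r' r'\<sigma> by (intro W reg w) auto
        finally show "d * local_time r w \<le> W r' w" .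
      qed
    qed simp
    have "0 \<le> d * local_time 0 w"
      unfolding local_time_def
      using regular_pathD(3,4)[OF reg order_refl] corner_time_pos[OF x w reg] d by (simp add: zero_ereal_def)
    then have nn: "0 \<le> W t w" using bound[of 0] t0 by simp
    have "sup_before (\<lambda>w. min (\<sigma> w) (ereal (real n))) local_time 0 w \<le> ennreal (W t w / d)"
    proof (rule sup_before_least)
      fix r assume "0 \<le> r" "ereal r < min (\<sigma> w) (ereal (real n))"
      then have "d * local_time r w \<le> W t w" unfolding t[symmetric] by (rule bound)
      then show "ennreal (local_time r w) \<le> ennreal (W t w / d)"
        using d by (intro ennreal_leI) (simp add: field_simps)
    qed
    then show ?thesis using nn by (simp add: t_def)
  qed
  \<comment> \<open>Optional stopping is available up to bounded times, and monotone convergence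
    removes the bound. The successor keeps the time horizon positive, as \<open>W_tau\<close>
    requires.\<close>
  define S where "S = (\<lambda>n. sup_before (\<lambda>w. min (\<sigma> w) (ereal (real (Suc n)))) local_time 0)"
  have S_meas: "S n \<in> borel_measurable M" for n
    unfolding S_def
    by (intro sup_before_measurable path_measurable borel_measurable_min corner_time_measurable) auto
  have "total_local_time w \<le> (SUP n. S n w)" for w
    unfolding total_local_time_def
  proof (rule sup_before_least)
    fix r assume r: "r \<in> \<rat>" "0 \<le> r" "ereal r < \<sigma> w"
    obtain n :: nat where n: "r \<le> real n" using real_arch_simple by blast
    have "ennreal (local_time r w) \<le> S n w"
      unfolding S_def sup_before_def using r n by (intro SUP_upper2[of r]) auto
    then show "ennreal (local_time r w) \<le> (SUP n. S n w)" by (rule SUP_upper2[OF UNIV_I])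
  qed
  then have "(\<integral>\<^sup>+w. total_local_time w \<partial>M) \<le> (\<integral>\<^sup>+w. (SUP n. S n w) \<partial>M)" by (intro nn_integral_mono)
  also have "\<dots> = (SUP n. \<integral>\<^sup>+w. S n w \<partial>M)"
  proof (rule nn_integral_monotone_convergence_SUP[OF _ S_meas])
    show "incseq S"
    proof (intro incseq_SucI le_funI)
      fix n w
      show "S n w \<le> S (Suc n) w"
        unfolding S_def
      proof (rule sup_before_least)
        fix r assume r: "r \<in> \<rat>" "0 \<le> r" "ereal r < min (\<sigma> w) (ereal (real (Suc n)))"
        then have "ereal r < min (\<sigma> w) (ereal (real (Suc (Suc n))))" by auto
        then show "ennreal (local_time r w) \<le> sup_before (\<lambda>w. min (\<sigma> w) (ereal (real (Suc (Suc n))))) local_time 0 w"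
          unfolding sup_before_def using r by (intro SUP_upper2[of r]) auto
      qed
    qed
  qed
  also have "\<dots> \<le> ennreal (c / d)"
  proof (rule SUP_least)
    fix n
    have "(\<integral>\<^sup>+w. S n w \<partial>M) \<le> (\<integral>\<^sup>+w. ennreal (W (\<tau> (Suc n) w) w / d) \<partial>M)"
    proof (rule nn_integral_mono_AE)
      show "AE w in M. S n w \<le> ennreal (W (\<tau> (Suc n) w) w / d)"
        using AE_regular_path AE_space
        by eventually_elim (unfold S_def, rule W_tau[THEN conjunct2], simp_all)
    qed
    also have "\<dots> = ennreal (LINT w|M. W (\<tau> (Suc n) w) w / d)"
    proof (rule nn_integral_eq_integral)
      show "integrable M (\<lambda>w. W (\<tau> (Suc n) w) w / d)" using stopped(1) by simp
      show "AE w in M. 0 \<le> W (\<tau> (Suc n) w) w / d"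
        using AE_regular_path AE_space by eventually_elim (use W_tau d in auto)
    qed
    also have "(LINT w|M. W (\<tau> (Suc n) w) w / d) = c / d" using stopped(2) by simp
    finally show "(\<integral>\<^sup>+w. S n w \<partial>M) \<le> ennreal (c / d)" .
  qed
  also have "c / d = x * (tan \<theta>2 + 1) / (tan \<theta>1 * tan \<theta>2 - 1)"
    by (simp add: c_def d_def mult.commute add.commute)
  finally show ?thesis .
qed

text \<open>The left limit of a monotone function is its supremum. \<open>0 < \<sigma> w\<close>
  makes the left neighbourhood nontrivial, so \<open>Lim\<close> is a genuine, unique limit.\<close>

lemma terminal_value_eq:
  assumes pos: "0 < \<sigma> w" and reg: "regular_path w"
  shows "terminal_value \<sigma> local_time w = total_local_time w"
proof -
  let ?f = "\<lambda>t. ennreal (local_time (real_of_ereal t) w)"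
  have ev: "(\<forall>\<^sub>F t in at_left (\<sigma> w). P t) \<longleftrightarrow> (\<exists>b<\<sigma> w. \<forall>t>b. t < \<sigma> w \<longrightarrow> P t)" for P
    by (rule eventually_at_left[OF pos])
  have nt: "at_left (\<sigma> w) \<noteq> bot"
    unfolding trivial_limit_def ev using dense by blast
  have real: "ereal (real_of_ereal t) = t" if "ereal r \<le> t" "t < \<sigma> w" for r t
    using that by (cases t) auto
  have "(?f \<longlongrightarrow> total_local_time w) (at_left (\<sigma> w))"
  proof (rule order_tendstoI)
    fix z assume "z < total_local_time w"
    from this[unfolded total_local_time_def sup_before_def less_SUP_iff]
    obtain r where r: "0 \<le> r" "z < (if ereal r < \<sigma> w then ennreal (local_time r w) else 0)"
      by blast
    then have r\<sigma>: "ereal r < \<sigma> w" and z: "z < ennreal (local_time r w)" by (auto split: if_splits)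
    show "\<forall>\<^sub>F t in at_left (\<sigma> w). z < ?f t"
      unfolding ev
    proof (intro exI[of _ "ereal r"] conjI r\<sigma> allI impI)
      fix t assume t: "ereal r < t" "t < \<sigma> w"
      have rt: "ereal (real_of_ereal t) = t" using t by (intro real[of r]) auto
      have "ereal r \<le> ereal (real_of_ereal t)" using t(1) by (simp only: rt less_imp_le)
      then have "r \<le> real_of_ereal t" by simp
      then have "ennreal (local_time r w) \<le> ?f t"
        using t r by (intro ennreal_leI local_time_mono[OF reg]) (auto simp: rt)
      then show "z < ?f t" using z by simp
    qed
  next
    fix z assume z: "total_local_time w < z"
    show "\<forall>\<^sub>F t in at_left (\<sigma> w). ?f t < z"
      unfolding ev
    proof (intro exI[of _ 0] conjI pos allI impI)
      fix t assume t: "0 < t" "t < \<sigma> w"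
      have rt: "ereal (real_of_ereal t) = t" using t by (intro real[of 0]) (auto simp: zero_ereal_def)
      have "?f t \<le> total_local_time w"
        by (rule local_time_le_total[OF reg]) (use t rt in \<open>auto intro: real_of_ereal_pos\<close>)
      then show "?f t < z" using z by simp
    qed
  qed
  then show ?thesis
    unfolding terminal_value_def by (rule tendsto_Lim[OF nt])
qed

lemma nn_integral_terminal_value:
  assumes "0 < x"
  shows "(\<integral>\<^sup>+w. terminal_value \<sigma> (\<lambda>t w. LX t w + LY t w) w \<partial>M) = (\<integral>\<^sup>+w. total_local_time w \<partial>M)"
proof (rule nn_integral_cong_AE)
  show "AE w in M. terminal_value \<sigma> (\<lambda>t w. LX t w + LY t w) w = total_local_time w"
    using AE_regular_path AE_space
    by eventually_elim
       (use terminal_value_eq corner_time_pos[OF assms] in \<open>simp add: local_time_def[abs_def]\<close>)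
qed

end

section \<open>Affine recursions and the conclusion\<close>

lemma affine_iterate:
  fixes r c :: real
  assumes "r \<noteq> 1"
  shows "((\<lambda>u. r * u + c) ^^ n) 0 = c * (1 - r ^ n) / (1 - r)"
proof (induction n)
  case (Suc n)
  have "((\<lambda>u. r * u + c) ^^ Suc n) 0 = r * (c * (1 - r ^ n) / (1 - r)) + c" by (simp add: Suc)
  also have "\<dots> = c * (1 - r ^ Suc n) / (1 - r)" using assms by (simp add: field_simps)
  finally show ?case .
qed simp

text \<open>Without contraction nothing already gained is lost, so every iteration adds at least
  \<open>c\<close>.\<close>

lemma affine_iterate_ge:
  fixes r c :: real
  assumes "1 \<le> r" "0 \<le> c"
  shows "real n * c \<le> ((\<lambda>u. r * u + c) ^^ n) 0"
proof (induction n)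
  case (Suc n)
  let ?w = "((\<lambda>u. r * u + c) ^^ n) 0"
  have "0 \<le> ?w" by (rule order_trans[OF _ Suc]) (use assms in simp)
  then have "1 * ?w \<le> r * ?w" using assms by (intro mult_right_mono) auto
  then show ?case using Suc by (simp add: algebra_simps)
qed simp

theorem proposition2p13:
  fixes M :: "'w measure" and F :: "real \<Rightarrow> 'w measure"
    and B :: "real \<Rightarrow> 'w \<Rightarrow> real \<times> real"
    and X Y LX LY :: "real \<Rightarrow> 'w \<Rightarrow> real"
    and \<theta>1 \<theta>2 x :: real
  assumes "0 < \<theta>1" "\<theta>1 < pi / 2" "0 < \<theta>2" "\<theta>2 < pi / 2" "0 < x"
    and "oblique_reflected_brownian_motion M F B \<theta>1 \<theta>2 x 0 X Y LX LY"
  defines "\<sigma>0 \<equiv> corner_time X Y"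
    and "L \<equiv> (\<lambda>t \<omega>. LX t \<omega> + LY t \<omega>)"
  shows "(tan \<theta>1 * tan \<theta>2 > 1 \<longrightarrow>
            (\<integral>\<^sup>+ \<omega>. terminal_value \<sigma>0 L \<omega> \<partial>M)
               = ennreal (x * (tan \<theta>2 + 1) / (tan \<theta>1 * tan \<theta>2 - 1)) \<and>
            (\<integral>\<^sup>+ \<omega>. terminal_value \<sigma>0 L \<omega> \<partial>M) < \<infinity>)
       \<and> (tan \<theta>1 * tan \<theta>2 \<le> 1 \<longrightarrow>
            (\<integral>\<^sup>+ \<omega>. terminal_value \<sigma>0 L \<omega> \<partial>M) = \<infinity>)"
proof -
  interpret oblique_reflected_brownian_motion M F B \<theta>1 \<theta>2 x 0 X Y LX LY by fact
  have ab: "0 < tan \<theta>1" "0 < tan \<theta>2" using assms by (auto intro: tan_gt_zero)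
  \<comment> \<open>Two consecutive stages act on the coefficient \<open>u\<close> as the affine map
    with slope \<open>r\<close> and offset \<open>c\<close>. It is a contraction exactly if the
    product of the tangents exceeds 1.\<close>
  define r where "r = 1 / (tan \<theta>1 * tan \<theta>2)"
  define c where "c = (1 + tan \<theta>2) / (tan \<theta>1 * tan \<theta>2)"
  define I where "I = (\<integral>\<^sup>+w. total_local_time w \<partial>M)"
  have I: "(\<integral>\<^sup>+ w. terminal_value \<sigma>0 L w \<partial>M) = I"
    unfolding \<sigma>0_def L_def I_def by (rule nn_integral_terminal_value) fact
  have "(1 + (1 + u) / tan \<theta>2) / tan \<theta>1 = r * u + c" for u
    using ab by (simp add: r_def c_def field_simps)
  then have ge: "ennreal (((\<lambda>u. r * u + c) ^^ n) 0 * x) \<le> I" for n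
    using total_local_time_ge[OF ab \<open>0 < x\<close> refl, of n] by (simp add: I_def)
  show ?thesis
    unfolding I
  proof (intro conjI impI)
    assume gt: "1 < tan \<theta>1 * tan \<theta>2"
    then have r: "0 < r" "r < 1" using ab by (simp_all add: r_def)
    have "ennreal (x * (tan \<theta>2 + 1) / (tan \<theta>1 * tan \<theta>2 - 1)) \<le> I"
    proof (rule LIMSEQ_le_const2)
      have "(\<lambda>n. c * (1 - r ^ n) / (1 - r) * x) \<longlonglongrightarrow> c * (1 - 0) / (1 - r) * x"
        using r by (intro tendsto_intros LIMSEQ_realpow_zero) auto
      \<comment> \<open>\<open>c / (1 - r)\<close> is the fixed point of the recursion, and clearing
        the product of the tangents gives the stated constant.\<close>
      moreover have "c * (1 - 0) / (1 - r) * x = x * (tan \<theta>2 + 1) / (tan \<theta>1 * tan \<theta>2 - 1)"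
        using ab gt by (simp add: c_def r_def field_simps)
      ultimately show "(\<lambda>n. ennreal (((\<lambda>u. r * u + c) ^^ n) 0 * x))
          \<longlonglongrightarrow> ennreal (x * (tan \<theta>2 + 1) / (tan \<theta>1 * tan \<theta>2 - 1))"
        using r by (intro tendsto_ennrealI) (simp add: affine_iterate)
    qed (use ge in auto)
    moreover have "I \<le> ennreal (x * (tan \<theta>2 + 1) / (tan \<theta>1 * tan \<theta>2 - 1))"
      unfolding I_def by (rule total_local_time_le[OF ab gt \<open>0 < x\<close> refl])
    ultimately show "I = ennreal (x * (tan \<theta>2 + 1) / (tan \<theta>1 * tan \<theta>2 - 1))" by (rule antisym[rotated])
    then show "I < \<infinity>" by simp
  next
    assume le: "tan \<theta>1 * tan \<theta>2 \<le> 1"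
    have r: "1 \<le> r" and c: "0 < c" using ab le by (simp_all add: r_def c_def)
    show "I = \<infinity>"
    proof (cases I)
      \<comment> \<open>A finite value of the expectation would be overtaken by the linear growth of
        the iterates.\<close>
      case (real z)
      obtain n :: nat where n: "z < real n * (c * x)"
        using reals_Archimedean3[of "c * x"] c \<open>0 < x\<close> by auto
      have "real n * c * x \<le> ((\<lambda>u. r * u + c) ^^ n) 0 * x"
        using affine_iterate_ge[OF r, of c n] c \<open>0 < x\<close> by (intro mult_right_mono) auto
      then have "ennreal (real n * c * x) \<le> ennreal z"
        using order_trans[OF ennreal_leI ge[of n]] real by simp
      then show ?thesis using n real by (simp add: mult.assoc)
    qed simp
  qed
qed

end
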